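(* Let $G$ be a finite $3$-regular graph with (vertex) connectivity $3$, and let $L$ be a $3$-assignment for $G$. Then $G$ is $L$-swappable unless either (a) $G=K_4$, or (b) $G=K_2\,\square\,K_3$ and $L(v)=L(w)$ for all $v,w\in V(G)$.
   Context: A list-assignment $L$ assigns to each vertex $v$ a set $L(v)$ of colors; a $3$-assignment has $|L(v)|=3$ for all $v$. An $L$-coloring is a proper coloring $\varphi$ with $\varphi(v)\in L(v)$. An $\alpha,\beta$-Kempe swap at a vertex $u$ with $\varphi(u)\in\{\alpha,\beta\}$ interchanges $\alpha$ and $\beta$ on the component containing $u$ of the subgraph induced by vertices colored $\alpha$ or $\beta$; it is $L$-valid if the result is again an $L$-coloring. Two $L$-colorings are $L$-equivalent if one is obtained from the other by a sequence of $L$-valid Kempe swaps. $G$ is $L$-swappable if it has an $L$-coloring and all its $L$-colorings are pairwise $L$-equivalent. $K_2\,\square\,K_3$ denotes the Cartesian product of $K_2$ and $K_3$ (the triangular prism). *)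

theory Defs
  imports "Graph_Theory.Graph_Theory" "HOL-Library.FuncSet" "HOL-Combinatorics.Transposition"
begin

text \<open>Finite simple graphs are the symmetric loop-free finite digraphs of locale \<open>pair_graph\<close>:
  every edge \<open>uv\<close> is represented by the two arcs \<open>(u, v)\<close> and \<open>(v, u)\<close>, so the degree of a vertex
  is its out-degree.\<close>

definition regular :: "nat \<Rightarrow> ('a, 'b) pre_digraph \<Rightarrow> bool" where
  "regular k G \<longleftrightarrow> (\<forall>v \<in> verts G. out_degree G v = k)"

text \<open>The least number of vertices whose deletion leaves a disconnected graph or a single vertex;
  in particular, the connectivity of the complete graph on \<open>n\<close> vertices is \<open>n - 1\<close>.\<close>

definition vertex_connectivity :: "('a, 'b) pre_digraph \<Rightarrow> nat" where
  "vertex_connectivity G =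
     (LEAST k. \<exists>S \<subseteq> verts G. card S = k \<and>
        (\<not> connected (G \<restriction> (verts G - S)) \<or> card (verts G - S) = 1))"

definition complete_graph :: "nat \<Rightarrow> nat pair_pre_digraph" where
  "complete_graph n =
     \<lparr> pverts = {..<n}, parcs = {(i, j). i < n \<and> j < n \<and> i \<noteq> j} \<rparr>"

definition cartesian_product ::
  "'a pair_pre_digraph \<Rightarrow> 'b pair_pre_digraph \<Rightarrow> ('a \<times> 'b) pair_pre_digraph"
  (infixr \<open>\<box>\<close> 75) where
  "G \<box> H =
     \<lparr> pverts = pverts G \<times> pverts H,
       parcs = {((a, b), (a', b')).
         (a = a' \<and> a \<in> pverts G \<and> (b, b') \<in> parcs H) \<or>
         ((a, a') \<in> parcs G \<and> b = b' \<and> b \<in> pverts H)} \<rparr>"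

definition list_assignment :: "nat \<Rightarrow> ('a, 'b) pre_digraph \<Rightarrow> ('a \<Rightarrow> 'c set) \<Rightarrow> bool" where
  "list_assignment k G L \<longleftrightarrow> (\<forall>v \<in> verts G. card (L v) = k)"

text \<open>Colorings are extensional functions on the vertex set, so that two colorings are equal as
  soon as they agree on all vertices.\<close>

definition list_coloring ::
  "('a, 'b) pre_digraph \<Rightarrow> ('a \<Rightarrow> 'c set) \<Rightarrow> ('a \<Rightarrow> 'c) \<Rightarrow> bool" where
  "list_coloring G L \<phi> \<longleftrightarrow>
     \<phi> \<in> (\<Pi>\<^sub>E v \<in> verts G. L v) \<and> (\<forall>(u, v) \<in> arcs_ends G. \<phi> u \<noteq> \<phi> v)"

text \<open>In a symmetric digraph the strongly connected components are the components of the
  underlying undirected graph.\<close>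

definition kempe_component ::
  "('a, 'b) pre_digraph \<Rightarrow> ('a \<Rightarrow> 'c) \<Rightarrow> 'c \<Rightarrow> 'c \<Rightarrow> 'a \<Rightarrow> 'a set" where
  "kempe_component G \<phi> \<alpha> \<beta> u =
     pre_digraph.scc_of (G \<restriction> {w \<in> verts G. \<phi> w \<in> {\<alpha>, \<beta>}}) u"

definition kempe_swap ::
  "('a, 'b) pre_digraph \<Rightarrow> 'c \<Rightarrow> 'c \<Rightarrow> 'a \<Rightarrow> ('a \<Rightarrow> 'c) \<Rightarrow> 'a \<Rightarrow> 'c" where
  "kempe_swap G \<alpha> \<beta> u \<phi> =
     (\<lambda>v. if v \<in> kempe_component G \<phi> \<alpha> \<beta> u then Transposition.transpose \<alpha> \<beta> (\<phi> v) else \<phi> v)"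

definition valid_kempe_step ::
  "('a, 'b) pre_digraph \<Rightarrow> ('a \<Rightarrow> 'c set) \<Rightarrow> ('a \<Rightarrow> 'c) \<Rightarrow> ('a \<Rightarrow> 'c) \<Rightarrow> bool" where
  "valid_kempe_step G L \<phi> \<psi> \<longleftrightarrow>
     list_coloring G L \<phi> \<and> list_coloring G L \<psi> \<and>
     (\<exists>u \<in> verts G. \<exists>\<alpha> \<beta>. \<alpha> \<noteq> \<beta> \<and> \<phi> u \<in> {\<alpha>, \<beta>} \<and> \<psi> = kempe_swap G \<alpha> \<beta> u \<phi>)"

definition kempe_equivalent ::
  "('a, 'b) pre_digraph \<Rightarrow> ('a \<Rightarrow> 'c set) \<Rightarrow> ('a \<Rightarrow> 'c) \<Rightarrow> ('a \<Rightarrow> 'c) \<Rightarrow> bool" where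
  "kempe_equivalent G L = (valid_kempe_step G L)\<^sup>*\<^sup>*"

definition swappable :: "('a, 'b) pre_digraph \<Rightarrow> ('a \<Rightarrow> 'c set) \<Rightarrow> bool" where
  "swappable G L \<longleftrightarrow>
     (\<exists>\<phi>. list_coloring G L \<phi>) \<and>
     (\<forall>\<phi> \<psi>. list_coloring G L \<phi> \<longrightarrow> list_coloring G L \<psi> \<longrightarrow> kempe_equivalent G L \<phi> \<psi>)"

end

theory Submission
  imports Defs
begin

text \<open>Call a color of \<open>x\<close> exposed if some neighbor of \<open>x\<close> lacks it. Once a few vertices are colored,
  a vertex that sees two equal colors, or a color outside its list, has slack, and if every component of the
  rest contains such a vertex, then all extensions exist and are Kempe equivalent by a greedy argument.
  Hence, by connectivity, all colorings giving a fixed exposed color to \<open>x\<close> are equivalent, and so are all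
  colorings that give a fixed common color to two neighbors of a vertex. If the lists differ, then any two
  classes of the first kind are linked by common colorings, and every coloring lies in a class of the second
  kind that meets one of the first kind. If the lists are constant, then every coloring lies in a class of the
  second kind at every vertex, and it suffices to link the three pairs of neighbors of a single vertex. Components
  without slack that obstruct these links hang on three edges, and then they can be colored by 3-connectivity,
  or they yield a triangle, a prism, or a small edge cut, which is excluded by the choice of the vertex.\<close>

section \<open>Kempe swaps on unions of components\<close>

text \<open>Deleting at most two vertices leaves a connected graph, so there a single vertex with
  slack is enough; this is why the classes fix the color of one vertex or of one pair. Linking two
  classes takes a coloring that lies in both, hence up to four fixed vertices, and then some
  components may be left without slack. Since degrees equal list sizes, greedy coloring has nothing
  to spare there. The remedy is a dichotomy for a part that hangs on three edges: it can be colored,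
  or all its vertices keep one and the same list, of size equal to their degree inside the part. The
  second alternative is rigid enough to be refuted by a repeated color on the three legs, or to be
  exploited because it makes new colors exposed. That each leg is a single edge is again forced by
  3-connectivity: the remaining vertices also need three attachments, and these use up the other
  edges. A second obstacle is that swaps must respect the lists: a chain may grow into a vertex that
  cannot take the other color, so such a vertex has to be recolored before the swap. Excluding four
  vertices is what rules out two triangles with a common edge.\<close>

locale simple_graph =
  fixes E :: "'a \<Rightarrow> 'a \<Rightarrow> bool"
  assumes E_sym: "E u v \<Longrightarrow> E v u"
    and E_irrefl: "\<not> E u u"
begin

definition nb :: "'a \<Rightarrow> 'a set" where
  "nb v = {u. E v u}"

text \<open>These are the unions of connected components of the subgraph induced on
  \<open>U\<close>; with them neither paths nor components have to be handled.\<close>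

definition nb_closed :: "'a set \<Rightarrow> 'a set \<Rightarrow> bool" where
  "nb_closed U A \<longleftrightarrow> A \<subseteq> U \<and> (\<forall>u\<in>A. \<forall>w\<in>U. E u w \<longrightarrow> w \<in> A)"

text \<open>Values outside \<open>U\<close> are left free, so that one function can be regarded as a
  coloring of several sets.\<close>

definition coloring :: "'a set \<Rightarrow> ('a \<Rightarrow> 'c set) \<Rightarrow> ('a \<Rightarrow> 'c) \<Rightarrow> bool" where
  "coloring U L f \<longleftrightarrow> (\<forall>u\<in>U. f u \<in> L u) \<and> (\<forall>u\<in>U. \<forall>w\<in>U. E u w \<longrightarrow> f u \<noteq> f w)"

text \<open>\<open>C\<close> is a union of Kempe components rather than a single one.\<close>

definition swap_on :: "'a set \<Rightarrow> 'c \<Rightarrow> 'c \<Rightarrow> 'a set \<Rightarrow> ('a \<Rightarrow> 'c) \<Rightarrow> ('a \<Rightarrow> 'c) \<Rightarrow> bool" where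
  "swap_on U \<alpha> \<beta> C f g \<longleftrightarrow> C \<subseteq> U \<and> (\<forall>z\<in>C. f z \<in> {\<alpha>, \<beta>}) \<and>
     (\<forall>z\<in>C. \<forall>y\<in>U - C. E z y \<longrightarrow> f y \<notin> {\<alpha>, \<beta>}) \<and>
     (\<forall>z\<in>U. g z = (if z \<in> C then transpose \<alpha> \<beta> (f z) else f z))"

definition step :: "'a set \<Rightarrow> ('a \<Rightarrow> 'c set) \<Rightarrow> ('a \<Rightarrow> 'c) \<Rightarrow> ('a \<Rightarrow> 'c) \<Rightarrow> bool" where
  "step U L f g \<longleftrightarrow> coloring U L f \<and> coloring U L g \<and> (\<exists>\<alpha> \<beta> C. swap_on U \<alpha> \<beta> C f g)"

abbreviation equiv_on :: "'a set \<Rightarrow> ('a \<Rightarrow> 'c set) \<Rightarrow> ('a \<Rightarrow> 'c) \<Rightarrow> ('a \<Rightarrow> 'c) \<Rightarrow> bool" where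
  "equiv_on U L \<equiv> (step U L)\<^sup>*\<^sup>*"

lemma in_nb [simp]: "u \<in> nb v \<longleftrightarrow> E v u"
  by (simp add: nb_def)

lemma coloring_cong:
  assumes "coloring U L f" "\<And>u. u \<in> U \<Longrightarrow> g u = f u"
  shows "coloring U L g"
  using assms by (auto simp: coloring_def)

lemma coloring_mono: "coloring U L f \<Longrightarrow> W \<subseteq> U \<Longrightarrow> coloring W L f"
  by (auto simp: coloring_def)

lemma swap_on_sym:
  assumes "swap_on U \<alpha> \<beta> C f g"
  shows "swap_on U \<alpha> \<beta> C g f"
  using assms unfolding swap_on_def
  by (intro conjI ballI impI) (auto simp: transpose_def split: if_splits)

lemma step_sym: "step U L f g \<Longrightarrow> step U L g f"
proof -
  assume "step U L f g"
  then obtain \<alpha> \<beta> C where "coloring U L f" "coloring U L g" "swap_on U \<alpha> \<beta> C f g"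
    by (auto simp: step_def)
  then show ?thesis using swap_on_sym[of U \<alpha> \<beta> C f g] by (auto simp: step_def)
qed

lemma equiv_on_sym: "equiv_on U L f g \<Longrightarrow> equiv_on U L g f"
  by (induction rule: rtranclp_induct) (auto intro: converse_rtranclp_into_rtranclp step_sym)

text \<open>A swap on the empty set counts as a step, which identifies functions that differ only
  outside \<open>U\<close>.\<close>

lemma equiv_on_cong:
  assumes "coloring U L f" "\<And>u. u \<in> U \<Longrightarrow> g u = f u"
  shows "equiv_on U L f g"
proof -
  have "swap_on U \<alpha> \<beta> {} f g" for \<alpha> \<beta>
    using assms by (auto simp: swap_on_def)
  then show ?thesis
    using assms coloring_cong by (metis r_into_rtranclp step_def)
qed

lemma swap_on_proper:
  assumes "swap_on U \<alpha> \<beta> C f g" "\<forall>u\<in>U. \<forall>w\<in>U. E u w \<longrightarrow> f u \<noteq> f w"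
    "u \<in> U" "w \<in> U" "E u w"
  shows "g u \<noteq> g w"
proof -
  have "transpose \<alpha> \<beta> (f u) \<noteq> transpose \<alpha> \<beta> (f w)"
    using assms(2-5) by (metis transpose_involutory)
  moreover have "z \<in> C \<Longrightarrow> y \<in> U - C \<Longrightarrow> E z y \<Longrightarrow> transpose \<alpha> \<beta> (f z) \<noteq> f y" for z y
    using assms(1) unfolding swap_on_def
    by (metis insert_iff singletonD transpose_apply_first transpose_apply_second)
  ultimately show ?thesis
    using assms E_sym unfolding swap_on_def by (metis DiffI)
qed

lemma swap_on_step:
  assumes "swap_on U \<alpha> \<beta> C f g" "coloring U L f" "\<And>z. z \<in> C \<Longrightarrow> g z \<in> L z"
  shows "step U L f g"
proof -
  have "coloring U L g"
    unfolding coloring_def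
  proof (intro conjI ballI impI)
    fix u assume "u \<in> U"
    then show "g u \<in> L u"
      using assms(1,2) assms(3)[of u] by (cases "u \<in> C") (simp_all add: swap_on_def coloring_def)
  next
    fix u w assume "u \<in> U" "w \<in> U" "E u w"
    then show "g u \<noteq> g w"
      using assms swap_on_proper unfolding coloring_def by meson
  qed
  then show ?thesis
    using assms by (auto simp: step_def)
qed

text \<open>The singleton \<open>{v}\<close> is a full chain: no neighbor has the color
  \<open>f v\<close> because \<open>f\<close> is proper, and none has \<open>y\<close> by
  assumption.\<close>

lemma recolor_step:
  assumes "coloring U L f" "v \<in> U" "y \<in> L v" "\<And>w. w \<in> U \<Longrightarrow> E v w \<Longrightarrow> f w \<noteq> y"
  shows "step U L f (f(v := y))"
proof (rule swap_on_step)
  show "swap_on U (f v) y {v} f (f(v := y))"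
    using assms E_sym E_irrefl by (auto simp: swap_on_def coloring_def)
qed (use assms in auto)

text \<open>Adding \<open>v\<close> does not enlarge the chains in \<open>C\<close>, for
  \<open>v\<close> has a third color or is not adjacent to \<open>C\<close>.\<close>

lemma swap_on_insert_same:
  assumes sw: "swap_on U \<alpha> \<beta> C f g" and v: "v \<notin> U"
    and g: "\<And>u. u \<in> U \<Longrightarrow> f' u = f u"
    and cond: "f' v \<notin> {\<alpha>, \<beta>} \<or> (\<forall>z\<in>C. \<not> E v z)"
  shows "swap_on (insert v U) \<alpha> \<beta> C f' (\<lambda>u. if u \<in> C then transpose \<alpha> \<beta> (f' u) else f' u)"
proof -
  have CU: "C \<subseteq> U" using sw by (auto simp: swap_on_def)
  show ?thesis
    unfolding swap_on_def
  proof (intro conjI ballI impI)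
    fix z assume z: "z \<in> C"
    then have "f' z = f z" using CU g by blast
    then show "f' z \<in> {\<alpha>, \<beta>}" using sw z unfolding swap_on_def by metis
  next
    fix z y assume z: "z \<in> C" and y: "y \<in> insert v U - C" and e: "E z y"
    show "f' y \<notin> {\<alpha>, \<beta>}"
    proof (cases "y = v")
      case True
      then show ?thesis using cond z E_sym[OF e] by auto
    next
      case False
      then show ?thesis using sw z y e g by (auto simp: swap_on_def)
    qed
  qed (use CU in auto)
qed

text \<open>If no color but the current one is free at \<open>v\<close>, then the neighbors of \<open>v\<close> have pairwise
  distinct colors, so a Kempe chain reaching \<open>v\<close> does so at one neighbor only and can be
  extended by \<open>v\<close>.\<close>

lemma lift_step_insert:
  assumes fin: "finite U" and v: "v \<notin> U" and deg: "card (nb v \<inter> U) < card (L v)"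
    and fL: "finite (L v)"
    and f: "coloring (insert v U) L f" and st: "step U L f g"
  shows "\<exists>h. equiv_on (insert v U) L f h \<and> coloring (insert v U) L h \<and> (\<forall>u\<in>U. h u = g u)"
proof -
  obtain \<alpha> \<beta> C where sw: "swap_on U \<alpha> \<beta> C f g"
    and cg: "coloring U L g" and cf: "coloring U L f"
    using st by (auto simp: step_def)
  have CU: "C \<subseteq> U" using sw by (auto simp: swap_on_def)
  have easy: "\<exists>h. equiv_on (insert v U) L f' h \<and> coloring (insert v U) L h \<and> (\<forall>u\<in>U. h u = g u)"
    if f': "coloring (insert v U) L f'" "\<And>u. u \<in> U \<Longrightarrow> f' u = f u"
      and cond: "f' v \<notin> {\<alpha>, \<beta>} \<or> (\<forall>z\<in>C. \<not> E v z)" for f'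
  proof -
    let ?h = "\<lambda>u. if u \<in> C then transpose \<alpha> \<beta> (f' u) else f' u"
    have hg: "\<forall>u\<in>U. ?h u = g u"
      using sw f'(2) by (auto simp: swap_on_def)
    have "step (insert v U) L f' ?h"
    proof (rule swap_on_step)
      show "swap_on (insert v U) \<alpha> \<beta> C f' ?h"
        using swap_on_insert_same[OF sw v f'(2) cond] .
      show "coloring (insert v U) L f'" by fact
      show "?h z \<in> L z" if "z \<in> C" for z
        using that hg CU cg by (metis coloring_def subsetD)
    qed
    then show ?thesis
      using hg by (intro exI[of _ ?h] conjI r_into_rtranclp) (simp_all add: step_def)
  qed
  show ?thesis
  proof (cases "f v \<notin> {\<alpha>, \<beta>} \<or> (\<forall>z\<in>C. \<not> E v z)")
    case True
    then show ?thesis using easy[OF f] by auto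
  next
    case False
    then obtain z where z: "z \<in> C" "E v z" and fv: "f v \<in> {\<alpha>, \<beta>}" by auto
    have zU: "z \<in> U" using z CU by auto
    define \<delta> where "\<delta> = transpose \<alpha> \<beta> (f v)"
    have fz: "f z = \<delta>"
    proof -
      have "f z \<in> {\<alpha>, \<beta>}" using sw z by (auto simp: swap_on_def)
      moreover have "f z \<noteq> f v" using f z zU by (auto simp: coloring_def)
      ultimately show ?thesis using fv by (auto simp: \<delta>_def)
    qed
    have ab: "{\<alpha>, \<beta>} = {f v, \<delta>}" using fv by (auto simp: \<delta>_def)
    show ?thesis
    \<comment> \<open>A second free color \<open>y\<close> also differs from \<delta>, which
      \<open>z\<close> carries. Recoloring \<open>v\<close> with it takes \<open>v\<close> out of
      the chain, and then \<open>easy\<close> applies.\<close>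
    proof (cases "\<exists>y\<in>L v. y \<noteq> f v \<and> y \<notin> f ` (nb v \<inter> U)")
      case True
      then obtain y where y: "y \<in> L v" "y \<noteq> f v" "y \<notin> f ` (nb v \<inter> U)" by blast
      have "y \<noteq> \<delta>" using y(3) fz z(2) zU by auto
      then have yab: "y \<notin> {\<alpha>, \<beta>}" using y(2) ab by auto
      have s1: "step (insert v U) L f (f(v := y))"
        by (rule recolor_step) (use f y E_irrefl in auto)
      have "\<exists>h. equiv_on (insert v U) L (f(v := y)) h \<and> coloring (insert v U) L h \<and> (\<forall>u\<in>U. h u = g u)"
      proof (rule easy)
        show "coloring (insert v U) L (f(v := y))" using s1 by (simp add: step_def)
      qed (use v yab in auto)
      then show ?thesis using s1 by (meson converse_rtranclp_into_rtranclp)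
    next
      case False
      then have sub: "L v - {f v} \<subseteq> f ` (nb v \<inter> U)" by auto
      have fvL: "f v \<in> L v" using f by (auto simp: coloring_def)
      have finN: "finite (nb v \<inter> U)" using fin by auto
      \<comment> \<open>The counts close up: the neighbors in \<open>U\<close> are no more numerous
        than the colors of \<open>L v\<close> other than \<open>f v\<close> that they have to cover.
        Hence each of these colors, \<delta> among them, occurs at exactly one neighbor.\<close>
      have c1: "card (L v - {f v}) \<ge> card (nb v \<inter> U)" using deg fvL fL by simp
      have c2: "card (f ` (nb v \<inter> U)) \<le> card (nb v \<inter> U)" using finN card_image_le by blast
      have c3: "card (L v - {f v}) \<le> card (f ` (nb v \<inter> U))" using sub finN card_mono by blast
      have img: "f ` (nb v \<inter> U) = L v - {f v}"
        using c1 c2 c3 sub finN by (metis card_subset_eq finite_imageI order_antisym order_trans)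
      have inj: "inj_on f (nb v \<inter> U)"
        using c1 c2 c3 finN by (intro eq_card_imp_inj_on) auto
      have "f z \<in> f ` (nb v \<inter> U)" using z(2) zU by simp
      then have dL: "\<delta> \<in> L v" using img fz by simp
      have uniq: "y = z" if "y \<in> U" "E v y" "f y = \<delta>" for y
        using inj that fz z(2) zU by (auto simp: inj_on_def)
      let ?h = "\<lambda>u. if u \<in> insert v C then transpose \<alpha> \<beta> (f u) else f u"
      have hg: "\<forall>u\<in>U. ?h u = g u"
        using sw v by (auto simp: swap_on_def)
      have "swap_on (insert v U) \<alpha> \<beta> (insert v C) f ?h"
        unfolding swap_on_def
      proof (intro conjI ballI impI)
        fix p q assume p: "p \<in> insert v C" and q: "q \<in> insert v U - insert v C" and e: "E p q"
        show "f q \<notin> {\<alpha>, \<beta>}"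
        proof (cases "p = v")
          case True
          then have "f q \<noteq> \<delta>" using uniq q e z by auto
          moreover have "f q \<noteq> f v" using f q e True by (auto simp: coloring_def)
          ultimately show ?thesis using ab by auto
        next
          case False
          then show ?thesis using sw p q e by (auto simp: swap_on_def)
        qed
      qed (use CU fv sw in \<open>auto simp: swap_on_def\<close>)
      then have "step (insert v U) L f ?h"
      proof (rule swap_on_step)
        show "?h u \<in> L u" if "u \<in> insert v C" for u
        proof (cases "u \<in> C")
          case True
          then have "u \<in> U" using CU by auto
          then show ?thesis using hg cg by (metis coloring_def)
        next
          case False
          then show ?thesis using that dL by (auto simp: \<delta>_def)
        qed
      qed fact
      then show ?thesis
        using hg by (intro exI[of _ ?h] conjI r_into_rtranclp) (simp_all add: step_def)
    qed
  qed
qed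

lemma step_cong:
  assumes "step U L f g" "\<And>u. u \<in> U \<Longrightarrow> f' u = f u"
  shows "step U L f' g"
proof -
  obtain \<alpha> \<beta> C where sw: "swap_on U \<alpha> \<beta> C f g" using assms by (auto simp: step_def)
  have "C \<subseteq> U" using sw by (auto simp: swap_on_def)
  then have "\<forall>z\<in>C. f' z = f z" using assms(2) by blast
  then have "swap_on U \<alpha> \<beta> C f' g" using assms(2) sw unfolding swap_on_def by simp
  moreover have "coloring U L f'"
    by (rule coloring_cong[of U L f]) (use assms in \<open>auto simp: step_def\<close>)
  ultimately show ?thesis using assms by (auto simp: step_def)
qed

text \<open>Lifting the steps one by one controls every value except the one at \<open>v\<close>. A
  last recoloring corrects it: \<open>g v\<close> is free at \<open>v\<close> because the lifted
  coloring agrees with \<open>g\<close> on \<open>U\<close>.\<close>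

lemma equiv_on_insert:
  assumes fin: "finite U" and v: "v \<notin> U" and deg: "card (nb v \<inter> U) < card (L v)"
    and fL: "finite (L v)"
    and U: "\<And>f g. coloring U L f \<Longrightarrow> coloring U L g \<Longrightarrow> equiv_on U L f g"
    and f: "coloring (insert v U) L f" and g: "coloring (insert v U) L g"
  shows "equiv_on (insert v U) L f g"
proof -
  have "equiv_on U L f g" using U f g coloring_mono by blast
  then have "\<exists>h. equiv_on (insert v U) L f h \<and> coloring (insert v U) L h \<and> (\<forall>u\<in>U. h u = g u)"
  proof (induction rule: rtranclp_induct)
    case base
    then show ?case using f by blast
  next
    case (step g1 g2)
    then obtain h where h: "equiv_on (insert v U) L f h" "coloring (insert v U) L h"
      "\<forall>u\<in>U. h u = g1 u" by blast
    have "step U L h g2" using step_cong[OF step(2)] h(3) by auto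
    then show ?case
      using lift_step_insert[OF fin v deg fL h(2)] h(1) by (meson rtranclp_trans)
  qed
  then obtain h where h: "equiv_on (insert v U) L f h" "coloring (insert v U) L h"
      "\<forall>u\<in>U. h u = g u" by blast
  have s: "step (insert v U) L h (h(v := g v))"
  proof (rule recolor_step)
    show "g v \<in> L v" using g by (auto simp: coloring_def)
    show "h w \<noteq> g v" if "w \<in> insert v U" "E v w" for w
    proof -
      have "w \<in> U" using that E_irrefl by auto
      then show ?thesis using h(3) g that E_sym by (fastforce simp: coloring_def)
    qed
  qed (use h in auto)
  have "equiv_on (insert v U) L (h(v := g v)) g"
    by (rule equiv_on_cong) (use s h v in \<open>auto simp: step_def\<close>)
  then show ?thesis using h(1) s by (meson rtranclp.rtrancl_into_rtrancl rtranclp_trans)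
qed

section \<open>Greedy coloring with slack\<close>

lemma coloring_insert:
  assumes "coloring U L f" "v \<notin> U" "finite U" "finite (L v)" "card (nb v \<inter> U) < card (L v)"
  shows "\<exists>c. coloring (insert v U) L (f(v := c))"
proof -
  have "card (f ` (nb v \<inter> U)) < card (L v)"
    using assms card_image_le[of "nb v \<inter> U" f] by auto
  then obtain c where c: "c \<in> L v" "c \<notin> f ` (nb v \<inter> U)"
    by (metis assms(3) card_mono finite_Int finite_imageI not_less subsetI)
  have "coloring (insert v U) L (f(v := c))"
    using assms(1,2) c E_sym E_irrefl by (auto simp: coloring_def image_iff)
  then show ?thesis by blast
qed

text \<open>The list version of the classical fact that all k-colorings of a (k-1)-degenerate graph
  are Kempe equivalent: remove a vertex with fewer neighbors than colors, apply induction, and put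
  it back.\<close>

lemma degenerate:
  assumes "finite U" "\<And>u. u \<in> U \<Longrightarrow> finite (L u)"
    and "\<And>A. A \<subseteq> U \<Longrightarrow> A \<noteq> {} \<Longrightarrow> \<exists>v\<in>A. card (nb v \<inter> A) < card (L v)"
  shows "(\<exists>f. coloring U L f) \<and> (\<forall>f g. coloring U L f \<longrightarrow> coloring U L g \<longrightarrow> equiv_on U L f g)"
  using assms
proof (induction "card U" arbitrary: U)
  case 0
  then have "U = {}" by auto
  then show ?case by (auto simp: coloring_def intro: equiv_on_cong)
next
  case (Suc n)
  then have "U \<noteq> {}" by auto
  then obtain v where v: "v \<in> U" "card (nb v \<inter> U) < card (L v)" using Suc(5)[of U] by auto
  define W where "W = U - {v}"
  have W: "U = insert v W" "v \<notin> W" "finite W" using v Suc by (auto simp: W_def)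
  have nW: "nb v \<inter> W = nb v \<inter> U" using E_irrefl by (auto simp: W_def)
  have IH: "(\<exists>f. coloring W L f) \<and> (\<forall>f g. coloring W L f \<longrightarrow> coloring W L g \<longrightarrow> equiv_on W L f g)"
  proof (rule Suc(1))
    show "\<exists>v\<in>A. card (nb v \<inter> A) < card (L v)" if "A \<subseteq> W" "A \<noteq> {}" for A
      by (rule Suc(5)) (use that W in auto)
  qed (use Suc W in auto)
  have fL: "finite (L v)" using Suc v by auto
  show ?case
  proof (intro conjI allI impI)
    show "\<exists>f. coloring U L f"
      using IH coloring_insert[where U = W and L = L and v = v] W fL v(2) nW by metis
    show "equiv_on U L f g" if "coloring U L f" "coloring U L g" for f g
      unfolding W(1)
      by (rule equiv_on_insert) (use IH W fL v(2) nW that in auto)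
  qed
qed

text \<open>A subset that is not closed has a vertex with a neighbor outside the subset, which makes
  the degree bound strict; a closed one has slack by assumption. So every nonempty subset meets the
  condition of \<open>degenerate\<close>.\<close>

lemma degree_slack:
  assumes fin: "finite U" "\<And>u. u \<in> U \<Longrightarrow> finite (L u)"
    and deg: "\<And>u. u \<in> U \<Longrightarrow> card (nb u \<inter> U) \<le> card (L u)"
    and sl: "\<And>A. nb_closed U A \<Longrightarrow> A \<noteq> {} \<Longrightarrow> \<exists>v\<in>A. card (nb v \<inter> U) < card (L v)"
  shows "(\<exists>f. coloring U L f) \<and> (\<forall>f g. coloring U L f \<longrightarrow> coloring U L g \<longrightarrow> equiv_on U L f g)"
proof (rule degenerate[OF fin])
  fix A assume A: "A \<subseteq> U" "A \<noteq> {}"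
  show "\<exists>v\<in>A. card (nb v \<inter> A) < card (L v)"
  proof (cases "nb_closed U A")
    case True
    then obtain v where v: "v \<in> A" "card (nb v \<inter> U) < card (L v)" using sl A by blast
    have "card (nb v \<inter> A) \<le> card (nb v \<inter> U)" using A fin(1) by (intro card_mono) auto
    then show ?thesis using v by (intro bexI[of _ v]) auto
  next
    case False
    then obtain v w where vw: "v \<in> A" "w \<in> U" "E v w" "w \<notin> A" using A by (auto simp: nb_closed_def)
    have "card (nb v \<inter> A) < card (nb v \<inter> U)"
      using A fin(1) vw by (intro psubset_card_mono) auto
    then show ?thesis using vw A deg[of v] by (metis order_less_le_trans subsetD)
  qed
qed auto

section \<open>Extending a coloring fixed on a set\<close>

definition reduced :: "'a set \<Rightarrow> ('a \<Rightarrow> 'c) \<Rightarrow> ('a \<Rightarrow> 'c set) \<Rightarrow> 'a \<Rightarrow> 'c set" where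
  "reduced S f L u = L u - f ` (nb u \<inter> S)"

lemma coloring_override:
  assumes "coloring S L f" "coloring U (reduced S f L) g" "S \<inter> U = {}"
  shows "coloring (S \<union> U) L (\<lambda>u. if u \<in> S then f u else g u)"
  unfolding coloring_def
proof (intro conjI ballI impI)
  fix u assume "u \<in> S \<union> U"
  then show "(if u \<in> S then f u else g u) \<in> L u"
    using assms by (auto simp: coloring_def reduced_def)
next
  fix u w assume u: "u \<in> S \<union> U" and w: "w \<in> S \<union> U" and e: "E u w"
  have *: "f p \<noteq> g q" if "p \<in> S" "q \<in> U" "E p q" for p q
  proof
    assume "f p = g q"
    then have "g q \<in> f ` (nb q \<inter> S)" using that E_sym by (metis IntI image_eqI in_nb)
    then show False using assms(2) that by (auto simp: coloring_def reduced_def)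
  qed
  show "(if u \<in> S then f u else g u) \<noteq> (if w \<in> S then f w else g w)"
    using assms u w e *[of u w] *[of w u] E_sym[OF e] by (auto simp: coloring_def)
qed

lemma coloring_reduced:
  assumes "coloring (S \<union> U) L f" "S \<inter> U = {}"
  shows "coloring U (reduced S f L) f"
  using assms E_sym by (auto simp: coloring_def reduced_def)

text \<open>At a swapped vertex the values before and after are together \<alpha> and \<beta>, and
  both avoid the colors of its neighbors in \<open>S\<close>. So no chain continues into
  \<open>S\<close>.\<close>

lemma swap_on_override:
  assumes sw: "swap_on U \<alpha> \<beta> C g h" and SU: "S \<inter> U = {}"
    and g: "coloring U (reduced S f L) g" and h: "coloring U (reduced S f L) h"
  shows "swap_on (S \<union> U) \<alpha> \<beta> C (\<lambda>u. if u \<in> S then f u else g u) (\<lambda>u. if u \<in> S then f u else h u)"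
proof -
  have CU: "C \<subseteq> U" using sw by (auto simp: swap_on_def)
  have ns: "f y \<notin> {\<alpha>, \<beta>}" if "z \<in> C" "y \<in> S" "E z y" for z y
  proof -
    have zU: "z \<in> U" using that CU by auto
    have "{g z, h z} = {\<alpha>, \<beta>}" using sw that zU by (auto simp: swap_on_def)
    moreover have "g z \<noteq> f y" "h z \<noteq> f y"
      using g h that zU by (auto simp: coloring_def reduced_def)
    ultimately show ?thesis by (metis insert_iff singletonD)
  qed
  show ?thesis
    unfolding swap_on_def
  proof (intro conjI ballI impI)
    fix z assume "z \<in> C"
    then show "(if z \<in> S then f z else g z) \<in> {\<alpha>, \<beta>}"
      using sw SU CU by (auto simp: swap_on_def)
  next
    fix z y assume z: "z \<in> C" and y: "y \<in> S \<union> U - C" and e: "E z y"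
    show "(if y \<in> S then f y else g y) \<notin> {\<alpha>, \<beta>}"
      using ns[OF z _ e] sw z y e by (auto simp: swap_on_def)
  next
    fix z assume "z \<in> S \<union> U"
    then show "(if z \<in> S then f z else h z) =
      (if z \<in> C then transpose \<alpha> \<beta> (if z \<in> S then f z else g z) else if z \<in> S then f z else g z)"
      using sw SU CU by (auto simp: swap_on_def)
  qed (use CU in auto)
qed

lemma equiv_on_override:
  assumes "equiv_on U (reduced S f L) g h" "coloring S L f" "S \<inter> U = {}"
  shows "equiv_on (S \<union> U) L (\<lambda>u. if u \<in> S then f u else g u) (\<lambda>u. if u \<in> S then f u else h u)"
  using assms(1)
proof (induction rule: rtranclp_induct)
  case (step g1 g2)
  have g: "coloring U (reduced S f L) g1" "coloring U (reduced S f L) g2"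
    using step(2) by (auto simp: step_def)
  obtain \<alpha> \<beta> C where "swap_on U \<alpha> \<beta> C g1 g2" using step(2) by (auto simp: step_def)
  note sw = swap_on_override[OF this assms(3) g]
  have "step (S \<union> U) L (\<lambda>u. if u \<in> S then f u else g1 u) (\<lambda>u. if u \<in> S then f u else g2 u)"
    unfolding step_def
    by (intro conjI exI) (rule coloring_override[OF assms(2) g(1) assms(3)]
      coloring_override[OF assms(2) g(2) assms(3)] sw)+
  then show ?case using step(3) by (meson rtranclp.rtrancl_into_rtrancl)
qed auto

text \<open>\<open>slack S f u\<close>: coloring \<open>S\<close> by \<open>f\<close> costs \<open>u\<close> fewer colors than neighbors.\<close>

definition slack :: "('a \<Rightarrow> 'c set) \<Rightarrow> 'a set \<Rightarrow> ('a \<Rightarrow> 'c) \<Rightarrow> 'a \<Rightarrow> bool" where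
  "slack L S f u \<longleftrightarrow> (\<exists>s\<in>S. E u s \<and> f s \<notin> L u) \<or>
     (\<exists>s\<in>S. \<exists>t\<in>S. E u s \<and> E u t \<and> s \<noteq> t \<and> f s = f t)"

text \<open>Each neighbor in \<open>S\<close> costs \<open>u\<close> at most one color; with slack,
  some neighbor costs none or two neighbors cost the same one.\<close>

lemma card_reduced:
  assumes "finite (nb u)" "finite (L u)" "card (nb u) \<le> card (L u)" "nb u \<subseteq> S \<union> U" "S \<inter> U = {}"
  shows "card (nb u \<inter> U) \<le> card (reduced S f L u)"
    and "slack L S f u \<Longrightarrow> card (nb u \<inter> U) < card (reduced S f L u)"
proof -
  let ?N = "nb u \<inter> S"
  have N: "finite ?N" using assms(1) by auto
  have split: "card (nb u) = card ?N + card (nb u \<inter> U)"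
    using assms by (subst card_Un_disjoint[symmetric]) (auto intro: arg_cong[where f = card])
  have red: "card (reduced S f L u) = card (L u) - card (L u \<inter> f ` ?N)"
    using assms(2) by (simp add: reduced_def card_Diff_subset_Int Int_commute)
  have le: "card (L u \<inter> f ` ?N) \<le> card (f ` ?N)" using N by (intro card_mono) auto
  have le2: "card (f ` ?N) \<le> card ?N" using N card_image_le by blast
  show "card (nb u \<inter> U) \<le> card (reduced S f L u)"
    using split red le le2 assms(3) by linarith
  show "card (nb u \<inter> U) < card (reduced S f L u)" if sl: "slack L S f u"
  proof -
    have "card (L u \<inter> f ` ?N) < card ?N"
      using sl unfolding slack_def
    proof
      assume "\<exists>s\<in>S. E u s \<and> f s \<notin> L u"
      then obtain s where s: "s \<in> S" "E u s" "f s \<notin> L u" by blast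
      have "f s \<in> f ` ?N" using s by simp
      then have "L u \<inter> f ` ?N \<subset> f ` ?N" using s(3) by blast
      then have "card (L u \<inter> f ` ?N) < card (f ` ?N)" using N by (intro psubset_card_mono) auto
      then show ?thesis using le2 by linarith
    next
      assume "\<exists>s\<in>S. \<exists>t\<in>S. E u s \<and> E u t \<and> s \<noteq> t \<and> f s = f t"
      then have "\<not> inj_on f ?N" unfolding inj_on_def by (metis IntI in_nb)
      then have "card (f ` ?N) < card ?N" using N le2 eq_card_imp_inj_on by (metis order_le_neq_trans)
      then show ?thesis using le by linarith
    qed
    then show ?thesis using split red assms(3) by linarith
  qed
qed

end

section \<open>Extending partial colorings of 3-connected cubic graphs\<close>

lemma card_3_obtain:
  assumes "card A = 3" "a \<in> A"
  obtains b c where "A = {a, b, c}" "a \<noteq> b" "a \<noteq> c" "b \<noteq> c"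
proof -
  obtain x y z where "A = {x, y, z}" "x \<noteq> y" "x \<noteq> z" "y \<noteq> z"
    using assms(1) by (metis card_3_iff)
  then show ?thesis using assms(2) that by (metis insert_commute insertE singletonD)
qed

text \<open>Connectivity is stated without paths: a nonempty set with at most two outside neighbors
  covers everything but these. A cubic graph on four vertices is the complete one, which explains
  the condition on \<open>card V\<close>.\<close>

locale cubic_graph = simple_graph E for E :: "'a \<Rightarrow> 'a \<Rightarrow> bool" +
  fixes V :: "'a set" and L :: "'a \<Rightarrow> 'c set"
  assumes finite_V: "finite V"
    and E_V: "E u v \<Longrightarrow> u \<in> V"
    and card_nb: "v \<in> V \<Longrightarrow> card (nb v) = 3"
    and card_L: "v \<in> V \<Longrightarrow> card (L v) = 3"
    and three_connected: "\<lbrakk>A \<subseteq> V; A \<noteq> {}; finite S; card S \<le> 2; A \<inter> S = {};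
      \<And>u. u \<in> A \<Longrightarrow> nb u \<subseteq> A \<union> S\<rbrakk> \<Longrightarrow> V \<subseteq> A \<union> S"
    and card_V: "card V \<noteq> 4"
begin

abbreviation "col \<equiv> coloring V L"
abbreviation "eqv \<equiv> equiv_on V L"

lemma nb_V: "nb v \<subseteq> V"
  using E_V E_sym by (auto simp: nb_def)

lemma E_V2: "E u v \<Longrightarrow> v \<in> V"
  using E_V E_sym by blast

lemma finite_nb: "finite (nb v)"
  using nb_V finite_V finite_subset by blast

lemma finite_L: "v \<in> V \<Longrightarrow> finite (L v)"
  using card_L by (metis card.infinite zero_neq_numeral)

lemma nb_obtain2:
  assumes "E v a"
  obtains b c where "nb v = {a, b, c}" "a \<noteq> b" "a \<noteq> c" "b \<noteq> c" "E v b" "E v c"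
proof -
  have "card (nb v) = 3" "a \<in> nb v" using card_nb E_V assms by auto
  then obtain b c where bc: "nb v = {a, b, c}" "a \<noteq> b" "a \<noteq> c" "b \<noteq> c"
    by (rule card_3_obtain)
  have "b \<in> nb v" "c \<in> nb v" using bc(1) by blast+
  then show ?thesis using that[OF bc] by simp
qed

lemma nb_obtain1:
  assumes "E v a" "E v b" "a \<noteq> b"
  obtains c where "nb v = {a, b, c}" "a \<noteq> c" "b \<noteq> c" "E v c"
proof -
  obtain x y where xy: "nb v = {a, x, y}" "a \<noteq> x" "a \<noteq> y" "x \<noteq> y" "E v x" "E v y"
    using nb_obtain2[OF assms(1)] .
  have "b \<in> nb v" using assms by simp
  then consider "b = x" | "b = y" using xy assms(3) by auto
  then show ?thesis using that xy by cases (auto simp: insert_commute)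
qed

lemma nb_eq3:
  assumes "E v a" "E v b" "E v c" "a \<noteq> b" "a \<noteq> c" "b \<noteq> c"
  shows "nb v = {a, b, c}"
  using assms by (intro card_seteq[symmetric]) (auto simp: finite_nb card_nb[OF E_V[OF assms(1)]])

lemma L_obtain2:
  assumes "\<alpha> \<in> L v" "v \<in> V"
  obtains \<beta> \<gamma> where "L v = {\<alpha>, \<beta>, \<gamma>}" "\<alpha> \<noteq> \<beta>" "\<alpha> \<noteq> \<gamma>" "\<beta> \<noteq> \<gamma>"
  using card_3_obtain[of "L v" \<alpha>] card_L assms by auto

lemma L_diff:
  assumes "u \<in> V" "v \<in> V" "L u \<noteq> L v"
  obtains c where "c \<in> L u" "c \<notin> L v"
  using assms card_L finite_L by (metis card_subset_eq subsetI)

text \<open>If \<open>s\<close> had no neighbor in \<open>A\<close>, the other two vertices of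
  \<open>S\<close> would cut off \<open>A\<close>, leaving no room for \<open>s\<close> in
  \<open>V\<close>.\<close>

lemma attach:
  assumes "A \<subseteq> V" "A \<noteq> {}" "card S = 3" "S \<subseteq> V" "A \<inter> S = {}"
    and nb: "\<And>u. u \<in> A \<Longrightarrow> nb u \<subseteq> A \<union> S" and s: "s \<in> S"
  shows "\<exists>u\<in>A. E s u"
proof (rule ccontr)
  assume *: "\<not> (\<exists>u\<in>A. E s u)"
  have "finite S" using assms(3) by (metis card.infinite zero_neq_numeral)
  then have "V \<subseteq> A \<union> (S - {s})"
  proof (intro three_connected)
    show "nb u \<subseteq> A \<union> (S - {s})" if "u \<in> A" for u
      using nb[OF that] * that E_sym by auto
  qed (use assms in auto)
  then show False using assms by auto
qed

lemma reduced_props: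
  assumes "u \<in> V" "nb u \<subseteq> S \<union> U" "S \<inter> U = {}"
  shows "card (nb u \<inter> U) \<le> card (reduced S f L u)"
    and "slack L S f u \<Longrightarrow> card (nb u \<inter> U) < card (reduced S f L u)"
  using card_reduced[of u L S U f] assms finite_nb finite_L card_nb card_L by auto

lemma finite_reduced: "u \<in> V \<Longrightarrow> finite (reduced S f L u)"
  using finite_L by (auto simp: reduced_def)

lemma reduced_degree_slack:
  assumes "S \<inter> U = {}" "U \<subseteq> V" "\<And>u. u \<in> U \<Longrightarrow> nb u \<subseteq> S \<union> U"
    and sl: "\<And>A. nb_closed U A \<Longrightarrow> A \<noteq> {} \<Longrightarrow> \<exists>u\<in>A. slack L S f u"
  shows "(\<exists>g. coloring U (reduced S f L) g) \<and>
    (\<forall>g h. coloring U (reduced S f L) g \<longrightarrow> coloring U (reduced S f L) h \<longrightarrow>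
      equiv_on U (reduced S f L) g h)"
proof (rule degree_slack)
  show "finite U" using assms finite_V finite_subset by blast
  show "\<exists>v\<in>A. card (nb v \<inter> U) < card (reduced S f L v)" if A: "nb_closed U A" "A \<noteq> {}" for A
  proof -
    obtain u where u: "u \<in> A" "slack L S f u" using sl A by blast
    have "u \<in> U" using A u by (auto simp: nb_closed_def)
    then show ?thesis using reduced_props(2)[of u S U f] assms u by blast
  qed
  show "card (nb u \<inter> U) \<le> card (reduced S f L u)" if "u \<in> U" for u
    using reduced_props(1)[of u S U f] assms that by blast
qed (use assms finite_reduced in auto)

text \<open>Outside \<open>S\<close> both are colorings from the same reduced lists, so
  \<open>degree_slack\<close> connects them there, and its steps are steps of the whole graph by
  \<open>equiv_on_override\<close>.\<close>

lemma equiv_extension: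
  assumes S: "S \<subseteq> V" and f: "col f" and g: "col g" and fg: "\<And>s. s \<in> S \<Longrightarrow> g s = f s"
    and sl: "\<And>A. nb_closed (V - S) A \<Longrightarrow> A \<noteq> {} \<Longrightarrow> \<exists>u\<in>A. slack L S f u"
  shows "eqv f g"
proof -
  have V: "S \<union> (V - S) = V" using S by auto
  have r: "coloring (V - S) (reduced S f L) f" "coloring (V - S) (reduced S f L) g"
  proof -
    show "coloring (V - S) (reduced S f L) f" using coloring_reduced[of S "V - S"] f V by auto
    have "coloring (V - S) (reduced S g L) g" using coloring_reduced[of S "V - S"] g V by auto
    moreover have "reduced S g L = reduced S f L"
      using fg by (auto simp: reduced_def fun_eq_iff)
    ultimately show "coloring (V - S) (reduced S f L) g" by simp
  qed
  have e1: "equiv_on (V - S) (reduced S f L) f g"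
  proof (rule conjunct2[OF reduced_degree_slack, rule_format])
    show "\<exists>u\<in>A. slack L S f u" if "nb_closed (V - S) A" "A \<noteq> {}" for A
      using sl that by simp
  qed (use nb_V r in auto)
  have cf: "coloring S L f" using coloring_mono[OF f S] .
  have "eqv (\<lambda>u. if u \<in> S then f u else f u) (\<lambda>u. if u \<in> S then f u else g u)"
    using equiv_on_override[OF e1 cf] V by auto
  moreover have "(\<lambda>u. if u \<in> S then f u else f u) = f" by auto
  moreover have "(\<lambda>u. if u \<in> S then f u else g u) = g" using fg by auto
  ultimately show ?thesis by simp
qed

lemma extension_exists:
  assumes S: "S \<subseteq> V" and f: "coloring S L f"
    and sl: "\<And>A. nb_closed (V - S) A \<Longrightarrow> A \<noteq> {} \<Longrightarrow> \<exists>u\<in>A. slack L S f u"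
  shows "\<exists>g. col g \<and> (\<forall>s\<in>S. g s = f s)"
proof -
  have V: "S \<union> (V - S) = V" using S by auto
  have "\<exists>g. coloring (V - S) (reduced S f L) g"
  proof (rule conjunct1[OF reduced_degree_slack])
    show "\<exists>u\<in>A. slack L S f u" if "nb_closed (V - S) A" "A \<noteq> {}" for A
      using sl that by simp
  qed (use nb_V in auto)
  then obtain g where g: "coloring (V - S) (reduced S f L) g" by blast
  show ?thesis
    using coloring_override[OF f g] V by (intro exI[of _ "\<lambda>u. if u \<in> S then f u else g u"]) auto
qed

section \<open>Components without slack\<close>

definition stuck :: "'a set \<Rightarrow> ('a \<Rightarrow> 'c) \<Rightarrow> 'a set" where
  "stuck S f = \<Union>{A. nb_closed (V - S) A \<and> (\<forall>u\<in>A. \<not> slack L S f u)}"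

text \<open>Closed sets are closed under union, so \<open>stuck S f\<close> is the largest closed
  set without slack, that is, the union of all components that obstruct the greedy
  extension.\<close>

lemma stuck_closed: "nb_closed (V - S) (stuck S f)"
proof -
  have *: "nb_closed (V - S) A \<Longrightarrow> \<forall>u\<in>A. \<not> slack L S f u \<Longrightarrow> A \<subseteq> stuck S f" for A
    unfolding stuck_def by blast
  have "\<exists>A. u \<in> A \<and> nb_closed (V - S) A \<and> A \<subseteq> stuck S f" if u: "u \<in> stuck S f" for u
  proof -
    obtain A where "u \<in> A" "nb_closed (V - S) A" "\<forall>u\<in>A. \<not> slack L S f u"
      using u unfolding stuck_def by blast
    then show ?thesis using * by blast
  qed
  then show ?thesis unfolding nb_closed_def by (meson subset_iff)
qed

lemma stuck_no_slack: "u \<in> stuck S f \<Longrightarrow> \<not> slack L S f u"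
  by (auto simp: stuck_def)

lemma stuck_subset: "stuck S f \<subseteq> V - S"
  using stuck_closed[of S f] by (simp add: nb_closed_def)

lemma stuck_nb: "u \<in> stuck S f \<Longrightarrow> E u w \<Longrightarrow> w \<in> stuck S f \<union> S"
  using stuck_closed[of S f] E_V2 by (auto simp: nb_closed_def)

text \<open>No edge joins the stuck part to the rest of \<open>V - S\<close>. Hence coloring the
  stuck part changes nothing for the other components, each of which still has slack from
  \<open>S\<close>.\<close>

lemma extension_split:
  assumes S: "S \<subseteq> V" and f: "coloring S L f"
    and D: "stuck S f \<noteq> {} \<Longrightarrow> \<exists>h. coloring (S \<union> stuck S f) L h \<and> (\<forall>s\<in>S. h s = f s)"
  shows "\<exists>g. col g \<and> (\<forall>s\<in>S. g s = f s)"
proof -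
  let ?D = "stuck S f"
  obtain h where h: "coloring (S \<union> ?D) L h" "\<forall>s\<in>S. h s = f s"
    using D f by (cases "?D = {}") auto
  have "\<exists>g. col g \<and> (\<forall>s\<in>S \<union> ?D. g s = h s)"
  proof (rule extension_exists)
    show "S \<union> ?D \<subseteq> V" using S stuck_subset by auto
    fix A assume A: "nb_closed (V - (S \<union> ?D)) A" "A \<noteq> {}"
    have "nb_closed (V - S) A"
      unfolding nb_closed_def
    proof (intro conjI ballI impI)
      fix u w assume u: "u \<in> A" and w: "w \<in> V - S" and e: "E u w"
      have "u \<notin> S \<union> ?D" using A u by (auto simp: nb_closed_def)
      then have "w \<notin> ?D" using stuck_nb[of w S f u] E_sym[OF e] by blast
      then show "w \<in> A" using A u w e by (auto simp: nb_closed_def)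
    qed (use A in \<open>auto simp: nb_closed_def\<close>)
    moreover have "\<not> A \<subseteq> ?D" using A by (auto simp: nb_closed_def)
    ultimately obtain u where u: "u \<in> A" "slack L S f u" by (auto simp: stuck_def)
    have "slack L (S \<union> ?D) h u" using u(2) h(2) unfolding slack_def by (metis UnI1)
    then show "\<exists>u\<in>A. slack L (S \<union> ?D) h u" using u by blast
  qed (use h in auto)
  then show ?thesis using h by auto
qed

text \<open>\<open>D\<close> hangs on three edges. By 3-connectivity \<open>D\<close> minus a vertex is still connected, so a
  color \<open>c\<close> of \<open>x\<close> missing at a neighbor \<open>y\<close> can be given to \<open>x\<close>, which leaves slack at \<open>y\<close>.\<close>

lemma leg_extension:
  assumes S: "card S = 3" "S \<subseteq> V" and f: "coloring S L f"
    and D: "D \<subseteq> V" "D \<inter> S = {}" "\<And>u. u \<in> D \<Longrightarrow> nb u \<subseteq> D \<union> S"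
    and legs: "\<And>s u w. s \<in> S \<Longrightarrow> u \<in> D \<Longrightarrow> w \<in> D \<Longrightarrow> E s u \<Longrightarrow> E s w \<Longrightarrow> u = w"
  shows "(\<exists>h. coloring (S \<union> D) L h \<and> (\<forall>s\<in>S. h s = f s)) \<or>
    (\<exists>Q. \<forall>u\<in>D. reduced S f L u = Q \<and> card Q = card (nb u \<inter> D))"
proof -
  have finS: "finite S" using S(1) by (metis card.infinite zero_neq_numeral)
  \<comment> \<open>\<open>T X\<close> collects the legs that end in \<open>X\<close>. As each
    vertex of \<open>S\<close> has at most one neighbor in \<open>D\<close>, disjoint parts of
    \<open>D\<close> use disjoint legs, and there are only three.\<close>
  define T where "T X = {s \<in> S. \<exists>u\<in>X. E s u}" for X
  have T_le: "T X \<subseteq> S" "finite (T X)" for X using finS by (auto simp: T_def)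
  have T_disj: "T A \<inter> T B = {}" if "A \<subseteq> D" "B \<subseteq> D" "A \<inter> B = {}" for A B
    using that legs unfolding T_def by blast
  have T_sum: "card (T A) + card (T B) \<le> 3" if "A \<subseteq> D" "B \<subseteq> D" "A \<inter> B = {}" for A B
    using T_disj[OF that] T_le S(1) finS card_Un_disjoint[of "T A" "T B"]
    by (metis Un_least card_mono)
  \<comment> \<open>\<open>T X\<close> and \<open>Z\<close> separate \<open>X\<close> from the rest,
    so they must count at least three. Two parts of \<open>D\<close> would then need 3 + 3 legs, and
    two parts of \<open>D\<close> minus a vertex 2 + 2.\<close>
  have T_ge: "card (T X) + card Z \<ge> 3"
    if X: "X \<subseteq> D" "X \<noteq> {}" "Z \<subseteq> D" "finite Z" "X \<inter> Z = {}"
      and cl: "\<And>u w. u \<in> X \<Longrightarrow> w \<in> D \<Longrightarrow> E u w \<Longrightarrow> w \<in> X \<union> Z" for X Z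
  proof (rule ccontr)
    assume "\<not> ?thesis"
    then have c: "card (T X \<union> Z) \<le> 2" using card_Un_le[of "T X" Z] by linarith
    have "V \<subseteq> X \<union> (T X \<union> Z)"
    proof (rule three_connected)
      show "nb u \<subseteq> X \<union> (T X \<union> Z)" if "u \<in> X" for u
      proof
        fix w assume w: "w \<in> nb u"
        then have "w \<in> D \<union> S" using D(3) that X by blast
        then show "w \<in> X \<union> (T X \<union> Z)" using cl[OF that] w that E_sym by (auto simp: T_def)
      qed
    qed (use X D c T_le in \<open>auto simp: T_def\<close>)
    then have "S \<subseteq> T X" using S(2) X D by blast
    then have "card S \<le> card (T X \<union> Z)" using T_le X(4) by (intro card_mono) auto
    then show False using c S(1) by linarith
  qed
  have conn0: "A = D" if A: "nb_closed D A" "A \<noteq> {}" for A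
  proof (rule ccontr)
    assume "A \<noteq> D"
    then have B: "D - A \<noteq> {}" "A \<subseteq> D" using A by (auto simp: nb_closed_def)
    have "card (T A) + card ({} :: 'a set) \<ge> 3"
      by (rule T_ge) (use A in \<open>auto simp: nb_closed_def\<close>)
    moreover have "card (T (D - A)) + card ({} :: 'a set) \<ge> 3"
      by (rule T_ge) (use A B E_sym in \<open>auto simp: nb_closed_def\<close>)
    ultimately show False using T_sum[of A "D - A"] B by auto
  qed
  have conn1: "A = D - {z}" if A: "nb_closed (D - {z}) A" "A \<noteq> {}" and z: "z \<in> D" for A z
  proof (rule ccontr)
    assume "A \<noteq> D - {z}"
    then have B: "D - {z} - A \<noteq> {}" "A \<subseteq> D" using A by (auto simp: nb_closed_def)
    have "card (T A) + card {z} \<ge> 3"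
      by (rule T_ge) (use A z in \<open>auto simp: nb_closed_def\<close>)
    moreover have "card (T (D - {z} - A)) + card {z} \<ge> 3"
      by (rule T_ge) (use A B z E_sym in \<open>auto simp: nb_closed_def\<close>)
    moreover have "card (T A) + card (T (D - {z} - A)) \<le> 3" by (rule T_sum) (use B in auto)
    ultimately show False by simp
  qed
  have nbD: "nb u \<subseteq> S \<union> D" if "u \<in> D" for u using D(3)[OF that] by auto
  let ?R = "reduced S f L"
  have le: "card (nb u \<inter> D) \<le> card (?R u)" if "u \<in> D" for u
    by (rule reduced_props(1)) (use that D nbD in auto)
  \<comment> \<open>If neither a strict inequality nor a color lost along an edge is available, the
    reduced lists agree along edges, hence on the connected set \<open>D\<close>; this is the second
    alternative of the claim.\<close>
  consider (slack) u where "u \<in> D" "card (nb u \<inter> D) < card (?R u)"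
    | (color) x y c where "x \<in> D" "y \<in> D" "E x y" "c \<in> ?R x" "c \<notin> ?R y"
    | (const) "\<forall>u\<in>D. card (nb u \<inter> D) = card (?R u)"
        "\<forall>x\<in>D. \<forall>y\<in>D. E x y \<longrightarrow> ?R x \<subseteq> ?R y"
  proof (cases "\<exists>u\<in>D. card (nb u \<inter> D) < card (?R u)")
    case False
    then have "\<forall>u\<in>D. card (nb u \<inter> D) = card (?R u)" using le le_neq_implies_less by blast
    then show ?thesis using that(2,3) by (cases "\<exists>x\<in>D. \<exists>y\<in>D. E x y \<and> \<not> ?R x \<subseteq> ?R y") auto
  qed (use that(1) in blast)
  then show ?thesis
  proof cases
    case slack
    have "\<exists>g. coloring D ?R g"
    proof (rule conjunct1[OF degree_slack])
      show "finite D" using D finite_V finite_subset by blast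
      show "\<exists>v\<in>A. card (nb v \<inter> D) < card (?R v)" if "nb_closed D A" "A \<noteq> {}" for A
        using conn0[OF that] slack by blast
    qed (use D finite_reduced le in auto)
    then obtain g where g: "coloring D ?R g" by blast
    show ?thesis
      using coloring_override[OF f g] D(2)
      by (intro disjI1 exI[of _ "\<lambda>u. if u \<in> S then f u else g u"]) auto
  next
    case color
    let ?f = "f(x := c)" and ?S = "insert x S" and ?U = "D - {x}"
    have xS: "x \<notin> S" using color D by auto
    have cS: "coloring ?S L ?f"
    proof -
      have *: "f s \<noteq> c" if "s \<in> S" "E x s" for s
        using color(4) that by (auto simp: reduced_def)
      show ?thesis
        using f color(4) xS * E_sym E_irrefl by (auto simp: coloring_def reduced_def)
    qed
    have sl: "slack L ?S ?f y"
    proof (cases "c \<in> L y")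
      case False
      then show ?thesis using color E_sym by (auto simp: slack_def)
    next
      case True
      then obtain s where s: "s \<in> S" "E y s" "f s = c" using color(5) by (auto simp: reduced_def)
      have "s \<noteq> x" using s xS by auto
      then show ?thesis
        using s color(3) E_sym[OF color(3)] unfolding slack_def
        by (intro disjI2 bexI[of _ x] bexI[of _ s]) auto
    qed
    obtain g where g: "coloring ?U (reduced ?S ?f L) g"
    proof -
      have "(\<exists>g. coloring ?U (reduced ?S ?f L) g)"
      proof (rule conjunct1[OF reduced_degree_slack])
        show "\<exists>u\<in>A. slack L ?S ?f u" if "nb_closed ?U A" "A \<noteq> {}" for A
          using conn1[OF that color(1)] sl color E_irrefl by blast
      qed (use D nbD in auto)
      then show ?thesis using that by blast
    qed
    have "coloring (?S \<union> ?U) L (\<lambda>u. if u \<in> ?S then ?f u else g u)"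
      using coloring_override[OF cS g] D(2) by auto
    moreover have "?S \<union> ?U = S \<union> D" using color by auto
    ultimately show ?thesis
      using xS by (intro disjI1 exI[of _ "\<lambda>u. if u \<in> ?S then ?f u else g u"]) auto
  next
    case const
    show ?thesis
    proof (cases "D = {}")
      case True
      then show ?thesis by auto
    next
      case False
      then obtain d where d: "d \<in> D" by auto
      have "{u \<in> D. ?R u = ?R d} = D"
      proof (rule conn0)
        show "nb_closed D {u \<in> D. ?R u = ?R d}"
        proof -
          have "?R x = ?R y" if "x \<in> D" "y \<in> D" "E x y" for x y
            using const(2) that E_sym[of x y] by (metis subset_antisym)
          then show ?thesis unfolding nb_closed_def by auto
        qed
      qed (use d in auto)
      then have "\<forall>u\<in>D. ?R u = ?R d" by blast
      then show ?thesis using const(1) by (intro disjI2 exI[of _ "?R d"]) metis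
    qed
  qed
qed

text \<open>Otherwise all reduced lists equal some \<open>Q\<close> without \<open>f s0\<close>,
  this color being lost at the neighbor \<open>d\<close> of \<open>s0\<close>. If \<open>d\<close>
  has a neighbor \<open>u\<close> in \<open>D\<close>, then \<open>u\<close> must lose
  \<open>f s0\<close> too, which only \<open>s0\<close> can cause, against the single leg of
  \<open>s0\<close>. If not, \<open>d\<close> is adjacent to all of \<open>S\<close>, and the
  repeated color gives it slack.\<close>

lemma leg_extension_unique_color:
  assumes S: "S = {s0, s1, s2}" "s0 \<noteq> s1" "s0 \<noteq> s2" "s1 \<noteq> s2" "S \<subseteq> V" and f: "coloring S L f"
    and f12: "f s1 = f s2" "f s0 \<noteq> f s1"
    and D: "D \<subseteq> V" "D \<noteq> {}" "D \<inter> S = {}" "\<And>u. u \<in> D \<Longrightarrow> nb u \<subseteq> D \<union> S"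
    and legs: "\<And>s u w. s \<in> S \<Longrightarrow> u \<in> D \<Longrightarrow> w \<in> D \<Longrightarrow> E s u \<Longrightarrow> E s w \<Longrightarrow> u = w"
    and avail: "\<And>d u. d \<in> D \<Longrightarrow> E s0 d \<Longrightarrow> u \<in> D \<Longrightarrow> E d u \<Longrightarrow> f s0 \<in> L u"
  shows "\<exists>h. coloring (S \<union> D) L h \<and> (\<forall>s\<in>S. h s = f s)"
proof (rule ccontr)
  assume no: "\<not> ?thesis"
  have c3: "card S = 3" using S by auto
  have "\<exists>Q. \<forall>u\<in>D. reduced S f L u = Q \<and> card Q = card (nb u \<inter> D)"
  proof -
    have "(\<exists>h. coloring (S \<union> D) L h \<and> (\<forall>s\<in>S. h s = f s)) \<or>
      (\<exists>Q. \<forall>u\<in>D. reduced S f L u = Q \<and> card Q = card (nb u \<inter> D))"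
      by (rule leg_extension[OF c3 S(5) f D(1,3)]) (fact D(4), rule legs)
    then show ?thesis by (rule disjE) (rule notE[OF no], assumption, assumption)
  qed
  then obtain Q where Q: "\<And>u. u \<in> D \<Longrightarrow> reduced S f L u = Q"
    "\<And>u. u \<in> D \<Longrightarrow> card Q = card (nb u \<inter> D)" by blast
  obtain d where d: "d \<in> D" "E s0 d"
    using attach[OF D(1,2) c3 S(5) D(3,4), of s0] S by auto
  have kQ: "f s0 \<notin> Q" using Q(1)[OF d(1)] d(2) E_sym S by (auto simp: reduced_def)
  show False
  proof (cases "nb d \<inter> D = {}")
    case True
    have "nb d \<subseteq> S" using D(4)[OF d(1)] True by blast
    then have "nb d = S"
      using c3 card_nb d(1) D(1) S by (metis card_subset_eq finite.emptyI finite_insert subsetD)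
    then have "slack L S f d" using S f12 by (auto simp: slack_def nb_def)
    then have "card (nb d \<inter> D) < card Q"
      using reduced_props(2)[of d S D f] D d Q(1) by (metis Int_commute Un_commute subsetD)
    then show False using Q(2)[OF d(1)] by simp
  next
    case False
    then obtain u where u: "u \<in> D" "E d u" by auto
    have "f s0 \<in> f ` (nb u \<inter> S)" using Q(1)[OF u(1)] avail[OF d u] kQ by (auto simp: reduced_def)
    then have "E u s0" using S f12 by auto
    then have "u = d" using legs[of s0 u d] S u d E_sym by blast
    then show False using u E_irrefl by blast
  qed
qed

end

section \<open>Lists that are not constant\<close>

context cubic_graph
begin

lemma nb_closed_all:
  assumes A: "nb_closed (V - S) A" "A \<noteq> {}" and S: "finite S" "card S \<le> 2"
  shows "A = V - S"
proof -
  have "V \<subseteq> A \<union> S"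
    by (rule three_connected) (use A S E_V2 in \<open>auto simp: nb_closed_def\<close>)
  then show ?thesis using A by (auto simp: nb_closed_def)
qed

text \<open>Two triangles \<open>x w z\<close> and \<open>x w z'\<close> use up all edges at
  \<open>x\<close> and \<open>w\<close>, so \<open>z\<close> and \<open>z'\<close> separate them
  from everything else; the graph would have only four vertices.\<close>

lemma no_diamond:
  assumes "E x w" "E x z" "E w z" "E x z'" "E w z'"
  shows "z = z'"
proof (rule ccontr)
  assume n: "z \<noteq> z'"
  have ne: "x \<noteq> w" "x \<noteq> z" "w \<noteq> z" "x \<noteq> z'" "w \<noteq> z'" using assms E_irrefl by auto
  have "nb x = {w, z, z'}" using assms ne n by (intro nb_eq3) auto
  moreover have "nb w = {x, z, z'}" using assms ne n E_sym by (intro nb_eq3) auto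
  ultimately have "V \<subseteq> {x, w} \<union> {z, z'}"
    using ne n E_V assms by (intro three_connected) auto
  moreover have "{x, w} \<union> {z, z'} \<subseteq> V" using assms E_V E_V2 by auto
  ultimately have "V = {x, w} \<union> {z, z'}" by auto
  then show False using card_V ne n by auto
qed

lemma exposed_class:
  assumes "E x y" "c \<notin> L y" "col f" "col g" "f x = c" "g x = c"
  shows "eqv f g"
proof (rule equiv_extension)
  show "{x} \<subseteq> V" using assms E_V by auto
  show "\<exists>u\<in>A. slack L {x} f u" if "nb_closed (V - {x}) A" "A \<noteq> {}" for A
  proof -
    have "A = V - {x}" using nb_closed_all[OF that] by simp
    then have "y \<in> A" using assms E_V2 E_irrefl by auto
    then show ?thesis using assms E_sym by (intro bexI[of _ y]) (auto simp: slack_def)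
  qed
qed (use assms in auto)

lemma pair_class:
  assumes "E y s" "E y t" "s \<noteq> t" "col f" "col g" "f s = f t" "g s = f s" "g t = f s"
  shows "eqv f g"
proof (rule equiv_extension)
  show "{s, t} \<subseteq> V" using assms E_V2 by auto
  show "\<exists>u\<in>A. slack L {s, t} f u" if "nb_closed (V - {s, t}) A" "A \<noteq> {}" for A
  proof -
    have "card {s, t} \<le> 2" by (simp add: card_insert_if)
    then have "A = V - {s, t}" using nb_closed_all[OF that] by simp
    then have "y \<in> A" using assms E_V E_irrefl by auto
    then show ?thesis using assms by (intro bexI[of _ y]) (auto simp: slack_def)
  qed
qed (use assms in auto)

section \<open>Exposed colors and links between their classes\<close>

definition exposed :: "'a \<Rightarrow> 'c \<Rightarrow> bool" where
  "exposed x c \<longleftrightarrow> c \<in> L x \<and> (\<exists>y. E x y \<and> c \<notin> L y)"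

text \<open>Vacuously true if one of the two classes is empty; therefore transitivity asks for an
  exposed color in the middle, which some coloring attains.\<close>

definition linked :: "'a \<Rightarrow> 'c \<Rightarrow> 'a \<Rightarrow> 'c \<Rightarrow> bool" where
  "linked x c y d \<longleftrightarrow> (\<forall>f g. col f \<longrightarrow> col g \<longrightarrow> f x = c \<longrightarrow> g y = d \<longrightarrow> eqv f g)"

lemma linked_sym: "linked x c y d \<Longrightarrow> linked y d x c"
  using equiv_on_sym unfolding linked_def by blast

lemma exposed_exists:
  assumes "exposed x c"
  shows "\<exists>f. col f \<and> f x = c"
proof -
  obtain y where y: "c \<in> L x" "E x y" "c \<notin> L y" using assms by (auto simp: exposed_def)
  have "\<exists>g. col g \<and> (\<forall>s\<in>{x}. g s = (\<lambda>_. c) s)"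
  proof (rule extension_exists)
    show "{x} \<subseteq> V" using y E_V by auto
    show "coloring {x} L (\<lambda>_. c)" using y E_irrefl by (auto simp: coloring_def)
    show "\<exists>u\<in>A. slack L {x} (\<lambda>_. c) u" if "nb_closed (V - {x}) A" "A \<noteq> {}" for A
    proof -
      have "A = V - {x}" using nb_closed_all[OF that] by simp
      then have "y \<in> A" using y E_V2 E_irrefl by auto
      then show ?thesis using y E_sym by (intro bexI[of _ y]) (auto simp: slack_def)
    qed
  qed
  then show ?thesis by auto
qed

lemma linked_trans:
  assumes "linked x c y d" "linked y d z e" "exposed y d"
  shows "linked x c z e"
proof -
  obtain h where "col h" "h y = d" using exposed_exists[OF assms(3)] by blast
  then have "eqv f h" "eqv h g" if "col f" "col g" "f x = c" "g z = e" for f g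
    using assms(1,2) that unfolding linked_def by blast+
  then show ?thesis unfolding linked_def by (blast intro: rtranclp_trans)
qed

text \<open>One common coloring is enough, as each of the two classes is a single equivalence class
  by \<open>exposed_class\<close>.\<close>

lemma linked_witness:
  assumes "exposed x c" "exposed y d" "col h" "h x = c" "h y = d"
  shows "linked x c y d"
  unfolding linked_def
proof (intro allI impI)
  fix f g assume fg: "col f" "col g" "f x = c" "g y = d"
  obtain x' y' where "E x x'" "c \<notin> L x'" "E y y'" "d \<notin> L y'" using assms by (auto simp: exposed_def)
  then have "eqv f h" "eqv h g" using exposed_class assms fg by metis+
  then show "eqv f g" by (rule rtranclp_trans)
qed

text \<open>With \<open>x\<close> and \<open>y\<close> colored the rest is still connected, so the
  slack at the third vertex \<open>u\<close> yields a coloring in both classes.\<close>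

lemma linked_slack:
  assumes xc: "exposed x c" and yd: "exposed y d" and ne: "x \<noteq> y" "E x y \<Longrightarrow> c \<noteq> d"
    and u: "u \<noteq> x" "u \<noteq> y" "E x u \<and> c \<notin> L u \<or> E y u \<and> d \<notin> L u"
  shows "linked x c y d"
proof -
  let ?f = "\<lambda>v. if v = x then c else d"
  have V: "x \<in> V" "y \<in> V" "u \<in> V" using xc yd E_V u E_V2 by (auto simp: exposed_def)
  have "\<exists>g. col g \<and> (\<forall>s\<in>{x, y}. g s = ?f s)"
  proof (rule extension_exists)
    show "coloring {x, y} L ?f"
      using xc yd ne E_irrefl E_sym by (auto simp: coloring_def exposed_def)
    show "\<exists>u\<in>A. slack L {x, y} ?f u" if "nb_closed (V - {x, y}) A" "A \<noteq> {}" for A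
    proof -
      have "card {x, y} \<le> 2" by (simp add: card_insert_if)
      then have "A = V - {x, y}" using nb_closed_all[OF that] by simp
      then have "u \<in> A" using u V by auto
      then show ?thesis using u ne E_sym by (intro bexI[of _ u]) (auto simp: slack_def)
    qed
  qed (use V in auto)
  then obtain g where "col g" "g x = c" "g y = d" using ne by auto
  then show ?thesis using linked_witness xc yd by blast
qed

lemma exposedI: "E x y \<Longrightarrow> c \<in> L x \<Longrightarrow> c \<notin> L y \<Longrightarrow> exposed x c"
  by (auto simp: exposed_def)

text \<open>If the apex \<open>z\<close> lacks \<gamma> or \<epsilon>, it has slack. Otherwise it
  gets its third color, and the rest hangs on the three edges that leave the triangle. Should the
  rest not be colorable, its rigid lists expose \<gamma> and \<epsilon> at the outer neighbors
  \<open>x'\<close> and \<open>w'\<close>, and a detour through these replaces the common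
  coloring.\<close>

lemma triangle_linked:
  assumes xw: "E x w" and g: "\<gamma> \<in> L x" "\<gamma> \<notin> L w" and e: "\<epsilon> \<in> L w" "\<epsilon> \<notin> L x"
    and z: "E x z" "E w z"
  shows "linked x \<gamma> w \<epsilon>"
proof -
  note sy = E_sym[OF xw] E_sym[OF z(1)] E_sym[OF z(2)]
  have ex: "exposed x \<gamma>" "exposed w \<epsilon>" using xw sy g e by (auto intro: exposedI)
  have ne: "x \<noteq> w" "z \<noteq> x" "z \<noteq> w" "\<gamma> \<noteq> \<epsilon>" using xw z E_irrefl g e by auto
  have V: "x \<in> V" "w \<in> V" "z \<in> V" using xw z E_V E_V2 by auto
  show ?thesis
  proof (cases "\<gamma> \<in> L z \<and> \<epsilon> \<in> L z")
    case False
    then show ?thesis using linked_slack[OF ex ne(1), of z] ne z by blast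
  next
    case True
    obtain \<alpha> \<beta> where ab: "L z = {\<gamma>, \<alpha>, \<beta>}" "\<gamma> \<noteq> \<alpha>" "\<gamma> \<noteq> \<beta>" "\<alpha> \<noteq> \<beta>"
      using L_obtain2[OF conjunct1[OF True] V(3)] .
    have "\<epsilon> = \<alpha> \<or> \<epsilon> = \<beta>" using True ab ne(4) by auto
    then obtain \<delta> where d: "L z = {\<gamma>, \<epsilon>, \<delta>}" "\<gamma> \<noteq> \<delta>" "\<epsilon> \<noteq> \<delta>"
      using ab by (elim disjE) (auto simp: insert_commute)
    define f where "f = (\<lambda>v. if v = x then \<gamma> else if v = w then \<epsilon> else \<delta>)"
    have fv: "f x = \<gamma>" "f w = \<epsilon>" "f z = \<delta>" using ne by (auto simp: f_def)
    let ?S = "{x, w, z}"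
    let ?D = "V - ?S"
    have cS: "coloring ?S L f"
      using ne d g e fv E_irrefl by (auto simp: coloring_def)
    obtain x' where x': "nb x = {w, z, x'}" "w \<noteq> x'" "z \<noteq> x'"
      using nb_obtain1[OF xw z(1)] ne by metis
    obtain w' where w': "nb w = {x, z, w'}" "x \<noteq> w'" "z \<noteq> w'"
      using nb_obtain1[OF sy(1) z(2)] ne by metis
    obtain z' where z': "nb z = {x, w, z'}" "x \<noteq> z'" "w \<noteq> z'"
      using nb_obtain1[OF sy(2,3)] ne by metis
    have "x' \<in> nb x" "w' \<in> nb w" using x' w' by blast+
    then have Ex': "E x x'" "E w w'" "E x' x" "E w' w" using E_sym by simp_all
    have inD: "x' \<in> ?D" "w' \<in> ?D" using Ex' x' w' E_V2 E_irrefl by auto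
    have legs: "u = v" if st: "s \<in> ?S" "u \<in> ?D" "v \<in> ?D" "E s u" "E s v" for s u v
    proof -
      have uv: "u \<in> nb s" "v \<in> nb s" "u \<notin> ?S" "v \<notin> ?S" using st by simp_all
      consider "s = x" | "s = w" | "s = z" using st(1) by blast
      then show ?thesis
      proof cases
        case 1
        then have "u = x'" "v = x'" using uv x'(1) by blast+
        then show ?thesis by simp
      next
        case 2
        then have "u = w'" "v = w'" using uv w'(1) by blast+
        then show ?thesis by simp
      next
        case 3
        then have "u = z'" "v = z'" using uv z'(1) by blast+
        then show ?thesis by simp
      qed
    qed
    have nbD: "nb u \<subseteq> ?D \<union> ?S" for u using nb_V by auto
    have "(\<exists>h. coloring (?S \<union> ?D) L h \<and> (\<forall>s\<in>?S. h s = f s)) \<or>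
      (\<exists>Q. \<forall>u\<in>?D. reduced ?S f L u = Q \<and> card Q = card (nb u \<inter> ?D))"
    proof (rule leg_extension)
      show "card ?S = 3" using ne by simp
      show "u = v" if "s \<in> ?S" "u \<in> ?D" "v \<in> ?D" "E s u" "E s v" for s u v
        using legs[OF that] .
    qed (use V cS nbD in auto)
    then consider h where "coloring (?S \<union> ?D) L h" "\<forall>s\<in>?S. h s = f s"
      | Q where "\<forall>u\<in>?D. reduced ?S f L u = Q \<and> card Q = card (nb u \<inter> ?D)"
      by meson
    then show ?thesis
    proof cases
      case 1
      moreover have "?S \<union> ?D = V" using V by auto
      ultimately show ?thesis using linked_witness[OF ex, of h] fv by simp
    next
      case 2
      \<comment> \<open>Since no two triangles share an edge, \<open>x'\<close> and
        \<open>w'\<close> each see just one vertex of the triangle and have two neighbors outside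
        it, so \<open>Q\<close> has two colors.\<close>
      have nx': "\<not> E x' w" "\<not> E x' z" "\<not> E w' x" "\<not> E w' z"
        using no_diamond[of x w z x'] no_diamond[of x z w x'] no_diamond[of x w z w']
          no_diamond[of w z x w'] xw z sy Ex' x' w' ne E_sym by metis+
      have two: "card (nb v \<inter> ?D) = 2" "reduced ?S f L v = L v - {f s}"
        if vs: "E v s" "s \<in> ?S" "\<And>t. t \<in> ?S \<Longrightarrow> t \<noteq> s \<Longrightarrow> \<not> E v t" for v s
      proof -
        obtain p q where pq: "nb v = {s, p, q}" "s \<noteq> p" "s \<noteq> q" "p \<noteq> q" "E v p" "E v q"
          using nb_obtain2[OF vs(1)] .
        have "p \<in> ?D" "q \<in> ?D" "s \<notin> ?D" using pq vs E_V2 by blast+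
        then have "nb v \<inter> ?D = {p, q}" unfolding pq(1) by (simp only: Int_insert_left if_True if_False Int_empty_left)
        then show "card (nb v \<inter> ?D) = 2" using pq by simp
        have "t = s" if "t \<in> nb v" "t \<in> ?S" for t using vs(3)[of t] that by auto
        moreover have "s \<in> nb v \<inter> ?S" using vs(1,2) by simp
        ultimately have "nb v \<inter> ?S = {s}" by blast
        then show "reduced ?S f L v = L v - {f s}" by (simp add: reduced_def)
      qed
      have rx: "card (nb x' \<inter> ?D) = 2" "reduced ?S f L x' = L x' - {\<gamma>}"
        using two[of x' x] Ex' nx' fv by auto
      have rw: "card (nb w' \<inter> ?D) = 2" "reduced ?S f L w' = L w' - {\<epsilon>}"
        using two[of w' w] Ex' nx' fv by auto
      have Q: "L x' - {\<gamma>} = Q" "L w' - {\<epsilon>} = Q" "card Q = 2" using 2 rx rw inD by auto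
      have no_loss: "c \<in> L v" if "L v - {c} = Q" "v \<in> ?D" for c v
      proof (rule ccontr)
        assume "c \<notin> L v"
        then have "L v = Q" using that(1) by blast
        then show False using Q(3) card_L[of v] that(2) by simp
      qed
      have in_x: "\<gamma> \<in> L x'" and in_w: "\<epsilon> \<in> L w'"
        using no_loss Q inD by blast+
      have gw: "\<gamma> \<notin> L w'" "\<epsilon> \<notin> L x'" using Q ne by auto
      \<comment> \<open>The three triangle colors are distinct, so a vertex of the rest can lose
        \<open>f s\<close> only by being adjacent to \<open>s\<close>; if it is not, its list cannot
        contain \<open>f s\<close>.\<close>
      have missing: "f s \<notin> L u" if "s \<in> ?S" "u \<in> ?D" "f s \<notin> Q" "\<not> E u s" for s u
      proof
        assume "f s \<in> L u"
        then have "f s \<in> f ` (nb u \<inter> ?S)" using 2 that by (auto simp: reduced_def)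
        then show False using that fv ne d by auto
      qed
      obtain u where u: "E x' u" "u \<in> ?D" "u \<noteq> w'"
      proof -
        have "\<not> nb x' \<inter> ?D \<subseteq> {w'}"
          using rx(1) card_mono[of "{w'}" "nb x' \<inter> ?D"] by auto
        then obtain u where "u \<in> nb x'" "u \<in> ?D" "u \<noteq> w'" by blast
        then show ?thesis using that[of u] by simp
      qed
      have "u \<noteq> x'" using u E_irrefl by auto
      have "\<not> E u x" using legs[of x u x'] u inD E_sym[of u x] \<open>u \<noteq> x'\<close> Ex' by blast
      then have gu: "\<gamma> \<notin> L u" using missing[of x u] u(2) fv(1) Q(1) by blast
      obtain u' where u': "E w' u'" "u' \<in> ?D"
      proof -
        have "nb w' \<inter> ?D \<noteq> {}" using rw(1) by auto
        then obtain u where "u \<in> nb w'" "u \<in> ?D" by blast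
        then show ?thesis using that[of u] by simp
      qed
      have "u' \<noteq> w'" using u' E_irrefl by auto
      have "\<not> E u' w" using legs[of w u' w'] u' inD E_sym[of u' w] \<open>u' \<noteq> w'\<close> Ex' by blast
      then have eu: "\<epsilon> \<notin> L u'" using missing[of w u'] u'(2) fv(2) Q(2) by blast
      have ex': "exposed x' \<gamma>" "exposed w' \<epsilon>"
        using exposedI u u' gu eu in_x in_w by blast+
      have "x' \<noteq> w'" using in_x gw by auto
      \<comment> \<open>The detour alternates between the two ends; the slack comes from
        \<open>w\<close>, then from the neighbor \<open>u\<close> of \<open>x'\<close> lacking
        \<gamma>, then from \<open>x\<close>.\<close>
      have l1: "linked x \<gamma> w' \<epsilon>"
        by (rule linked_slack[OF ex(1) ex'(2), of w]) (use w' ne xw g Ex' E_irrefl in auto)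
      have l2: "linked w' \<epsilon> x' \<gamma>"
        by (rule linked_slack[OF ex'(2,1), of u]) (use u gu \<open>u \<noteq> x'\<close> \<open>x' \<noteq> w'\<close> ne in auto)
      have l3: "linked x' \<gamma> w \<epsilon>"
        by (rule linked_slack[OF ex'(1) ex(2), of x]) (use x' ne sy e Ex' E_irrefl in auto)
      show ?thesis using linked_trans[OF l1 linked_trans[OF l2 l3]] ex' by blast
    qed
  qed
qed

text \<open>The detour uses a color \<open>d\<close> of \<open>y\<close> that \<open>x\<close>
  lacks: with \<gamma> at \<open>x\<close> the slack is at \<open>w\<close>, and with
  \<open>d\<close> at \<open>y\<close> it is at \<open>x\<close>. Nonadjacency of \<open>w\<close>
  and \<open>y\<close> allows \<open>d\<close> to coincide with \<epsilon>.\<close>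

lemma neighbor_linked:
  assumes xw: "E x w" and g: "\<gamma> \<in> L x" "\<gamma> \<notin> L w" and e: "\<epsilon> \<in> L w" "\<epsilon> \<notin> L x"
    and y: "E x y" "\<not> E w y" "L y \<noteq> L x" "y \<noteq> w"
  shows "linked x \<gamma> w \<epsilon>"
proof -
  obtain d where d: "d \<in> L y" "d \<notin> L x" using L_diff[of y x] y E_V E_V2 by metis
  have ex: "exposed x \<gamma>" "exposed w \<epsilon>" "exposed y d"
    using exposedI xw y d g e E_sym by blast+
  have ne: "x \<noteq> y" "x \<noteq> w" using xw y E_irrefl by auto
  have l1: "linked x \<gamma> y d"
    by (rule linked_slack[OF ex(1,3), of w]) (use xw y d g ne in auto)
  have l2: "linked y d w \<epsilon>"
    by (rule linked_slack[OF ex(3,2), of x]) (use xw y d g ne E_sym in auto)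
  show ?thesis using linked_trans[OF l1 l2 ex(3)] .
qed

text \<open>The rest after deleting \<open>S\<close> is connected, so the vertices with list
  \<open>A\<close> cannot form a closed set there.\<close>

lemma boundary_edge:
  assumes "finite S" "card S \<le> 2" "p \<in> V - S" "q \<in> V - S" "L p = A" "L q \<noteq> A"
  obtains x w where "E x w" "x \<notin> S" "w \<notin> S" "L x = A" "L w \<noteq> A"
proof -
  have "\<not> nb_closed (V - S) {u \<in> V - S. L u = A}"
    using nb_closed_all[of S "{u \<in> V - S. L u = A}"] assms by blast
  then show ?thesis using that unfolding nb_closed_def by blast
qed

lemma cross_linked:
  assumes "E x w" "\<gamma> \<in> L x" "\<gamma> \<notin> L w" "E y v" "\<epsilon> \<in> L v" "\<epsilon> \<notin> L y" "w \<noteq> v" "x \<noteq> v" "\<gamma> \<noteq> \<epsilon>"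
  shows "linked x \<gamma> v \<epsilon>"
  by (rule linked_slack[of _ _ _ _ w]) (use assms E_irrefl E_sym exposedI in blast)+

text \<open>A common neighbor, or a further neighbor of an end with a list unlike that of this end,
  settles the claim. An edge with neither is \<open>isolated\<close>; then another edge along which
  the lists change, found away from this one, carries a detour. If that edge is isolated as well, a
  third edge joins the two.\<close>

lemma edge_linked:
  assumes xw: "E x w" and g: "\<gamma> \<in> L x" "\<gamma> \<notin> L w" and e: "\<epsilon> \<in> L w" "\<epsilon> \<notin> L x"
  shows "linked x \<gamma> w \<epsilon>"
proof -
  define isolated where "isolated x w \<longleftrightarrow> (\<forall>z. \<not> (E x z \<and> E w z)) \<and>
    (\<forall>y. E x y \<and> y \<noteq> w \<longrightarrow> L y = L x) \<and> (\<forall>y. E w y \<and> y \<noteq> x \<longrightarrow> L y = L w)" for x w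
  have easy: "linked x \<gamma> w \<epsilon>" if ni: "\<not> isolated x w"
    and that: "E x w" "\<gamma> \<in> L x" "\<gamma> \<notin> L w" "\<epsilon> \<in> L w" "\<epsilon> \<notin> L x"
    for x w \<gamma> \<epsilon>
  proof (cases "\<exists>z. E x z \<and> E w z")
    case True
    then show ?thesis using triangle_linked that by blast
  next
    case False
    then consider y where "E x y" "y \<noteq> w" "L y \<noteq> L x" | y where "E w y" "y \<noteq> x" "L y \<noteq> L w"
      using ni unfolding isolated_def by blast
    then show ?thesis
    proof cases
      case 1
      then show ?thesis using neighbor_linked[of x w \<gamma> \<epsilon> y] False that by blast
    next
      case 2
      then show ?thesis
        using neighbor_linked[of w x \<epsilon> \<gamma> y] False that E_sym linked_sym by blast
    qed
  qed
  show ?thesis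
  proof (cases "isolated x w")
    case False
    then show ?thesis using easy assms by blast
  next
    case iso: True
    have ne: "x \<noteq> w" using xw E_irrefl by auto
    obtain y where y: "E x y" "y \<noteq> w" using nb_obtain2[OF xw] by (metis in_nb insertCI)
    obtain r where r: "E w r" "r \<noteq> x" using nb_obtain2[OF E_sym[OF xw]] by (metis in_nb insertCI)
    have Ly: "L y = L x" "L r = L w" using iso y r unfolding isolated_def by blast+
    have Lne: "L x \<noteq> L w" using g by auto
    have c2: "card {a, b} \<le> 2" for a b :: 'a by (simp add: card_insert_if)
    have "y \<in> V - {x, w}" "r \<in> V - {x, w}" using y r E_V2 E_irrefl by blast+
    then obtain x' w' where x': "E x' w'" "x' \<notin> {x, w}" "w' \<notin> {x, w}" "L x' = L x" "L w' \<noteq> L x"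
      using boundary_edge[of "{x, w}" y r "L x"] Ly Lne c2 by (metis finite.emptyI finite_insert)
    have V: "x \<in> V" "w \<in> V" "x' \<in> V" "w' \<in> V" using xw x' E_V E_V2 by blast+
    obtain \<gamma>' where g': "\<gamma>' \<in> L x'" "\<gamma>' \<notin> L w'" using L_diff[of x' w'] V x' by metis
    obtain \<epsilon>' where e': "\<epsilon>' \<in> L w'" "\<epsilon>' \<notin> L x'" using L_diff[of w' x'] V x' by metis
    have l1: "linked x \<gamma> w' \<epsilon>'"
      by (rule cross_linked[OF xw g x'(1) e']) (use x' e' g in auto)
    have l2: "linked x' \<gamma>' w \<epsilon>"
      by (rule cross_linked[OF x'(1) g' xw e]) (use x' e g' in auto)
    have ex: "exposed x' \<gamma>'" "exposed w' \<epsilon>'" using x'(1) g' e' E_sym exposedI by blast+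
    show ?thesis
    proof (cases "isolated x' w'")
      case False
      have "linked w' \<epsilon>' x' \<gamma>'" using easy[OF False x'(1) g' e'] linked_sym by blast
      then show ?thesis using linked_trans[OF l1 linked_trans[OF _ l2]] ex by blast
    next
      case iso': True
      have "x' \<in> V - {x, w'}" "w \<in> V - {x, w'}" using x' V ne E_irrefl by blast+
      then obtain x2 w2 where x2: "E x2 w2" "x2 \<notin> {x, w'}" "w2 \<notin> {x, w'}" "L x2 = L x" "L w2 \<noteq> L x"
        using boundary_edge[of "{x, w'}" x' w "L x"] x' Lne c2 by (metis finite.emptyI finite_insert)
      \<comment> \<open>Isolation separates the edges: \<open>x'\<close> has only \<open>w'\<close>
        as a neighbor with another list, and \<open>x\<close> is the only neighbor of
        \<open>w\<close> with the list \<open>L x\<close>.\<close>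
      have "x2 \<noteq> x'" using iso' x2 x' unfolding isolated_def by blast
      have "w2 \<noteq> w" using iso x2 Lne E_sym unfolding isolated_def by (metis insert_iff)
      have V2: "x2 \<in> V" "w2 \<in> V" using x2 E_V E_V2 by blast+
      obtain \<epsilon>2 where e2: "\<epsilon>2 \<in> L w2" "\<epsilon>2 \<notin> L x2" using L_diff[of w2 x2] V2 x2 by metis
      have m1: "linked x \<gamma> w2 \<epsilon>2"
        by (rule cross_linked[OF xw g x2(1) e2]) (use x2 e2 g \<open>w2 \<noteq> w\<close> in auto)
      have m2: "linked x' \<gamma>' w2 \<epsilon>2"
        by (rule cross_linked[OF x'(1) g' x2(1) e2]) (use x2 x' e2 g' in auto)
      have ex2: "exposed w2 \<epsilon>2" using x2(1) e2 E_sym exposedI by blast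
      show ?thesis
        using linked_trans[OF linked_trans[OF m1 linked_sym[OF m2] ex2] l2] ex by blast
    qed
  qed
qed

text \<open>Each exposed color comes with an edge, and \<open>edge_linked\<close> lets one pass to a
  color of its other end. After such passages two exposed colors meet in a coloring with slack. The
  cases are the ways in which the two edges may share ends; for disjoint edges only adjacent
  \<open>x\<close> and \<open>x'\<close> with the same color need a passage.\<close>

lemma exposed_linked:
  assumes xc: "E x y" "c \<in> L x" "c \<notin> L y" and xc': "E x' y'" "c' \<in> L x'" "c' \<notin> L y'"
  shows "linked x c x' c'"
proof -
  have V: "x \<in> V" "y \<in> V" "x' \<in> V" "y' \<in> V" using xc xc' E_V E_V2 by blast+
  obtain d where d: "d \<in> L y" "d \<notin> L x" using L_diff[of y x] V xc by metis
  obtain d' where d': "d' \<in> L y'" "d' \<notin> L x'" using L_diff[of y' x'] V xc' by metis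
  have ex: "exposed x c" "exposed y d" "exposed x' c'" "exposed y' d'"
    using exposedI xc xc' d d' E_sym by blast+
  have ne: "x \<noteq> y" "x' \<noteq> y'" using xc xc' E_irrefl by blast+
  have l: "linked x c y d" using edge_linked xc d by blast
  have l': "linked y' d' x' c'" using edge_linked xc' d' linked_sym by blast
  have share: "linked p b q' e" if "E p q" "E p q'" "q \<noteq> q'" "b \<in> L p" "b \<notin> L q" "e \<in> L q'" "e \<notin> L p"
    for p q q' b e
    by (rule linked_slack[of _ _ _ _ q]) (use that exposedI E_sym E_irrefl in blast)+
  consider "x = x'" "y = y'" | "x = x'" "y \<noteq> y'" | "x = y'" "y = x'" | "x = y'" "y \<noteq> x'"
    | "y = x'" "x \<noteq> y'" | "y = y'" "x \<noteq> x'" | "x \<noteq> x'" "x \<noteq> y'" "y \<noteq> x'" "y \<noteq> y'"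
    by blast
  then show ?thesis
  proof cases
    case 1
    then have "linked y d x' c'" using edge_linked[of x y c' d] xc xc' d linked_sym by blast
    then show ?thesis using linked_trans[OF l] ex by blast
  next
    case 2
    then have "linked x c y' d'" using share[of x y y' c d'] xc xc' d' by blast
    then show ?thesis using linked_trans[OF _ l'] ex by blast
  next
    case 3
    then show ?thesis using edge_linked[of x y c c'] xc xc' by blast
  next
    case 4
    then show ?thesis using share[of x y x' c c'] xc xc' E_sym by blast
  next
    case 5
    then show ?thesis using share[of y y' x c' c] xc xc' E_sym linked_sym by metis
  next
    case 6
    then have "linked y d x' c'" using share[of y x x' d c'] xc xc' d E_sym by metis
    then show ?thesis using linked_trans[OF l] ex by blast
  next
    case 7
    show ?thesis
    proof (cases "E x x' \<and> c = c'")
      case False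
      then show ?thesis using linked_slack[OF ex(1,3), of y] 7 ne xc by blast
    next
      case True
      then have "linked x c y' d'" using linked_slack[OF ex(1,4), of y] 7 ne xc xc' d' by blast
      then show ?thesis using linked_trans[OF _ l'] ex by blast
    qed
  qed
qed

section \<open>Reaching an exposed color from an arbitrary coloring\<close>

lemma stuck_nb_subset: "u \<in> stuck S f \<Longrightarrow> nb u \<subseteq> stuck S f \<union> S"
  using stuck_nb by (meson in_nb subsetI)

text \<open>Keeping the equal pair \<open>s1\<close>, \<open>s2\<close> keeps the equivalence class,
  so only an extension with \<kappa> at \<open>s0\<close> is required. On the stuck part
  \<open>f\<close> itself serves unless a neighbor \<open>d\<close> of \<open>s0\<close> has the
  color \<kappa> there. In that case \<open>avail\<close> at \<open>d\<close> puts \<kappa> into the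
  lists around \<open>d\<close>, as \<open>leg_extension_unique_color\<close> demands.\<close>

lemma recolor_one_of_three:
  assumes f: "col f" and ne: "s0 \<noteq> s1" "s0 \<noteq> s2" "s1 \<noteq> s2" and y: "E y s1" "E y s2"
    and f12: "f s1 = f s2" and k: "\<kappa> \<in> L s0" "\<kappa> \<noteq> f s1"
    and S: "S = {s0, s1, s2}" "S \<subseteq> V"
    and g: "g = f(s0 := \<kappa>)"
    and avail: "\<And>u v. E u v \<Longrightarrow> f u \<in> L v"
    and legs: "\<And>s u w. stuck S g \<noteq> {} \<Longrightarrow> s \<in> S \<Longrightarrow> u \<in> stuck S g \<Longrightarrow> w \<in> stuck S g \<Longrightarrow>
      E s u \<Longrightarrow> E s w \<Longrightarrow> u = w"
  shows "\<exists>h. eqv f h \<and> h s0 = \<kappa>"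
proof -
  let ?D = "stuck S g"
  have gv: "g s0 = \<kappa>" "g s1 = f s1" "g s2 = f s1" using ne f12 g by auto
  have D: "?D \<subseteq> V" "?D \<inter> S = {}"
    using stuck_subset[of S g] by blast+
  note nbD = stuck_nb_subset[of _ S g]
  have "s1 \<in> V" "s2 \<in> V" using S by auto
  then have "\<not> E s1 s2" using f f12 unfolding coloring_def by blast
  moreover have "\<not> E s2 s1" using calculation E_sym by blast
  ultimately have "\<not> E s1 s2" "\<not> E s2 s1" by blast+
  then have cg: "coloring S L g"
    using f k gv S f12 E_irrefl E_sym by (auto simp: coloring_def)
  have "\<exists>h. col h \<and> (\<forall>s\<in>S. h s = g s)"
  proof (rule extension_split)
    assume ne': "?D \<noteq> {}"
    show "\<exists>h. coloring (S \<union> ?D) L h \<and> (\<forall>s\<in>S. h s = g s)"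
    proof (cases "\<exists>d\<in>?D. E s0 d \<and> f d = \<kappa>")
      case False
      have "coloring (S \<union> ?D) L g"
        unfolding coloring_def
      proof (intro conjI ballI impI)
        fix u assume u: "u \<in> S \<union> ?D"
        then have "u \<in> V" using S D by blast
        then show "g u \<in> L u" using f k g by (auto simp: coloring_def)
      next
        fix u v assume u: "u \<in> S \<union> ?D" and v: "v \<in> S \<union> ?D" and e: "E u v"
        have V: "u \<in> V" "v \<in> V" using e E_V E_V2 by blast+
        have *: "f v \<noteq> \<kappa>" if "v \<in> S \<union> ?D" "E s0 v" for v
        proof (cases "v \<in> ?D")
          case False
          then have "v = s1 \<or> v = s2" using that S E_irrefl by auto
          then show ?thesis using k f12 by auto
        qed (use False that in blast)
        show "g u \<noteq> g v"
          using f V e *[OF u] *[OF v] E_sym[OF e] E_irrefl by (auto simp: g coloring_def)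
      qed
      then show ?thesis by blast
    next
      case True
      then obtain d where d: "d \<in> ?D" "E s0 d" "f d = \<kappa>" by blast
      show ?thesis
      proof (rule leg_extension_unique_color[OF S(1) ne S(2) cg])
        show "g s0 \<in> L u" if "d' \<in> ?D" "E s0 d'" "u \<in> ?D" "E d' u" for d' u
        proof -
          have "d' = d" by (rule legs[OF ne', of s0]) (use that d S in auto)
          then show ?thesis using avail that d gv by metis
        qed
        show "u = w" if "s \<in> S" "u \<in> ?D" "w \<in> ?D" "E s u" "E s w" for s u w
          using legs[OF ne' that] .
      qed (use D nbD ne' gv k in auto)
    qed
  qed fact+
  then obtain h where h: "col h" "\<forall>s\<in>S. h s = g s" by blast
  then have hv: "h s0 = \<kappa>" "h s1 = f s1" "h s2 = f s1" using gv S(1) by auto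
  have "eqv f h" by (rule pair_class[OF y ne(3) f h(1)]) (use hv f12 in auto)
  then show ?thesis using hv by blast
qed

lemma stuck_not_slack: "slack L S f u \<Longrightarrow> u \<notin> stuck S f"
  using stuck_no_slack by blast

lemma nb_two_determined:
  assumes "nb v = {a, b, c}" "u \<notin> {a, b}" "w \<notin> {a, b}" "E v u" "E v w"
  shows "u = w"
  using assms by (metis in_nb insert_iff singletonD)

text \<open>If no coloring equivalent to \<open>f\<close> uses an exposed color, each color in use
  belongs to the lists of all neighbors. This makes a neighbor \<open>y\<close> of \<open>x\<close>
  block \<gamma>, and two neighbors of \<open>y\<close> share a color. That pair is kept while
  \<open>x\<close> is recolored with \<gamma>, or \<open>w\<close> with \<epsilon> if
  \<open>x\<close> belongs to the pair.\<close>

lemma reach_exposed: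
  assumes xw: "E x w" and g: "\<gamma> \<in> L x" "\<gamma> \<notin> L w" and e: "\<epsilon> \<in> L w" "\<epsilon> \<notin> L x"
    and f: "col f"
  shows "\<exists>h u v. eqv f h \<and> col h \<and> E u v \<and> h u \<notin> L v"
proof (rule ccontr)
  assume no: "\<not> ?thesis"
  have eqv_col: "eqv f h \<Longrightarrow> col h" for h
    by (induction rule: rtranclp_induct) (auto simp: f step_def)
  have avail: "h u \<in> L v" if "eqv f h" "E u v" for h u v
    using no eqv_col that by blast
  have fa: "f u \<in> L v" if "E u v" for u v using avail that by blast
  have fg: "\<not> (\<exists>h. eqv f h \<and> h x = \<gamma>)" using avail xw g by metis
  have fe: "\<not> (\<exists>h. eqv f h \<and> h w = \<epsilon>)" using avail E_sym[OF xw] e by metis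
  have "x \<in> V" "w \<in> V" using xw E_V E_V2 by blast+
  have "\<exists>y. E x y \<and> f y = \<gamma>"
  proof (rule ccontr)
    assume "\<not> ?thesis"
    then have "step V L f (f(x := \<gamma>))"
      using f g \<open>x \<in> V\<close> by (intro recolor_step) auto
    then have "eqv f (f(x := \<gamma>))" by blast
    then show False using fg by fastforce
  qed
  then obtain y where y: "E x y" "f y = \<gamma>" by blast
  have neq: "x \<noteq> w" "x \<noteq> y" "y \<noteq> w" using xw y E_irrefl fa[OF E_sym[OF xw]] g fa[OF xw] 
    f \<open>w \<in> V\<close> by (auto simp: coloring_def)
  have nyw: "\<not> E y w" using fa[of y w] y g by auto
  obtain t1 t2 where t0: "nb y = {x, t1, t2}" "x \<noteq> t1" "x \<noteq> t2" "t1 \<noteq> t2" "E y t1" "E y t2"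
    using nb_obtain2[OF E_sym[OF y(1)]] .
  have yV: "y \<in> V" using y E_V2 by blast
  have "\<gamma> \<in> L y" using f yV y(2) unfolding coloring_def by blast
  then obtain \<alpha> \<beta> where Ly: "L y = {\<gamma>, \<alpha>, \<beta>}" using L_obtain2[OF _ yV] by metis
  have in_ab: "f v \<in> {\<alpha>, \<beta>}" if "E y v" for v
  proof -
    have "f v \<in> L y" using fa E_sym that by blast
    moreover have "f v \<noteq> \<gamma>" using f that y E_V E_V2 unfolding coloring_def by metis
    ultimately show ?thesis using Ly by auto
  qed
  \<comment> \<open>The colors around \<open>y\<close> lie in \<open>L y\<close> and differ from
    \<gamma>, so three neighbors share two colors.\<close>
  have "f t1 = f t2 \<or> f x = f t1 \<or> f x = f t2"
    using in_ab[OF t0(5)] in_ab[OF t0(6)] in_ab[OF E_sym[OF y(1)]] by auto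
  then consider (apart) "f t1 = f t2"
    | (same) t t' where "nb y = {x, t, t'}" "x \<noteq> t" "x \<noteq> t'" "t \<noteq> t'" "E y t" "E y t'" "f x = f t"
  proof (elim disjE)
    assume "f t1 = f t2"
    then show ?thesis by (rule that(1))
  next
    assume "f x = f t1"
    then show ?thesis by (rule that(2)[OF t0])
  next
    assume *: "f x = f t2"
    have "nb y = {x, t2, t1}" using t0(1) by blast
    then show ?thesis by (rule that(2)) (use t0 * in auto)
  qed
  then show False
  proof cases
    case apart
    let ?S = "{x, t1, t2}" and ?g = "f(x := \<gamma>)"
    let ?D = "stuck ?S ?g"
    have tw: "t1 \<noteq> w" "t2 \<noteq> w" using t0 nyw by auto
    have V: "?S \<subseteq> V" using t0 E_V2 \<open>x \<in> V\<close> by blast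
    have ft: "f t1 \<noteq> \<gamma>" using t0 y f yV E_V2 unfolding coloring_def by metis
    have "slack L ?S ?g y"
      using t0 apart unfolding slack_def by (intro disjI2 bexI[of _ t1] bexI[of _ t2]) auto
    then have yD: "y \<notin> ?D" by (rule stuck_not_slack)
    have "slack L ?S ?g w"
      using xw g E_sym unfolding slack_def by (intro disjI1 bexI[of _ x]) auto
    then have wD: "w \<notin> ?D" by (rule stuck_not_slack)
    \<comment> \<open>The other uncolored vertices, among them \<open>w\<close>, hang on
      \<open>?S\<close> too, so each leg has one edge to \<open>y\<close>, one into
      \<open>A\<close>, and at most one into the stuck part.\<close>
    define A where "A = V - ?S - ?D - {y}"
    have wA: "w \<in> A" using wD neq tw \<open>w \<in> V\<close> unfolding A_def by blast
    have nbA: "nb u \<subseteq> A \<union> ?S" if "u \<in> A" for u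
    proof
      fix v assume v: "v \<in> nb u"
      then have "v \<notin> ?D" using stuck_nb[of v ?S ?g u] that E_sym unfolding A_def by auto
      moreover have "v \<noteq> y" using v t0(1) E_sym[of u v] that unfolding A_def by (metis DiffD1 DiffD2 in_nb)
      ultimately show "v \<in> A \<union> ?S" using v nb_V[of u] unfolding A_def by blast
    qed
    have att: "\<exists>u\<in>A. E s u" if "s \<in> ?S" for s
      by (rule attach[of A ?S]) (use wA nbA V t0 that in \<open>auto simp: A_def\<close>)
    have "\<exists>h. eqv f h \<and> h x = \<gamma>"
    proof (rule recolor_one_of_three[OF f t0(2-4) t0(5,6) apart g(1) ft[symmetric] refl V refl fa])
      fix s u v assume s: "s \<in> ?S" and u: "u \<in> ?D" and v: "v \<in> ?D" and e: "E s u" "E s v"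
      obtain b where b: "b \<in> A" "E s b" using att[OF s] by blast
      have "E s y" using s t0 y E_sym by auto
      moreover have "y \<noteq> b" using b by (auto simp: A_def)
      ultimately obtain c where "nb s = {y, b, c}" using nb_obtain1[OF _ b(2)] by metis
      moreover have "u \<notin> {y, b}" "v \<notin> {y, b}" using b u v yD by (auto simp: A_def)
      ultimately show "u = v" using e nb_two_determined by metis
    qed
    then show False using fg by blast
  next
    case (same t t')
    let ?S = "{w, x, t}" and ?g = "f(w := \<epsilon>)"
    let ?D = "stuck ?S ?g"
    have tw: "t \<noteq> w" "t' \<noteq> w" using same nyw by auto
    have tV: "t \<in> V" "t' \<in> V" using same E_V2 by blast+
    have V: "?S \<subseteq> V" using \<open>x \<in> V\<close> \<open>w \<in> V\<close> tV by blast
    have fx: "f x \<noteq> \<epsilon>" using f \<open>x \<in> V\<close> e unfolding coloring_def by metis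
    have yx: "E y x" using y E_sym by blast
    have "slack L ?S ?g y"
      using same yx neq tw unfolding slack_def by (intro disjI2 bexI[of _ x] bexI[of _ t]) auto
    then have yD: "y \<notin> ?D" by (rule stuck_not_slack)
    have yS: "y \<notin> ?S" using neq same(5) E_irrefl by auto
    obtain y' where y': "nb x = {w, y, y'}" using nb_obtain1[OF xw y(1)] neq by metis
    have "\<exists>h. eqv f h \<and> h w = \<epsilon>"
    proof (rule recolor_one_of_three[OF f _ _ same(2) yx same(5,7) e(1) fx[symmetric] refl V refl fa])
      fix s u v assume D0: "?D \<noteq> {}" and s: "s \<in> ?S" and u: "u \<in> ?D" and v: "v \<in> ?D" and e: "E s u" "E s v"
      have DS: "?D \<subseteq> V" "?D \<inter> ?S = {}" using stuck_subset[of ?S ?g] by blast+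
      have c3: "card ?S = 3" using same tw neq by auto
      \<comment> \<open>Of the neighbors of \<open>x\<close> only \<open>y'\<close> can be stuck, so
        \<open>x\<close> spends its last edge there. The remaining vertices then hang on
        \<open>y\<close>, \<open>t\<close>, \<open>w\<close>, which leaves at most one edge of
        \<open>t\<close> and of \<open>w\<close> for the stuck part.\<close>
      have "\<exists>b\<in>?D. E x b"
        by (rule attach[OF DS(1) D0 c3 V DS(2)]) (rule stuck_nb_subset, assumption, simp)
      then have y'D: "y' \<in> ?D" using y' yD DS(2) by (metis disjoint_iff in_nb insert_iff singletonD)
      define A where "A = V - ?S - ?D - {y}"
      have t'D: "t' \<notin> ?D" using stuck_nb[of t' ?S ?g y] same(6) E_sym yD yS by blast
      have t'A: "t' \<in> A" using same tw t'D tV E_irrefl unfolding A_def by auto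
      have nbA: "nb p \<subseteq> A \<union> {y, t, w}" if "p \<in> A" for p
      proof
        fix q assume q: "q \<in> nb p"
        then have "q \<notin> ?D" using stuck_nb[of q ?S ?g p] that E_sym unfolding A_def by auto
        moreover have "q \<noteq> x"
        proof
          assume "q = x"
          then have "p \<in> nb x" using q E_sym by auto
          then show False using that y' y'D unfolding A_def by auto
        qed
        ultimately show "q \<in> A \<union> {y, t, w}" using q nb_V[of p] unfolding A_def by blast
      qed
      have att: "\<exists>u\<in>A. E s u" if "s \<in> {y, t, w}" for s
        by (rule attach[of A "{y, t, w}"])
          (use t'A nbA V yV yS tw that same in \<open>auto simp: A_def\<close>)
      show "u = v"
      proof (cases "s = x")
        case True
        have "u \<notin> {w, y}" "v \<notin> {w, y}" using u v yD DS by auto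
        then show ?thesis using nb_two_determined[OF y'] e True by metis
      next
        case False
        then have s': "s \<in> {y, t, w}" using s by auto
        obtain b where b: "b \<in> A" "E s b" using att[OF s'] by blast
        define p where "p = (if s = w then x else y)"
        have p: "E s p" "p \<notin> ?D" "p \<notin> A"
          using False s xw same(5) E_sym yD DS unfolding p_def A_def by auto
        have "p \<noteq> b" using b p by auto
        then obtain c where "nb s = {p, b, c}" using nb_obtain1[OF p(1) b(2)] by metis
        moreover have "u \<notin> {p, b}" "v \<notin> {p, b}" using b u v p by (auto simp: A_def)
        ultimately show "u = v" using e nb_two_determined by metis
      qed
    qed (use neq tw in auto)
    then show False using fe by blast
  qed
qed

theorem nonconstant_lists:
  assumes "x \<in> V" "w \<in> V" "L x \<noteq> L w"
  shows "\<exists>f. col f" and "col f \<Longrightarrow> col g \<Longrightarrow> eqv f g"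
proof -
  obtain u v where uv: "E u v" "L u \<noteq> L v"
    using boundary_edge[of "{}" x w "L x"] assms by (metis card.empty Diff_empty finite.emptyI zero_le)
  have V: "u \<in> V" "v \<in> V" using uv E_V E_V2 by blast+
  obtain c where c: "c \<in> L u" "c \<notin> L v" using L_diff[OF V uv(2)] .
  obtain d where d: "d \<in> L v" "d \<notin> L u" using L_diff[OF V(2,1)] uv by metis
  show "\<exists>f. col f" using exposed_exists[of u c] exposedI[OF uv(1) c] by blast
  assume f: "col f" and g: "col g"
  obtain f' p p' where f': "eqv f f'" "col f'" "E p p'" "f' p \<notin> L p'"
    using reach_exposed[OF uv(1) c d f] by blast
  obtain g' q q' where g': "eqv g g'" "col g'" "E q q'" "g' q \<notin> L q'"
    using reach_exposed[OF uv(1) c d g] by blast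
  have "f' p \<in> L p" "g' q \<in> L q" using f' g' E_V by (auto simp: coloring_def)
  then have "linked p (f' p) q (g' q)" using exposed_linked f'(3,4) g'(3,4) by blast
  then have "eqv f' g'" using f'(2) g'(2) unfolding linked_def by blast
  then show "eqv f g" using f'(1) equiv_on_sym[OF g'(1)] by (meson rtranclp_trans)
qed

end

section \<open>Constant lists\<close>

locale constant_lists = cubic_graph E V L
  for E :: "'a \<Rightarrow> 'a \<Rightarrow> bool" and V :: "'a set" and L :: "'a \<Rightarrow> 'c set" +
  fixes K :: "'c set"
  assumes L_const: "v \<in> V \<Longrightarrow> L v = K" and V_nonempty: "V \<noteq> {}"
begin

lemma card_K: "card K = 3"
  using V_nonempty L_const card_L by fastforce

lemma finite_K: "finite K"
  using card_K by (metis card.infinite zero_neq_numeral)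

lemma col_K: "col f \<Longrightarrow> v \<in> V \<Longrightarrow> f v \<in> K"
  using L_const unfolding coloring_def by blast

lemma col_ne: "col f \<Longrightarrow> E u v \<Longrightarrow> f u \<noteq> f v"
  using E_V E_V2 unfolding coloring_def by blast

lemma three_values:
  assumes "{p, q, r, s} \<subseteq> K" "p \<notin> {q, r, s}"
  shows "q = r \<or> q = s \<or> r = s"
proof (rule ccontr)
  assume "\<not> ?thesis"
  then have "card {p, q, r, s} = 4" using assms(2) by auto
  then show False using card_mono[OF finite_K assms(1)] card_K by simp
qed

text \<open>All chains of two colors are swapped at once, which is a single step for unions of
  chains and respects the lists because they are constant.\<close>

lemma color_permutation:
  assumes f: "col f" and ab: "\<alpha> \<in> K" "\<beta> \<in> K"
  shows "eqv f (\<lambda>v. transpose \<alpha> \<beta> (f v))" "col (\<lambda>v. transpose \<alpha> \<beta> (f v))"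
proof -
  let ?C = "{v \<in> V. f v \<in> {\<alpha>, \<beta>}}"
  have st: "step V L f (\<lambda>v. transpose \<alpha> \<beta> (f v))"
  proof (rule swap_on_step)
    show "swap_on V \<alpha> \<beta> ?C f (\<lambda>v. transpose \<alpha> \<beta> (f v))"
      by (auto simp: swap_on_def)
    show "transpose \<alpha> \<beta> (f z) \<in> L z" if "z \<in> ?C" for z
      using that ab L_const by auto
  qed fact
  show "eqv f (\<lambda>v. transpose \<alpha> \<beta> (f v))" "col (\<lambda>v. transpose \<alpha> \<beta> (f v))"
    using r_into_rtranclp[of "step V L", OF st] st by (simp_all add: step_def)
qed

lemma pair_class_any:
  assumes y: "E y s" "E y t" "s \<noteq> t" and f: "col f" "f s = f t" and g: "col g" "g s = g t"
  shows "eqv f g"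
proof -
  let ?h = "\<lambda>v. transpose (g s) (f s) (g v)"
  have "s \<in> V" using y E_V2 by blast
  then have "eqv g ?h" "col ?h" using color_permutation g f col_K by blast+
  moreover have "eqv f ?h"
    by (rule pair_class[OF y f(1) \<open>col ?h\<close>]) (use f g in auto)
  ultimately show ?thesis using equiv_on_sym by (meson rtranclp_trans)
qed

section \<open>Links between pairs with equal colors\<close>

definition pairs_linked :: "'a \<Rightarrow> 'a \<Rightarrow> 'a \<Rightarrow> 'a \<Rightarrow> bool" where
  "pairs_linked s t p q \<longleftrightarrow>
    (\<forall>f g. col f \<longrightarrow> col g \<longrightarrow> f s = f t \<longrightarrow> g p = g q \<longrightarrow> eqv f g)"

lemma pairs_linkedI:
  assumes "E y s" "E y t" "s \<noteq> t" "E z p" "E z q" "p \<noteq> q"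
    and "col f" "f s = f t" "col g" "g p = g q" "eqv f g"
  shows "pairs_linked s t p q"
  unfolding pairs_linked_def
proof (intro allI impI)
  fix f' g' assume "col f'" "col g'" "f' s = f' t" "g' p = g' q"
  then have "eqv f' f" "eqv g g'" using assms pair_class_any by blast+
  then show "eqv f' g'" using assms(11) by (meson rtranclp_trans)
qed

lemma pairs_linked_sym: "pairs_linked s t p q \<Longrightarrow> pairs_linked p q s t"
  using equiv_on_sym unfolding pairs_linked_def by blast

lemma pair_exists:
  assumes "E y s" "E y t" "s \<noteq> t" "\<not> E s t"
  shows "\<exists>f. col f \<and> f s = f t"
proof -
  obtain \<alpha> where a: "\<alpha> \<in> K" using card_K by fastforce
  have V: "s \<in> V" "t \<in> V" "y \<in> V" using assms E_V E_V2 by blast+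
  have "\<exists>g. col g \<and> (\<forall>v\<in>{s, t}. g v = (\<lambda>_. \<alpha>) v)"
  proof (rule extension_exists)
    show "coloring {s, t} L (\<lambda>_. \<alpha>)"
      using a V L_const assms(4) E_sym[of t s] E_irrefl unfolding coloring_def by blast
    show "\<exists>u\<in>A. slack L {s, t} (\<lambda>_. \<alpha>) u" if "nb_closed (V - {s, t}) A" "A \<noteq> {}" for A
    proof -
      have "card {s, t} \<le> 2" by (simp add: card_insert_if)
      then have "A = V - {s, t}" using nb_closed_all[OF that] by simp
      then have "y \<in> A" using assms V E_irrefl by blast
      then show ?thesis using assms unfolding slack_def by blast
    qed
  qed (use V in auto)
  then show ?thesis by auto
qed

text \<open>The middle pair is required to be nonadjacent so that some coloring makes it
  equal.\<close>

lemma pairs_linked_trans: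
  assumes "pairs_linked s t p q" "pairs_linked p q u v" "E y p" "E y q" "p \<noteq> q" "\<not> E p q"
  shows "pairs_linked s t u v"
proof -
  obtain h where "col h" "h p = h q" using pair_exists[OF assms(3-6)] by blast
  then have "eqv f h" "eqv h g" if "col f" "col g" "f s = f t" "g u = g v" for f g
    using assms(1,2) that unfolding pairs_linked_def by blast+
  then show ?thesis unfolding pairs_linked_def by (blast intro: rtranclp_trans)
qed

lemma nb_two_equal:
  assumes nb: "nb v = {a, b, c}" and f: "col f"
  shows "f a = f b \<or> f a = f c \<or> f b = f c"
proof (rule three_values[of "f v"])
  have "a \<in> nb v" "b \<in> nb v" "c \<in> nb v" using nb by blast+
  then have e: "E v a" "E v b" "E v c" by simp_all
  then show "{f v, f a, f b, f c} \<subseteq> K" using col_K[OF f] E_V E_V2 by blast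
  show "f v \<notin> {f a, f b, f c}" using col_ne[OF f] e by blast
qed

text \<open>Three neighbors of \<open>v\<close> share two colors, so every coloring lies in one of
  three pair classes. The class of \<open>a\<close> and \<open>b\<close> is nonempty and is linked
  to the other two.\<close>

lemma all_equiv:
  assumes nb: "nb v = {a, b, c}" "a \<noteq> b" "a \<noteq> c" "b \<noteq> c" and ne: "\<not> E a b"
    and l: "pairs_linked a b a c" "pairs_linked a b b c"
    and f: "col f" and g: "col g"
  shows "eqv f g"
proof -
  have "a \<in> nb v" "b \<in> nb v" using nb by blast+
  then have e: "E v a" "E v b" by simp_all
  obtain h where h: "col h" "h a = h b" using pair_exists[OF e nb(2) ne] by blast
  have "eqv h k" if k: "col k" for k
    using nb_two_equal[OF nb(1) k] l h k pair_class_any[OF e nb(2) h k]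
    unfolding pairs_linked_def by blast
  then show ?thesis using f g equiv_on_sym by (meson rtranclp_trans)
qed

lemma all_equiv_triangle:
  assumes nb: "nb v = {a, b, c}" "a \<noteq> b" "a \<noteq> c" and ab: "E b c"
    and l: "pairs_linked a b a c" and f: "col f" and g: "col g"
  shows "eqv f g"
proof -
  have "a \<in> nb v" "b \<in> nb v" "c \<in> nb v" using nb by blast+
  then have e: "E v a" "E v b" "E v c" by simp_all
  have cov: "h a = h b \<or> h a = h c" if "col h" for h
    using nb_two_equal[OF nb(1) that] col_ne[OF that ab] by blast
  show ?thesis
    using cov[OF f] cov[OF g] pair_class_any[OF e(1,2) nb(2) f _ g]
      pair_class_any[OF e(1,3) nb(3) f _ g] l f g pairs_linked_sym[OF l]
    unfolding pairs_linked_def by blast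
qed

text \<open>As \<open>s\<close> has no stuck neighbor, the stuck part hangs on three legs only, and
  its coloring fits with the color of \<open>s\<close>.\<close>

lemma four_leg_extension:
  assumes S: "S = {s, s0, s1, s2}" "S \<subseteq> V" and ne: "s0 \<noteq> s1" "s0 \<noteq> s2" "s1 \<noteq> s2"
    and g: "coloring S L g" "g s1 = g s2" "g s0 \<noteq> g s1"
    and inner: "\<And>u. E s u \<Longrightarrow> u \<notin> stuck S g"
    and legs: "\<And>t u w. stuck S g \<noteq> {} \<Longrightarrow> t \<in> {s0, s1, s2} \<Longrightarrow> u \<in> stuck S g \<Longrightarrow> w \<in> stuck S g \<Longrightarrow>
      E t u \<Longrightarrow> E t w \<Longrightarrow> u = w"
  shows "\<exists>h. col h \<and> (\<forall>s\<in>S. h s = g s)"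
proof (rule extension_split[OF S(2) g(1)])
  let ?D = "stuck S g" and ?T = "{s0, s1, s2}"
  assume D0: "?D \<noteq> {}"
  have D: "?D \<subseteq> V" "?D \<inter> S = {}" using stuck_subset[of S g] by blast+
  have nbD: "nb u \<subseteq> ?D \<union> ?T" if "u \<in> ?D" for u
  proof
    fix v assume v: "v \<in> nb u"
    have "v \<noteq> s" using inner[of u] v that E_sym[of u v] by auto
    then show "v \<in> ?D \<union> ?T" using v stuck_nb[OF that] S(1) by (metis UnE UnI1 UnI2 in_nb insertE)
  qed
  have "\<exists>h. coloring (?T \<union> ?D) L h \<and> (\<forall>s\<in>?T. h s = g s)"
  proof (rule leg_extension_unique_color[OF refl ne])
    show "coloring ?T L g" by (rule coloring_mono[OF g(1)]) (use S in auto)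
    show "?T \<subseteq> V" "?D \<inter> ?T = {}" using S D by auto
    show "g s0 \<in> L u" if "d \<in> ?D" "E s0 d" "u \<in> ?D" "E d u" for d u
    proof -
      have "s0 \<in> V" "u \<in> V" using that D E_V by blast+
      then show ?thesis using g(1) S L_const[of s0] L_const[of u] unfolding coloring_def by auto
    qed
    show "u = w" if "t \<in> ?T" "u \<in> ?D" "w \<in> ?D" "E t u" "E t w" for t u w
      using legs[OF D0 that] .
  qed (use g D D0 nbD in auto)
  then obtain h where h: "coloring (?T \<union> ?D) L h" "\<forall>s\<in>?T. h s = g s" by blast
  define k where "k u = (if u \<in> S then g u else h u)" for u
  have k: "k u = h u" if "u \<in> ?T \<union> ?D" for u
    using that h(2) D by (auto simp: k_def)
  have "coloring (S \<union> ?D) L k"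
    unfolding coloring_def
  proof (intro conjI ballI impI)
    fix u assume "u \<in> S \<union> ?D"
    then show "k u \<in> L u" using g(1) h(1) by (auto simp: k_def coloring_def)
  next
    fix u v assume u: "u \<in> S \<union> ?D" and v: "v \<in> S \<union> ?D" and e: "E u v"
    consider "u \<in> S" "v \<in> S" | "u \<in> ?T \<union> ?D" "v \<in> ?T \<union> ?D" | "u = s" "v \<in> ?D" | "u \<in> ?D" "v = s"
      using u v S(1) by blast
    then show "k u \<noteq> k v"
    proof cases
      case 1
      then show ?thesis using g(1) e by (auto simp: k_def coloring_def)
    next
      case 2
      have "h u \<noteq> h v" using h(1) 2 e unfolding coloring_def by blast
      then show ?thesis using k[OF 2(1)] k[OF 2(2)] by simp
    qed (use inner e E_sym[OF e] in blast)+
  qed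
  then show "\<exists>h. coloring (S \<union> ?D) L h \<and> (\<forall>s\<in>S. h s = g s)"
    by (intro exI[of _ k]) (auto simp: k_def)
qed

lemma two_colors:
  obtains \<alpha> \<beta> where "\<alpha> \<in> K" "\<beta> \<in> K" "\<alpha> \<noteq> \<beta>"
  using card_K by (metis card_3_iff insertCI)

section \<open>Graphs with a triangle\<close>

definition triangle :: "'a \<Rightarrow> 'a \<Rightarrow> 'a \<Rightarrow> 'a \<Rightarrow> 'a \<Rightarrow> 'a \<Rightarrow> bool" where
  "triangle v1 v2 v3 w1 w2 w3 \<longleftrightarrow>
    nb v1 = {v2, v3, w1} \<and> nb v2 = {v1, v3, w2} \<and> nb v3 = {v1, v2, w3} \<and>
    distinct [v1, v2, v3, w1, w2, w3]"

lemma triangle_rotate: "triangle v1 v2 v3 w1 w2 w3 \<Longrightarrow> triangle v2 v3 v1 w2 w3 w1"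
  unfolding triangle_def by (auto simp: insert_commute)

lemma triangle_flip: "triangle v1 v2 v3 w1 w2 w3 \<Longrightarrow> triangle v1 v3 v2 w1 w3 w2"
  unfolding triangle_def by (auto simp: insert_commute)

lemma triangle_adj:
  assumes "triangle v1 v2 v3 w1 w2 w3"
  shows "E v1 u \<longleftrightarrow> u \<in> {v2, v3, w1}" "E v2 u \<longleftrightarrow> u \<in> {v1, v3, w2}" "E v3 u \<longleftrightarrow> u \<in> {v1, v2, w3}"
    "E u v1 \<longleftrightarrow> u \<in> {v2, v3, w1}" "E u v2 \<longleftrightarrow> u \<in> {v1, v3, w2}" "E u v3 \<longleftrightarrow> u \<in> {v1, v2, w3}"
  using assms unfolding triangle_def by (metis in_nb E_sym)+

lemma triangle_exists:
  assumes "E v1 v2" "E v1 v3" "E v2 v3"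
  obtains w1 w2 w3 where "triangle v1 v2 v3 w1 w2 w3"
proof -
  have ne: "v1 \<noteq> v2" "v1 \<noteq> v3" "v2 \<noteq> v3" using assms E_irrefl by auto
  note sy = E_sym[OF assms(1)] E_sym[OF assms(2)] E_sym[OF assms(3)]
  obtain w1 where w1: "nb v1 = {v2, v3, w1}" "v2 \<noteq> w1" "v3 \<noteq> w1" "E v1 w1"
    using nb_obtain1[OF assms(1,2) ne(3)] .
  obtain w2 where w2: "nb v2 = {v1, v3, w2}" "v1 \<noteq> w2" "v3 \<noteq> w2" "E v2 w2"
    using nb_obtain1[OF sy(1) assms(3) ne(2)] .
  obtain w3 where w3: "nb v3 = {v1, v2, w3}" "v1 \<noteq> w3" "v2 \<noteq> w3" "E v3 w3"
    using nb_obtain1[OF sy(2,3) ne(1)] .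
  have "w1 \<noteq> w2" using no_diamond[of v1 v2 v3 w1] assms w1 w2 by blast
  moreover have "w1 \<noteq> w3" using no_diamond[of v1 v3 v2 w1] assms sy w1 w3 by blast
  moreover have "w2 \<noteq> w3" using no_diamond[of v2 v3 v1 w2] assms sy w2 w3 by blast
  moreover have "w1 \<noteq> v1" "w2 \<noteq> v2" "w3 \<noteq> v3" using w1 w2 w3 E_irrefl by auto
  ultimately have "triangle v1 v2 v3 w1 w2 w3"
    using w1 w2 w3 ne unfolding triangle_def by auto
  then show ?thesis by (rule that)
qed

text \<open>If two outer neighbors have the same color, then the other two triangle vertices may be swapped.\<close>

lemma triangle_swap:
  assumes t: "triangle v1 v2 v3 w1 w2 w3" and f: "col f" and eq: "f w2 = f w3"
  shows "pairs_linked w1 v2 w1 v3"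
proof -
  note adj = triangle_adj[OF t]
  have d: "distinct [v1, v2, v3, w1, w2, w3]" using t by (simp add: triangle_def)
  have V: "v1 \<in> V" "v2 \<in> V" "v3 \<in> V" "w1 \<in> V" "w2 \<in> V" "w3 \<in> V"
    using E_V[of v1] E_V[of v2] E_V[of v3] E_V2[of v1] E_V2[of v2] E_V2[of v3] adj by auto
  have fne: "f v1 \<noteq> f v2" "f v1 \<noteq> f v3" "f v2 \<noteq> f v3" "f w1 \<noteq> f v1" "f w2 \<noteq> f v2" "f w3 \<noteq> f v3"
    using col_ne[OF f] adj by auto
  \<comment> \<open>The common color of \<open>w2\<close> and \<open>w3\<close> is avoided by
    \<open>v2\<close> and \<open>v3\<close>, hence is that of \<open>v1\<close>. So
    \<open>v2\<close> and \<open>v3\<close> form a chain by themselves.\<close>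
  have "f v1 = f w2"
    using three_values[of "f v2" "f v3" "f v1" "f w2"] fne eq col_K[OF f] V
      three_values[of "f v3" "f v2" "f v1" "f w2"] by auto
  have w1: "f w1 = f v2 \<or> f w1 = f v3"
    using nb_two_equal[of v1 v2 v3 w1 f] t f fne unfolding triangle_def by metis
  let ?g = "f(v2 := f v3, v3 := f v2)"
  have "swap_on V (f v2) (f v3) {v2, v3} f ?g"
    unfolding swap_on_def
  proof (intro conjI ballI impI)
    fix z y assume z: "z \<in> {v2, v3}" and y: "y \<in> V - {v2, v3}" and e: "E z y"
    then have "y = v1 \<or> y = w2 \<or> y = w3" using adj by auto
    then show "f y \<notin> {f v2, f v3}" using fne eq \<open>f v1 = f w2\<close> by auto
  qed (use V d in auto)
  then have st: "step V L f ?g"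
    by (rule swap_on_step) (use f V L_const col_K[OF f] in auto)
  have eg: "eqv f ?g" "col ?g" using r_into_rtranclp[of "step V L", OF st] st by (simp_all add: step_def)
  have e: "E v1 w1" "E v1 v2" "E v1 v3" using adj by auto
  have n: "w1 \<noteq> v2" "w1 \<noteq> v3" using d by auto
  show ?thesis
  proof (cases "f w1 = f v2")
    case True
    then show ?thesis
      by (intro pairs_linkedI[OF e(1,2) n(1) e(1,3) n(2) f _ eg(2) _ eg(1)]) (use d in auto)
  next
    case False
    then have "f w1 = f v3" using w1 by blast
    then have "pairs_linked w1 v3 w1 v2"
      by (intro pairs_linkedI[OF e(1,3) n(2) e(1,2) n(1) f _ eg(2) _ eg(1)]) (use d in auto)
    then show ?thesis by (rule pairs_linked_sym)
  qed
qed

text \<open>The two prescribed equalities give slack to \<open>w1\<close> and \<open>v3\<close>, so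
  \<open>v1\<close> has no stuck neighbor. A stuck part must use the edge from \<open>v2\<close> to
  \<open>w2\<close>; then the other vertices hang on \<open>p\<close>, \<open>w1\<close>,
  \<open>w3\<close>, which leaves \<open>p\<close> and \<open>w3\<close> one edge each for the stuck
  part.\<close>

lemma triangle_extension:
  assumes t: "triangle v1 v2 v3 w1 w2 w3" and nw: "\<not> E w1 w2" "\<not> E w1 w3"
    and p: "E w1 p" "p \<noteq> v1"
  shows "\<exists>h. col h \<and> h v1 = h p \<and> h v2 = h w3"
proof -
  note adj = triangle_adj[OF t]
  have d: "distinct [v1, v2, v3, w1, w2, w3]" using t by (simp add: triangle_def)
  have nb: "nb v1 = {v2, v3, w1}" "nb v2 = {v1, v3, w2}" "nb v3 = {v1, v2, w3}"
    using t by (auto simp: triangle_def)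
  have V: "v1 \<in> V" "v2 \<in> V" "v3 \<in> V" "w1 \<in> V" "w2 \<in> V" "w3 \<in> V"
    using E_V[of v1] E_V[of v2] E_V[of v3] E_V2[of v1] E_V2[of v2] E_V2[of v3] adj by auto
  have out: "u \<notin> {v2, v3, w1, w2, w3}" if "E w1 u" for u
    using that nw E_irrefl adj d by auto
  have pV: "p \<in> V" using p E_V2 by blast
  have w1v1: "E w1 v1" using adj by auto
  obtain q where q: "nb w1 = {v1, p, q}" "v1 \<noteq> q" "p \<noteq> q" "E w1 q"
    using nb_obtain1[OF w1v1 p(1)] p(2) by blast
  obtain \<alpha> \<beta> where ab: "\<alpha> \<in> K" "\<beta> \<in> K" "\<alpha> \<noteq> \<beta>" using two_colors .
  define g where "g u = (if u \<in> {v1, p} then \<alpha> else \<beta>)" for u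
  let ?S = "{v1, p, v2, w3}"
  let ?D = "stuck ?S g"
  have po: "p \<notin> {v1, v2, v3, w1, w2, w3}" using out[OF p(1)] p(2) by auto
  have qo: "q \<notin> {v1, v2, v3, w1, w2, w3, p}" using out[OF q(4)] q by auto
  have SV: "?S \<subseteq> V" using V pV by auto
  have gv: "g v1 = \<alpha>" "g p = \<alpha>" "g v2 = \<beta>" "g w3 = \<beta>" using d po by (auto simp: g_def)
  have ne1: "\<not> E v1 p" "\<not> E p v1" "\<not> E v2 w3" "\<not> E w3 v2" using adj d po by auto
  have cS: "coloring ?S L g"
    using gv ne1 ab L_const SV E_irrefl unfolding coloring_def by auto
  have "slack L ?S g w1"
    using w1v1 p gv unfolding slack_def by (intro disjI2 bexI[of _ v1] bexI[of _ p]) auto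
  then have w1D: "w1 \<notin> ?D" by (rule stuck_not_slack)
  have "slack L ?S g v3"
    using adj gv d unfolding slack_def by (intro disjI2 bexI[of _ v2] bexI[of _ w3]) auto
  then have v3D: "v3 \<notin> ?D" by (rule stuck_not_slack)
  have DS: "?D \<subseteq> V" "?D \<inter> ?S = {}" using stuck_subset[of ?S g] by blast+
  have inner: "u \<notin> ?D" if "E v1 u" for u
    using that adj(1) w1D v3D DS by auto
  have "\<exists>h. col h \<and> (\<forall>s\<in>?S. h s = g s)"
  proof (rule four_leg_extension[OF refl SV _ _ _ cS])
    fix s u w assume D0: "?D \<noteq> {}" and s: "s \<in> {p, v2, w3}" and u: "u \<in> ?D" and w: "w \<in> ?D"
      and e: "E s u" "E s w"
    have nbD: "nb x \<subseteq> ?D \<union> {p, v2, w3}" if "x \<in> ?D" for x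
    proof
      fix y assume y: "y \<in> nb x"
      have "y \<noteq> v1" using inner[of x] y that E_sym[of x y] by auto
      then show "y \<in> ?D \<union> {p, v2, w3}" using stuck_nb[OF that] y by auto
    qed
    have "\<exists>x\<in>?D. E v2 x"
      by (rule attach[OF DS(1) D0 _ _ _ nbD]) (use d po SV DS in auto)
    then have w2D: "w2 \<in> ?D" using adj(2) v3D DS by auto
    define A where "A = V - ?S - ?D - {w1, v3}"
    have qD: "q \<notin> ?D"
    proof
      assume "q \<in> ?D"
      then have "w1 \<in> ?D \<union> ?S" using E_sym[OF q(4)] by (rule stuck_nb)
      then show False using w1D d po by auto
    qed
    have qA: "q \<in> A" using q qo qD E_V2 unfolding A_def by blast
    have nbA: "nb x \<subseteq> A \<union> {p, w1, w3}" if x: "x \<in> A" for x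
    proof
      fix y assume y: "y \<in> nb x"
      have "y \<notin> ?D" using stuck_nb[of y ?S g x] x y E_sym unfolding A_def by auto
      moreover have "y \<noteq> v1" "y \<noteq> v2" "y \<noteq> v3"
        using x y adj(4-6)[of x] w2D unfolding A_def by auto
      ultimately show "y \<in> A \<union> {p, w1, w3}" using y nb_V[of x] unfolding A_def by blast
    qed
    have att: "\<exists>x\<in>A. E y x" if "y \<in> {p, w1, w3}" for y
      by (rule attach[of A "{p, w1, w3}"]) (use qA nbA SV V d po that in \<open>auto simp: A_def\<close>)
    show "u = w"
    proof (cases "s = v2")
      case True
      have "u \<notin> {v1, v3}" "w \<notin> {v1, v3}" using u w v3D DS by auto
      then show ?thesis using nb_two_determined[OF nb(2)] e True by metis
    next
      case False
      define r where "r = (if s = p then w1 else v3)"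
      have r: "E s r" "r \<notin> ?D" "r \<notin> A"
        using s False adj E_sym[OF p(1)] w1D v3D unfolding r_def A_def by auto
      obtain b where b: "b \<in> A" "E s b" using att[of s] s False by blast
      have "r \<noteq> b" using b r by auto
      then obtain c where "nb s = {r, b, c}" using nb_obtain1[OF r(1) b(2)] by metis
      moreover have "u \<notin> {r, b}" "w \<notin> {r, b}" using b u w r by (auto simp: A_def)
      ultimately show ?thesis using e nb_two_determined by metis
    qed
  qed (use gv ab d po inner in auto)
  then show ?thesis using gv by auto
qed

text \<open>If some coloring repeats a color on \<open>w1\<close>, \<open>w2\<close>,
  \<open>w3\<close>, a swap inside the triangle links two pairs. Otherwise these three always have
  distinct colors, so \<open>w1\<close> agrees with \<open>v3\<close> once \<open>v2\<close> agrees
  with \<open>w3\<close>, and with \<open>v2\<close> once \<open>v3\<close> agrees with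
  \<open>w2\<close>. Both patterns occur together with equal colors on \<open>v1\<close> and
  \<open>p\<close>, and that pair class links them.\<close>

lemma triangle_isolated_outer:
  assumes t: "triangle v1 v2 v3 w1 w2 w3" and nw: "\<not> E w1 w2" "\<not> E w1 w3"
    and f: "col f" and g: "col g"
  shows "eqv f g"
proof -
  note adj = triangle_adj[OF t]
  have d: "distinct [v1, v2, v3, w1, w2, w3]" using t by (simp add: triangle_def)
  have t2: "triangle v2 v3 v1 w2 w3 w1" and t3: "triangle v3 v1 v2 w3 w1 w2"
    using triangle_rotate t by blast+
  have fin: "eqv f g" if "pairs_linked a b a c" "triangle v b c a x y" for a b c v x y
  proof (rule all_equiv_triangle[of v a b c])
    show "nb v = {a, b, c}" "a \<noteq> b" "a \<noteq> c"
      using that(2) unfolding triangle_def by auto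
    show "E b c" using triangle_adj(2)[OF that(2)] by auto
  qed fact+
  show ?thesis
  proof (cases "\<exists>h. col h \<and> (h w1 = h w2 \<or> h w1 = h w3 \<or> h w2 = h w3)")
    case True
    then obtain h where h: "col h" "h w1 = h w2 \<or> h w1 = h w3 \<or> h w2 = h w3" by blast
    then consider "h w1 = h w2" | "h w3 = h w1" | "h w2 = h w3" by metis
    then show ?thesis
    proof cases
      case 1
      then show ?thesis using fin[OF triangle_swap[OF t3 h(1)]] t3 by blast
    next
      case 2
      then show ?thesis using fin[OF triangle_swap[OF t2 h(1)]] t2 by blast
    next
      case 3
      then show ?thesis using fin[OF triangle_swap[OF t h(1)]] t by blast
    qed
  next
    case False
    then have rb: "h w1 \<noteq> h w2" "h w1 \<noteq> h w3" "h w2 \<noteq> h w3" if "col h" for h using that by blast+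
    have w1v1: "E w1 v1" using adj by auto
    obtain p q where p: "E w1 p" "p \<noteq> v1" using nb_obtain2[OF w1v1] by metis
    obtain h1 where h1: "col h1" "h1 v1 = h1 p" "h1 v2 = h1 w3"
      using triangle_extension[OF t nw p] by blast
    obtain h2 where h2: "col h2" "h2 v1 = h2 p" "h2 v3 = h2 w2"
      using triangle_extension[OF triangle_flip[OF t] nw(2,1) p] by blast
    have e: "E v1 w1" "E v1 v2" "E v1 v3" using adj by auto
    have cov: "h w1 = h v2 \<or> h w1 = h v3" if "col h" for h
      using nb_two_equal[of v1 v2 v3 w1 h] that t col_ne[OF that, of v2 v3] adj
      unfolding triangle_def by (metis insertCI)
    have "h1 w1 = h1 v3" using cov[OF h1(1)] rb[OF h1(1)] h1(3) by auto
    moreover have "h2 w1 = h2 v2" using cov[OF h2(1)] rb[OF h2(1)] h2(3) by auto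
    moreover have "eqv h2 h1"
      by (rule pair_class_any[OF w1v1 p(1)]) (use p h1 h2 in auto)
    ultimately have "pairs_linked w1 v2 w1 v3"
      using pairs_linkedI[OF e(1,2) _ e(1,3)] h1(1) h2(1) d by auto
    then show ?thesis using fin t by blast
  qed
qed

text \<open>The six vertices have at most the outside neighbors \<open>p\<close> and
  \<open>p'\<close>, so there are no further vertices. Three neighbors of \<open>p\<close> can then
  only be \<open>w1\<close>, \<open>w3\<close>, \<open>p'\<close>; but the only outside neighbor of
  \<open>w3\<close> is \<open>p'\<close>, which makes \<open>p\<close> its own neighbor.\<close>

lemma triangle_no_path:
  assumes t: "triangle v1 v2 v3 w1 w2 w3" and nw: "\<not> E w1 w3" and e: "E w1 w2" "E w2 w3"
  shows False
proof -
  note adj = triangle_adj[OF t]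
  have d: "distinct [v1, v2, v3, w1, w2, w3]" using t by (simp add: triangle_def)
  have nb: "nb v1 = {v2, v3, w1}" "nb v2 = {v1, v3, w2}" "nb v3 = {v1, v2, w3}"
    using t by (auto simp: triangle_def)
  have V: "v1 \<in> V" "v2 \<in> V" "v3 \<in> V" "w1 \<in> V" "w2 \<in> V" "w3 \<in> V"
    using E_V[of v1] E_V[of v2] E_V[of v3] E_V2[of v1] E_V2[of v2] E_V2[of v3] adj by auto
  have e1: "E w1 v1" "E w2 v2" "E w3 v3" "E w2 w1" "E w3 w2" using adj e E_sym by auto
  obtain p where p: "nb w1 = {v1, w2, p}" "v1 \<noteq> p" "w2 \<noteq> p" "E w1 p"
    using nb_obtain1[OF e1(1) e(1)] d by auto
  obtain p' where p': "nb w3 = {v3, w2, p'}" "v3 \<noteq> p'" "w2 \<noteq> p'" "E w3 p'"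
    using nb_obtain1[OF e1(3,5)] d by auto
  have nb2: "nb w2 = {v2, w1, w3}" by (rule nb_eq3) (use e e1 d in auto)
  have po: "p \<notin> {v1, v2, v3, w1, w2, w3}" using p adj nw d E_irrefl by auto
  have po': "p' \<notin> {v1, v2, v3, w1, w2, w3}" using p' adj nw d E_irrefl E_sym[of w3 w1] by auto
  let ?A = "{v1, v2, v3, w1, w2, w3}"
  have VA: "V \<subseteq> ?A \<union> {p, p'}"
  proof (rule three_connected)
    show "card {p, p'} \<le> 2" by (cases "p = p'") auto
    show "nb u \<subseteq> ?A \<union> {p, p'}" if "u \<in> ?A" for u
      using that unfolding insert_iff empty_iff
      by (elim disjE) (simp_all add: nb nb2 p(1) p'(1))
  qed (use V po po' in auto)
  have sub: "nb p \<subseteq> {w1, w3, p'}"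
  proof
    fix u assume u: "u \<in> nb p"
    then have up: "p \<in> nb u" using E_sym by simp
    have "u \<in> V" using u nb_V by blast
    then have "u \<in> ?A \<union> {p, p'}" using VA by blast
    moreover have "u \<noteq> p" using u E_irrefl by auto
    moreover have "u \<noteq> v1" "u \<noteq> v2" "u \<noteq> v3" "u \<noteq> w2" using up nb nb2 po by auto
    ultimately show "u \<in> {w1, w3, p'}" by blast
  qed
  have pV: "p \<in> V" using p E_V2 by blast
  have c: "card (nb p) = 3" using card_nb pV by blast
  then have eq: "nb p = {w1, w3, p'}"
    using sub by (intro card_seteq) (auto simp: card_insert_if)
  have "p \<noteq> p'" using eq E_irrefl[of p] by auto
  have "w3 \<in> nb p" using eq by blast
  then have "p \<in> nb w3" using E_sym by simp
  then show False using p' po \<open>p \<noteq> p'\<close> by auto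
qed

definition prism :: "'a \<Rightarrow> 'a \<Rightarrow> 'a \<Rightarrow> 'a \<Rightarrow> 'a \<Rightarrow> 'a \<Rightarrow> bool" where
  "prism v1 v2 v3 w1 w2 w3 \<longleftrightarrow> triangle v1 v2 v3 w1 w2 w3 \<and> triangle w1 w2 w3 v1 v2 v3 \<and>
    V = {v1, v2, v3, w1, w2, w3}"

lemma triangle_outer_prism:
  assumes t: "triangle v1 v2 v3 w1 w2 w3" and e: "E w1 w2" "E w1 w3" "E w2 w3"
  shows "prism v1 v2 v3 w1 w2 w3"
proof -
  note adj = triangle_adj[OF t]
  have d: "distinct [v1, v2, v3, w1, w2, w3]" using t by (simp add: triangle_def)
  have nb: "nb v1 = {v2, v3, w1}" "nb v2 = {v1, v3, w2}" "nb v3 = {v1, v2, w3}"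
    using t by (auto simp: triangle_def)
  have V: "{v1, v2, v3, w1, w2, w3} \<subseteq> V"
    using E_V[of v1] E_V[of v2] E_V[of v3] E_V2[of v1] E_V2[of v2] E_V2[of v3] adj by auto
  have e1: "E w1 v1" "E w2 v2" "E w3 v3" using adj by auto
  note sy = E_sym[OF e(1)] E_sym[OF e(2)] E_sym[OF e(3)]
  have nbw: "nb w1 = {w2, w3, v1}" "nb w2 = {w1, w3, v2}" "nb w3 = {w1, w2, v3}"
    using e e1 sy d by (intro nb_eq3; auto)+
  have "V \<subseteq> {v1, v2, v3, w1, w2, w3} \<union> {}"
  proof (rule three_connected)
    show "nb u \<subseteq> {v1, v2, v3, w1, w2, w3} \<union> {}" if "u \<in> {v1, v2, v3, w1, w2, w3}" for u
      using that unfolding insert_iff empty_iff by (elim disjE) (simp_all add: nb nbw)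
  qed (use V in auto)
  then show ?thesis
    using V t nbw d unfolding prism_def triangle_def by auto
qed

text \<open>The cases count the edges among the outer neighbors: at most one leaves some outer
  neighbor isolated from the others, two are impossible, and three form the excluded prism.\<close>

theorem triangle_equiv:
  assumes e: "E v1 v2" "E v1 v3" "E v2 v3"
    and np: "\<And>v1 v2 v3 w1 w2 w3. \<not> prism v1 v2 v3 w1 w2 w3"
    and f: "col f" and g: "col g"
  shows "eqv f g"
proof -
  obtain w1 w2 w3 where t: "triangle v1 v2 v3 w1 w2 w3" using triangle_exists[OF e] .
  have t2: "triangle v2 v3 v1 w2 w3 w1" and t3: "triangle v3 v1 v2 w3 w1 w2"
    using triangle_rotate t by blast+
  have sy: "E w2 w1 \<longleftrightarrow> E w1 w2" "E w3 w1 \<longleftrightarrow> E w1 w3" "E w3 w2 \<longleftrightarrow> E w2 w3" using E_sym by blast+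
  consider "\<not> E w1 w2" "\<not> E w1 w3" | "\<not> E w1 w2" "\<not> E w2 w3" | "\<not> E w1 w3" "\<not> E w2 w3"
    | "\<not> E w1 w2" "E w1 w3" "E w2 w3" | "E w1 w2" "\<not> E w1 w3" "E w2 w3"
    | "E w1 w2" "E w1 w3" "\<not> E w2 w3" | "E w1 w2" "E w1 w3" "E w2 w3"
    by blast
  then show ?thesis
  proof cases
    case 1
    then show ?thesis using triangle_isolated_outer[OF t] f g by blast
  next
    case 2
    then show ?thesis using triangle_isolated_outer[OF t2] f g sy by blast
  next
    case 3
    then show ?thesis using triangle_isolated_outer[OF t3] f g sy by blast
  next
    case 4
    then show ?thesis using triangle_no_path[OF t2] sy by blast
  next
    case 5
    then show ?thesis using triangle_no_path[OF t] sy by blast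
  next
    case 6
    then show ?thesis using triangle_no_path[OF t3] sy by blast
  next
    case 7
    then show ?thesis using triangle_outer_prism[OF t] np by blast
  qed
qed

end

section \<open>Constant lists on triangle-free graphs\<close>

context simple_graph
begin

section \<open>Edge counts and small edge cuts\<close>

definition edges_between :: "'a set \<Rightarrow> 'a set \<Rightarrow> ('a \<times> 'a) set" where
  "edges_between A B = {(u, v). u \<in> A \<and> v \<in> B \<and> E u v}"

lemma card_edges_between_sym: "card (edges_between A B) = card (edges_between B A)"
proof -
  have "edges_between B A = prod.swap ` edges_between A B"
    using E_sym by (auto simp: edges_between_def image_iff)
  then show ?thesis by (simp add: card_image)
qed

lemma finite_edges_between: "finite A \<Longrightarrow> finite B \<Longrightarrow> finite (edges_between A B)"
  by (rule finite_subset[of _ "A \<times> B"]) (auto simp: edges_between_def)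

lemma card_edges_between_Un:
  assumes "finite A" "finite B" "finite C" "B \<inter> C = {}"
  shows "card (edges_between A (B \<union> C)) = card (edges_between A B) + card (edges_between A C)"
proof -
  have "edges_between A (B \<union> C) = edges_between A B \<union> edges_between A C"
    by (auto simp: edges_between_def)
  moreover have "edges_between A B \<inter> edges_between A C = {}"
    using assms(4) by (auto simp: edges_between_def)
  ultimately show ?thesis
    using card_Un_disjoint[OF finite_edges_between finite_edges_between] assms(1-3) by metis
qed

lemma card_edges_between_Un_left:
  assumes "finite A" "finite B" "finite C" "B \<inter> C = {}"
  shows "card (edges_between (B \<union> C) A) = card (edges_between B A) + card (edges_between C A)"
  using card_edges_between_Un[OF assms] card_edges_between_sym by metis

end

context cubic_graph
begin

definition boundary :: "'a set \<Rightarrow> nat" where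
  "boundary A = card (edges_between A (V - A))"

text \<open>Counting edges between the four parts cut out by \<open>X\<close> and \<open>T\<close>,
  the right side exceeds the left by twice the number of edges between \<open>X \<inter> T\<close>
  and the complement of the union.\<close>

lemma boundary_posimodular:
  assumes "X \<subseteq> V" "T \<subseteq> V"
  shows "boundary (X - T) + boundary (T - X) \<le> boundary X + boundary T"
proof -
  define A B C D where ABCD: "A = X - T" "B = X \<inter> T" "C = T - X" "D = V - X - T"
  define e where "e P Q = card (edges_between P Q)" for P Q
  have fin: "finite A" "finite B" "finite C" "finite D"
    using assms finite_V finite_subset unfolding ABCD by (meson finite_Diff finite_Int)+
  have disj: "A \<inter> B = {}" "A \<inter> C = {}" "A \<inter> D = {}" "B \<inter> C = {}" "B \<inter> D = {}" "C \<inter> D = {}"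
    by (auto simp: ABCD)
  have sets: "X = A \<union> B" "T = B \<union> C" "V - X = C \<union> D" "V - T = A \<union> D"
    "V - (X - T) = B \<union> (C \<union> D)" "V - (T - X) = A \<union> (B \<union> D)" "X - T = A" "T - X = C"
    using assms by (auto simp: ABCD)
  have e1: "e P (Q \<union> R) = e P Q + e P R" if "finite P" "finite Q" "finite R" "Q \<inter> R = {}" for P Q R
    unfolding e_def by (rule card_edges_between_Un[OF that])
  have e2: "e (Q \<union> R) P = e Q P + e R P" if "finite P" "finite Q" "finite R" "Q \<inter> R = {}" for P Q R
    unfolding e_def by (rule card_edges_between_Un_left[OF that])
  have "boundary (X - T) = e A B + (e A C + e A D)"
  proof -
    have "boundary (X - T) = e A (B \<union> (C \<union> D))"
      unfolding boundary_def e_def using sets(5,7) by simp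
    also have "\<dots> = e A B + e A (C \<union> D)" by (rule e1) (use fin disj in auto)
    finally show ?thesis using e1 fin disj by simp
  qed
  moreover have "boundary (T - X) = e C A + (e C B + e C D)"
  proof -
    have "boundary (T - X) = e C (A \<union> (B \<union> D))"
      unfolding boundary_def e_def using sets(6,8) by simp
    also have "\<dots> = e C A + e C (B \<union> D)" by (rule e1) (use fin disj in auto)
    finally show ?thesis using e1 fin disj by simp
  qed
  moreover have "boundary X = (e A C + e A D) + (e B C + e B D)"
  proof -
    have "boundary X = e (A \<union> B) (C \<union> D)"
      unfolding boundary_def e_def using sets(1,3) by simp
    also have "\<dots> = e A (C \<union> D) + e B (C \<union> D)" by (rule e2) (use fin disj in auto)
    also have "\<dots> = (e A C + e A D) + (e B C + e B D)" using e1 fin disj by simp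
    finally show ?thesis .
  qed
  moreover have "boundary T = (e B A + e B D) + (e C A + e C D)"
  proof -
    have "boundary T = e (B \<union> C) (A \<union> D)"
      unfolding boundary_def e_def using sets(2,4) by simp
    also have "\<dots> = e B (A \<union> D) + e C (A \<union> D)" by (rule e2) (use fin disj in auto)
    also have "\<dots> = (e B A + e B D) + (e C A + e C D)" using e1 fin disj by simp
    finally show ?thesis .
  qed
  moreover have "e A B = e B A" "e C B = e B C"
    unfolding e_def using card_edges_between_sym by blast+
  ultimately show ?thesis by linarith
qed

text \<open>The outer ends of at most two edges would form a vertex cut covering all of
  \<open>V - A\<close>.\<close>

lemma boundary_ge_3:
  assumes A: "A \<subseteq> V" "A \<noteq> {}" and c: "card (V - A) \<ge> 3"
  shows "boundary A \<ge> 3"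
proof (rule ccontr)
  assume "\<not> ?thesis"
  then have b: "card (edges_between A (V - A)) \<le> 2" by (simp add: boundary_def)
  define S where "S = snd ` edges_between A (V - A)"
  have fin: "finite (edges_between A (V - A))"
    using A finite_V finite_subset by (intro finite_edges_between) auto
  have cS: "card S \<le> 2" using card_image_le[OF fin, of snd] b by (simp add: S_def)
  have fS: "finite S" using fin by (simp add: S_def)
  have "V \<subseteq> A \<union> S"
  proof (rule three_connected[OF A fS cS])
    show "A \<inter> S = {}" by (auto simp: S_def edges_between_def)
    show "nb u \<subseteq> A \<union> S" if u: "u \<in> A" for u
    proof
      fix w assume w: "w \<in> nb u"
      show "w \<in> A \<union> S"
      proof (cases "w \<in> A")
        case False
        then have "(u, w) \<in> edges_between A (V - A)"
          using u w nb_V[of u] by (auto simp: edges_between_def)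
        then show ?thesis unfolding S_def by force
      qed auto
    qed
  qed
  then have "V - A \<subseteq> S" by blast
  then have "card (V - A) \<le> card S" using fS card_mono by blast
  then show False using c cS by linarith
qed

lemma boundary_sum:
  assumes "A \<subseteq> V"
  shows "boundary A = (\<Sum>u\<in>A. card (nb u - A))"
proof -
  have "edges_between A (V - A) = (SIGMA u:A. nb u - A)"
    using E_V2 by (auto simp: edges_between_def)
  moreover have "finite A" using assms finite_V finite_subset by blast
  ultimately show ?thesis
    using finite_nb by (simp add: boundary_def card_SigmaI)
qed

end

context constant_lists
begin

text \<open>A vertex \<open>a\<^sub>1\<close> adjacent to both twins \<open>a\<close> and \<open>c\<close> can be given a monochromatic neighborhood.\<close>

lemma twins_equiv:
  assumes tf: "\<forall>x y z. E x y \<longrightarrow> E y z \<longrightarrow> \<not> E x z"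
    and ac: "a \<noteq> c" "nb a = nb c" "E a a1" and f: "col f" and g: "col g"
  shows "eqv f g"
proof -
  have e: "E a1 a" "E a1 c" using ac E_sym by (metis in_nb)+
  obtain p where p: "nb a1 = {a, c, p}" "a \<noteq> p" "c \<noteq> p" "E a1 p" using nb_obtain1[OF e ac(1)] .
  obtain \<alpha> where al: "\<alpha> \<in> K" using card_K by fastforce
  have n: "\<not> E a c" "\<not> E a p" "\<not> E c p" "\<not> E c a" "\<not> E p a" "\<not> E p c"
    using tf e p(4) E_sym by blast+
  let ?S = "{a, c, p}" and ?g = "\<lambda>_. \<alpha>"
  have V: "?S \<subseteq> V" using e p(4) E_V2 by blast
  have "\<exists>h. col h \<and> (\<forall>v\<in>?S. h v = ?g v)"
  proof (rule extension_exists[OF V])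
    show "coloring ?S L ?g"
      using n al V L_const E_irrefl unfolding coloring_def by auto
    fix A assume A: "nb_closed (V - ?S) A" "A \<noteq> {}"
    show "\<exists>u\<in>A. slack L ?S ?g u"
    proof (cases "A \<inter> nb a = {}")
      case False
      then obtain u where u: "u \<in> A" "E a u" by auto
      then have "E c u" using ac(2) by (metis in_nb)
      then have "E u a" "E u c" using u E_sym by blast+
      then have "slack L ?S ?g u" unfolding slack_def using ac(1) by blast
      then show ?thesis using u by blast
    next
      case True
      \<comment> \<open>The twins have the same neighbors, so a component missing all of them could
        be attached only at \<open>p\<close>.\<close>
      have "V \<subseteq> A \<union> {p}"
      proof (rule three_connected)
        show "nb u \<subseteq> A \<union> {p}" if u: "u \<in> A" for u
        proof
          fix w assume w: "w \<in> nb u"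
          have "w \<noteq> a" using w u True E_sym[of u w] by auto
          moreover have "w \<noteq> c" using w u True ac(2) E_sym[of u w] by auto
          ultimately show "w \<in> A \<union> {p}" using w u A nb_V[of u] by (auto simp: nb_closed_def)
        qed
      qed (use A in \<open>auto simp: nb_closed_def\<close>)
      then have "a \<in> A \<union> {p}" using V by blast
      then show ?thesis using A p(2) by (auto simp: nb_closed_def)
    qed
  qed
  then obtain h where h: "col h" "h a = h c" "h a = h p" by auto
  have "pairs_linked a c a p"
    by (rule pairs_linkedI[OF e ac(1) e(1) p(4,2) h(1,2) h(1,3)]) auto
  moreover have "pairs_linked a c c p"
    by (rule pairs_linkedI[OF e ac(1) e(2) p(4,3) h(1,2) h(1)]) (use h in auto)
  ultimately show ?thesis using all_equiv[OF p(1) ac(1) p(2,3) n(1)] f g by blast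
qed

text \<open>Uncrossing: a cut \<open>T\<close> inside \<open>X\<close> would be smaller. Otherwise
  \<open>T - X\<close> has boundary at least 3, its complement containing \<open>v\<close>,
  \<open>a\<close>, \<open>b\<close>, and posimodularity leaves at most 3 for \<open>X - T\<close>,
  which is smaller than \<open>X\<close> and still contains \<open>v\<close> and
  \<open>a\<close>.\<close>

lemma minimal_small_cut:
  assumes X: "X \<subseteq> V" "boundary X \<le> 3"
    and minimal: "\<forall>Y. Y \<subseteq> V \<and> card Y \<ge> 2 \<and> boundary Y \<le> 3 \<longrightarrow> card X \<le> card Y"
    and T: "T \<subseteq> V" "card T \<ge> 2" "boundary T \<le> 3"
    and v: "v \<in> X" "a \<in> X" "v \<noteq> a" "v \<notin> T" "a \<notin> T" and c: "c \<in> X" "c \<in> T"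
    and b: "b \<in> X" "b \<noteq> v" "b \<noteq> a"
  shows False
proof -
  have fin: "finite X" "finite T" using X T finite_V finite_subset by blast+
  show False
  proof (cases "T \<subseteq> X")
    case True
    then have "T \<subset> X" using v by blast
    then have "card T < card X" by (rule psubset_card_mono[OF fin(1)])
    then show False using minimal T by (meson leD)
  next
    case False
    have "{v, a, b} \<subseteq> V - (T - X)" using v b X by blast
    then have "card {v, a, b} \<le> card (V - (T - X))" using finite_V by (intro card_mono) auto
    then have "boundary (T - X) \<ge> 3" using v b False T by (intro boundary_ge_3) auto
    then have "boundary (X - T) \<le> 3" using boundary_posimodular[OF X(1) T(1)] X T by linarith
    moreover have "card (X - T) \<ge> 2"
    proof -
      have "card {v, a} \<le> card (X - T)" using v fin by (intro card_mono) auto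
      then show ?thesis using v by simp
    qed
    ultimately have "card X \<le> card (X - T)" using X(1) minimal by blast
    moreover have "card (X - T) < card X" by (rule psubset_card_mono[OF fin(1)]) (use c in blast)
    ultimately show False by simp
  qed
qed

text \<open>If every vertex of \<open>X\<close> sent an edge outside, \<open>X\<close> would have
  two or three vertices. Without triangles two of them then have at most one neighbor in
  \<open>X\<close>, so at least four edges would leave.\<close>

lemma minimal_cut_interior:
  assumes tf: "\<forall>x y z. E x y \<longrightarrow> E y z \<longrightarrow> \<not> E x z"
    and X: "X \<subseteq> V" "card X \<ge> 2" "boundary X \<le> 3"
  shows "\<exists>v\<in>X. nb v \<subseteq> X"
proof (rule ccontr)
  assume no: "\<not> ?thesis"
  have fin: "finite X" using X finite_V finite_subset by blast
  have out: "card (nb v - X) \<ge> 1" if "v \<in> X" for v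
    using no that finite_nb by (metis Diff_eq_empty_iff card_gt_0_iff finite_Diff less_eq_Suc_le One_nat_def)
  have split: "card (nb v - X) + card (nb v \<inter> X) = 3" if "v \<in> X" for v
    using that X card_nb[of v] finite_nb by (subst card_Un_disjoint[symmetric]) (auto simp: Un_Diff_Int)
  have sum: "(\<Sum>v\<in>X. card (nb v - X)) \<le> 3" using X boundary_sum by metis
  have "card X \<le> 3"
    using sum_mono[of X "\<lambda>_. 1" "\<lambda>v. card (nb v - X)"] out sum by simp
  then consider "card X = 2" | "card X = 3" using X by linarith
  then show False
  proof cases
    case 1
    then obtain x y where xy: "X = {x, y}" "x \<noteq> y" by (metis card_2_iff)
    have "nb x \<inter> X \<subseteq> {y}" "nb y \<inter> X \<subseteq> {x}" using xy E_irrefl by auto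
    then have "card (nb x \<inter> X) \<le> 1" "card (nb y \<inter> X) \<le> 1"
      using card_mono[of "{y}"] card_mono[of "{x}"] by fastforce+
    then have "card (nb x - X) \<ge> 2" "card (nb y - X) \<ge> 2" using split[of x] split[of y] xy by simp_all
    then show False using sum xy by simp
  next
    case 3: 2
    have two: "\<exists>u\<in>X. \<exists>w\<in>X. u \<noteq> w \<and> \<not> E u w"
    proof -
      obtain x y z where "X = {x, y, z}" "x \<noteq> y" "x \<noteq> z" "y \<noteq> z" using 3 by (metis card_3_iff)
      then show ?thesis using tf by (metis insertCI)
    qed
    then obtain u w where uw: "u \<in> X" "w \<in> X" "u \<noteq> w" "\<not> E u w" by blast
    have inner: "card (nb p \<inter> X) \<le> 1" if "p \<in> X" "q \<in> X" "p \<noteq> q" "\<not> E p q" for p q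
    proof -
      have "nb p \<inter> X \<subseteq> X - {p, q}" using that E_irrefl by auto
      then have "card (nb p \<inter> X) \<le> card (X - {p, q})" using fin by (intro card_mono) auto
      then show ?thesis using that 3 fin by (simp add: card_Diff_subset)
    qed
    have "card (nb u - X) \<ge> 2" "card (nb w - X) \<ge> 2"
      using inner[of u w] inner[of w u] uw E_sym[of w u] split[of u] split[of w] by fastforce+
    moreover have "card (nb u - X) + card (nb w - X) \<le> (\<Sum>v\<in>X. card (nb v - X))"
    proof -
      have "(\<Sum>v\<in>{u, w}. card (nb v - X)) \<le> (\<Sum>v\<in>X. card (nb v - X))"
        using uw fin by (intro sum_mono2) auto
      then show ?thesis using uw by simp
    qed
    ultimately show False using sum by linarith
  qed
qed

text \<open>The vertex \<open>v\<close> has slack, so the stuck part hangs on \<open>b\<close>,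
  \<open>a1\<close>, \<open>a2\<close>. If one of these had two stuck neighbors, too few edges would
  remain for the other vertices \<open>T\<close>, and \<open>T\<close> would be a cut crossing the
  minimal \<open>X\<close>, with \<open>c\<close> inside \<open>X\<close> and \<open>v\<close>,
  \<open>a\<close> left out.\<close>

lemma adjacent_pairs_extension:
  assumes tf: "\<forall>x y z. E x y \<longrightarrow> E y z \<longrightarrow> \<not> E x z"
    and twins: "\<forall>x\<in>V. \<forall>y. nb x = nb y \<longrightarrow> x = y"
    and X: "X \<subseteq> V" "boundary X \<le> 3"
    and minimal: "\<forall>Y. Y \<subseteq> V \<and> card Y \<ge> 2 \<and> boundary Y \<le> 3 \<longrightarrow> card X \<le> card Y"
    and v: "v \<in> X" "nb v = {a, b, c}" "a \<noteq> b" "a \<noteq> c" "b \<noteq> c" "{a, b, c} \<subseteq> X"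
    and a: "nb a = {v, a1, a2}" "a1 \<noteq> a2" "v \<noteq> a1" "v \<noteq> a2"
  shows "\<exists>h. col h \<and> h a = h b \<and> h a1 = h a2"
proof -
  have "a \<in> nb v" "b \<in> nb v" "c \<in> nb v" "a1 \<in> nb a" "a2 \<in> nb a" using v(2) a(1) by blast+
  then have e: "E v a" "E v b" "E v c" "E a a1" "E a a2" by simp_all
  note sy = e[THEN E_sym]
  have n: "\<not> E a b" "\<not> E a1 a2" "\<not> E b a" "\<not> E a2 a1" "\<not> E b c"
    using tf e E_sym by blast+
  have nvx: "\<not> E v a1" "\<not> E v a2" using tf e by blast+
  have d: "v \<noteq> a" "v \<noteq> b" "v \<noteq> c" "a \<noteq> a1" "a \<noteq> a2" "b \<noteq> a1" "b \<noteq> a2" "c \<noteq> a1" "c \<noteq> a2"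
    using e nvx E_irrefl by auto
  obtain \<alpha> \<beta> where ab: "\<alpha> \<in> K" "\<beta> \<in> K" "\<alpha> \<noteq> \<beta>" using two_colors .
  define g where "g u = (if u \<in> {a, b} then \<alpha> else \<beta>)" for u
  let ?S = "{a, b, a1, a2}" and ?T = "{b, a1, a2}"
  let ?D = "stuck ?S g"
  have gv: "g a = \<alpha>" "g b = \<alpha>" "g a1 = \<beta>" "g a2 = \<beta>" using d by (auto simp: g_def)
  have SV: "?S \<subseteq> V" using e E_V2 by blast
  have cS: "coloring ?S L g"
    using gv n ab L_const SV E_irrefl unfolding coloring_def by auto
  have "slack L ?S g v"
    using e gv v(3) unfolding slack_def by (intro disjI2 bexI[of _ a] bexI[of _ b]) auto
  then have vD: "v \<notin> ?D" by (rule stuck_not_slack)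
  have DS: "?D \<subseteq> V" "?D \<inter> ?S = {}" using stuck_subset[of ?S g] by blast+
  have vS: "v \<notin> ?S" using d a by blast
  have inner: "u \<notin> ?D" if "E a u" for u
  proof -
    have "u \<in> nb a" using that by simp
    then have "u = v \<or> u \<in> ?S" unfolding a(1) by blast
    then show ?thesis using vD DS(2) by (elim disjE) (simp, meson disjoint_iff)
  qed
  have "\<exists>h. col h \<and> (\<forall>s\<in>?S. h s = g s)"
  proof (rule four_leg_extension[OF refl SV _ _ _ cS])
    fix s p q assume D0: "?D \<noteq> {}" and s: "s \<in> ?T" and p: "p \<in> ?D" and q: "q \<in> ?D"
      and pq: "E s p" "E s q"
    show "p = q"
    proof (rule ccontr)
      assume pq': "p \<noteq> q"
      have nbD: "nb x \<subseteq> ?D \<union> ?T" if x: "x \<in> ?D" for x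
      proof
        fix y assume y: "y \<in> nb x"
        have "y \<noteq> a" using inner[of x] y x E_sym[of x y] by auto
        then show "y \<in> ?D \<union> ?T" using stuck_nb[OF x] y by auto
      qed
      have c3: "card ?T = 3" using d a by auto
      have att: "\<exists>x\<in>?D. E t x" if "t \<in> ?T" for t
        by (rule attach[OF DS(1) D0 c3 _ _ nbD that]) (use SV DS in auto)
      define T where "T = V - ?S - ?D - {v}"
      have cD: "c \<notin> ?D"
      proof
        assume "c \<in> ?D"
        then have "v \<in> ?D \<union> ?S" using sy(3) by (rule stuck_nb)
        then show False using vD vS by blast
      qed
      have cT: "c \<in> T" using d v cD e E_V2 unfolding T_def by blast
      have nbT: "nb x \<subseteq> T \<union> {v, b, a1, a2}" if x: "x \<in> T" for x
      proof
        fix y assume y: "y \<in> nb x"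
        have "y \<notin> ?D" using stuck_nb[of y ?S g x] x y E_sym unfolding T_def by auto
        moreover have "y \<noteq> a"
        proof
          assume "y = a"
          then have "x \<in> nb a" using y E_sym by simp
          then show False using a(1) x unfolding T_def by blast
        qed
        ultimately show "y \<in> T \<union> {v, b, a1, a2}" using y nb_V[of x] unfolding T_def by blast
      qed
      have finT: "finite T" using finite_V by (simp add: T_def)
      have finD: "finite ?D" using DS finite_V finite_subset by blast
      define dT where "dT t = card (nb t \<inter> T)" for t
      define dD where "dD t = card (nb t \<inter> ?D)" for t
      have dsum: "dT t + dD t \<le> 2" if t: "t \<in> ?T" for t
      proof -
        define r where "r = (if t = b then v else a)"
        have r: "r \<in> nb t" "r \<notin> T" "r \<notin> ?D"
          using t sy vD DS d unfolding r_def T_def by auto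
        have "nb t \<inter> T \<union> nb t \<inter> ?D \<subseteq> nb t - {r}" using r by blast
        then have "card (nb t \<inter> T \<union> nb t \<inter> ?D) \<le> card (nb t - {r})"
          using finite_nb by (intro card_mono) auto
        moreover have "card (nb t - {r}) = 2" using r card_nb[of t] t SV finite_nb by auto
        moreover have "card (nb t \<inter> T \<union> nb t \<inter> ?D) = dT t + dD t"
          unfolding dT_def dD_def using finite_nb by (intro card_Un_disjoint) (auto simp: T_def)
        ultimately show ?thesis by simp
      qed
      have dD1: "dD t \<ge> 1" if t: "t \<in> ?T" for t
      proof -
        obtain x where "x \<in> ?D" "E t x" using att[OF t] by blast
        then have "nb t \<inter> ?D \<noteq> {}" by auto
        then show ?thesis using finD unfolding dD_def by (simp add: Suc_le_eq card_gt_0_iff)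
      qed
      have dD2: "dD s \<ge> 2"
      proof -
        have "card {p, q} \<le> dD s" unfolding dD_def using p q pq finD by (intro card_mono) auto
        then show ?thesis using pq' by simp
      qed
      have "boundary T \<le> 3"
      proof -
        have sub: "edges_between (V - T) T \<subseteq> {(v, c)} \<union> (SIGMA t:?T. nb t \<inter> T)"
        proof
          fix z assume "z \<in> edges_between (V - T) T"
          then obtain y x where z: "z = (y, x)" "y \<notin> T" "x \<in> T" "E y x"
            by (auto simp: edges_between_def)
          then have "y \<in> T \<union> {v, b, a1, a2}" using nbT[OF z(3)] E_sym[OF z(4)] by auto
          then have y: "y = v \<or> y \<in> ?T" using z(2) by blast
          show "z \<in> {(v, c)} \<union> (SIGMA t:?T. nb t \<inter> T)"
          proof (cases "y = v")
            case True
            then have "x \<in> {a, b, c}" using z v(2) by (metis in_nb)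
            then have "x = c" using z(3) unfolding T_def by blast
            then show ?thesis using z True by simp
          next
            case False
            then show ?thesis using y z by auto
          qed
        qed
        have "boundary T = card (edges_between (V - T) T)"
          unfolding boundary_def by (rule card_edges_between_sym)
        also have "\<dots> \<le> card ({(v, c)} \<union> (SIGMA t:?T. nb t \<inter> T))"
          using sub finT by (intro card_mono) auto
        also have "\<dots> \<le> 1 + card (SIGMA t:?T. nb t \<inter> T)"
          using card_Un_le[of "{(v, c)}" "SIGMA t:?T. nb t \<inter> T"] by simp
        also have "card (SIGMA t:?T. nb t \<inter> T) = (\<Sum>t\<in>?T. dT t)"
          unfolding dT_def using finT by (intro card_SigmaI) auto
        also have "\<dots> = dT b + dT a1 + dT a2" using d a by simp
        finally have "boundary T \<le> 1 + (dT b + dT a1 + dT a2)" by simp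
        moreover have "s = b \<or> s = a1 \<or> s = a2" using s by blast
        ultimately show ?thesis
          using dsum[of b] dsum[of a1] dsum[of a2] dD1[of b] dD1[of a1] dD1[of a2] dD2 by auto
      qed
      \<comment> \<open>A single vertex \<open>c\<close> would have the neighbors \<open>v\<close>,
        \<open>a1\<close>, \<open>a2\<close> and thus be a twin of \<open>a\<close>.\<close>
      moreover have "card T \<ge> 2"
      proof (rule ccontr)
        assume "\<not> ?thesis"
        moreover have "card T \<noteq> 0" using cT finT by auto
        ultimately have "card T = 1" by linarith
        then have T1: "T = {c}" using cT by (metis card_1_singletonE singletonD)
        have "nb c \<subseteq> {v, a1, a2}" using nbT[OF cT] T1 E_irrefl[of c] n(5) E_sym[of c b] by auto
        then have "nb c = nb a"
          using card_nb[of c] card_nb[of a] E_V2[OF e(3)] E_V2[OF e(1)] finite_nb a(1)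
          by (metis card_subset_eq)
        then show False using twins E_V2[OF e(3)] v by blast
      qed
      ultimately show False
        using minimal_small_cut[OF X minimal, of T v a c b] v d cT unfolding T_def by auto
    qed
  qed (use gv ab d a inner in auto)
  then show ?thesis using gv by auto
qed

theorem triangle_free_equiv:
  assumes tf: "\<forall>x y z. E x y \<longrightarrow> E y z \<longrightarrow> \<not> E x z" and f: "col f" and g: "col g"
  shows "eqv f g"
proof (cases "\<exists>x y. x \<in> V \<and> nb x = nb y \<and> x \<noteq> y")
  case True
  then obtain x y where xy: "x \<in> V" "nb x = nb y" "x \<noteq> y" by blast
  then have "nb x \<noteq> {}" using card_nb by fastforce
  then obtain u where "E x u" by auto
  then show ?thesis using twins_equiv[OF tf xy(3,2)] f g by blast
next
  case False
  then have twins: "\<forall>x\<in>V. \<forall>y. nb x = nb y \<longrightarrow> x = y" by blast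
  let ?P = "\<lambda>X. X \<subseteq> V \<and> card X \<ge> 2 \<and> boundary X \<le> 3"
  have "?P V"
  proof -
    obtain v where v: "v \<in> V" using V_nonempty by blast
    have "card (nb v) \<le> card V" using nb_V finite_V by (intro card_mono) auto
    then show ?thesis using card_nb[OF v] by (auto simp: boundary_def edges_between_def)
  qed
  then obtain X where X: "?P X" and minimal: "\<forall>Y. ?P Y \<longrightarrow> card X \<le> card Y"
    using ex_has_least_nat[of ?P V card] by blast
  obtain v where v: "v \<in> X" "nb v \<subseteq> X" using minimal_cut_interior[OF tf] X by blast
  then have "v \<in> V" using X by blast
  then obtain a b c where nb: "nb v = {a, b, c}" "a \<noteq> b" "a \<noteq> c" "b \<noteq> c"
    using card_nb by (metis card_3_iff)
  \<comment> \<open>The pairs at \<open>v\<close> are linked through the two other neighbors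
    \<open>a1\<close>, \<open>a2\<close> of \<open>a\<close>, a pair that can be made equal together
    with either of them.\<close>
  have link: "pairs_linked a b a c" if nb: "nb v = {a, b, c}" "a \<noteq> b" "a \<noteq> c" "b \<noteq> c" for a b c
  proof -
    have "a \<in> nb v" "b \<in> nb v" "c \<in> nb v" using nb by blast+
    then have e: "E v a" "E v b" "E v c" by simp_all
    obtain a1 a2 where a: "nb a = {v, a1, a2}" "v \<noteq> a1" "v \<noteq> a2" "a1 \<noteq> a2" "E a a1" "E a a2"
      using nb_obtain2[OF E_sym[OF e(1)]] .
    have nb': "nb v = {a, c, b}" using nb(1) by blast
    have sub: "{a, b, c} \<subseteq> X" "{a, c, b} \<subseteq> X" using nb v(2) by blast+
    have X1: "X \<subseteq> V" "boundary X \<le> 3" using X by blast+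
    obtain h1 where h1: "col h1" "h1 a = h1 b" "h1 a1 = h1 a2"
      using adjacent_pairs_extension[OF tf twins X1 minimal v(1) nb sub(1) a(1,4,2,3)] by blast
    obtain h2 where h2: "col h2" "h2 a = h2 c" "h2 a1 = h2 a2"
      using adjacent_pairs_extension[OF tf twins X1 minimal v(1) nb' nb(3,2) nb(4)[symmetric] sub(2) a(1,4,2,3)]
      by blast
    have l1: "pairs_linked a b a1 a2"
      by (rule pairs_linkedI[OF e(1,2) nb(2) a(5,6,4) h1(1,2) h1(1,3)]) simp
    have l2: "pairs_linked a1 a2 a c"
      by (rule pairs_linkedI[OF a(5,6,4) e(1,3) nb(3) h2(1,3) h2(1,2)]) simp
    have "\<not> E a1 a2" using tf a(5,6) E_sym by blast
    then show ?thesis using pairs_linked_trans[OF l1 l2 a(5,6,4)] by blast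
  qed
  have "a \<in> nb v" "b \<in> nb v" using nb by blast+
  then have ne: "\<not> E a b" using tf by (metis in_nb)
  have comm: "pairs_linked b a b c" using link[of b a c] nb by (simp add: insert_commute)
  have "pairs_linked a b b c" using comm unfolding pairs_linked_def by metis
  then show ?thesis using all_equiv[OF nb ne link[OF nb]] f g by blast
qed

lemma coloring_exists: "\<exists>f. col f"
proof -
  obtain v where v: "v \<in> V" using V_nonempty by blast
  then obtain a b c where nb: "nb v = {a, b, c}" "a \<noteq> b" "a \<noteq> c" "b \<noteq> c"
    using card_nb by (metis card_3_iff)
  have "a \<in> nb v" "b \<in> nb v" "c \<in> nb v" using nb by blast+
  then have e: "E v a" "E v b" "E v c" by simp_all
  have "\<not> E a b \<or> \<not> E a c" using no_diamond[of v a b c] e nb by blast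
  then show ?thesis using pair_exists e nb by blast
qed

theorem constant_lists_equiv:
  assumes "\<And>v1 v2 v3 w1 w2 w3. \<not> prism v1 v2 v3 w1 w2 w3" "col f" "col g"
  shows "eqv f g"
  using triangle_equiv triangle_free_equiv assms by metis

end

section \<open>Kempe equivalence in symmetric digraphs\<close>

context pair_graph
begin

abbreviation adj :: "'a \<Rightarrow> 'a \<Rightarrow> bool" where
  "adj u v \<equiv> (u, v) \<in> parcs G"

lemma adj_sym: "adj u v \<Longrightarrow> adj v u"
  by (rule arcs_symmetric)

lemma adj_irrefl: "\<not> adj u u"
  using no_loops by fastforce

sublocale gr: simple_graph adj
  by unfold_locales (use adj_sym adj_irrefl in auto)

lemma list_coloring_iff:
  "list_coloring G L f \<longleftrightarrow> f \<in> extensional (pverts G) \<and> gr.coloring (pverts G) L f"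
  using in_arcsD1 in_arcsD2
  by (auto simp: list_coloring_def gr.coloring_def PiE_def Pi_def arcs_ends_conv)

lemma arcs_ends_restrict:
  "arcs_ends (G \<restriction> W) = {(u, v). adj u v \<and> u \<in> W \<and> v \<in> W}"
  by (auto simp: arcs_ends_conv arcs_ends_def induce_subgraph_def arc_to_ends_def)

lemma reachable_closed:
  assumes "u \<rightarrow>\<^sup>*\<^bsub>H\<^esub> v" "u \<in> C" "\<And>x y. x \<in> C \<Longrightarrow> (x, y) \<in> arcs_ends H \<Longrightarrow> y \<in> C"
  shows "v \<in> C"
  using assms(1) unfolding reachable_def
  by (induction rule: rtrancl_on_induct) (use assms(2,3) in auto)

text \<open>The last two facts characterize the component as the least set containing
  \<open>u\<close> that is closed under adjacency among the two colors; no later argument has to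
  mention reachability in it.\<close>

lemma kempe_component_props:
  fixes f :: "'a \<Rightarrow> 'c" and \<alpha> \<beta> :: 'c
  assumes u: "u \<in> pverts G" "f u \<in> {\<alpha>, \<beta>}"
  defines "W \<equiv> {w \<in> pverts G. f w \<in> {\<alpha>, \<beta>}}" and "C \<equiv> kempe_component G f \<alpha> \<beta> u"
  shows "u \<in> C" and "C \<subseteq> W"
    and "\<And>x y. x \<in> C \<Longrightarrow> y \<in> W \<Longrightarrow> adj x y \<Longrightarrow> y \<in> C"
    and "\<And>D. u \<in> D \<Longrightarrow> (\<And>x y. x \<in> D \<Longrightarrow> y \<in> W \<Longrightarrow> adj x y \<Longrightarrow> y \<in> D) \<Longrightarrow> C \<subseteq> D"
proof -
  let ?H = "with_proj G \<restriction> W"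
  have W: "W = {w \<in> verts G. f w \<in> {\<alpha>, \<beta>}}" by (simp add: W_def)
  have C: "C = {v. u \<rightarrow>\<^sup>*\<^bsub>?H\<^esub> v \<and> v \<rightarrow>\<^sup>*\<^bsub>?H\<^esub> u}"
    unfolding C_def kempe_component_def W pre_digraph.scc_of_def ..
  have vH: "verts ?H = W" by (simp add: induce_subgraph_def)
  have uW: "u \<in> W" using u by (simp add: W_def)
  show "u \<in> C" using uW by (simp add: C reachable_def vH)
  show "C \<subseteq> W"
  proof
    fix v assume "v \<in> C"
    then have "u \<rightarrow>\<^sup>*\<^bsub>?H\<^esub> v" by (simp add: C)
    then show "v \<in> W" by (rule reachable_closed) (use uW in \<open>auto simp: arcs_ends_restrict\<close>)
  qed
  note CW = this
  show "y \<in> C" if x: "x \<in> C" and y: "y \<in> W" and e: "adj x y" for x y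
  proof -
    have xW: "x \<in> W" using x CW by blast
    have a: "(x, y) \<in> arcs_ends ?H" "(y, x) \<in> arcs_ends ?H"
      using e adj_sym xW y by (auto simp: arcs_ends_restrict)
    have x': "(u, x) \<in> rtrancl_on W (arcs_ends ?H)" "(x, u) \<in> rtrancl_on W (arcs_ends ?H)"
      using x by (auto simp: C reachable_def vH)
    have "(u, y) \<in> rtrancl_on W (arcs_ends ?H)"
      using x'(1) a(1) y by (rule rtrancl_on_into_rtrancl_on)
    moreover have "(y, u) \<in> rtrancl_on W (arcs_ends ?H)"
      using a(2) x'(2) y by (rule converse_rtrancl_on_into_rtrancl_on)
    ultimately show ?thesis by (simp add: C reachable_def vH)
  qed
  show "C \<subseteq> D" if D: "u \<in> D" "\<And>x y. x \<in> D \<Longrightarrow> y \<in> W \<Longrightarrow> adj x y \<Longrightarrow> y \<in> D" for D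
  proof
    fix v assume "v \<in> C"
    then have "u \<rightarrow>\<^sup>*\<^bsub>?H\<^esub> v" by (simp add: C)
    then show "v \<in> D" by (rule reachable_closed) (use D in \<open>auto simp: arcs_ends_restrict\<close>)
  qed
qed

text \<open>The components in \<open>C\<close> are swapped one at a time. Every intermediate
  coloring takes each value from \<open>f\<close> or \<open>g\<close>, so it respects the lists, and
  what remains of \<open>C\<close> is still a union of chains.\<close>

lemma swap_on_kempe_equivalent:
  fixes f g :: "'a \<Rightarrow> 'c"
  assumes "gr.swap_on (pverts G) \<alpha> \<beta> C f g"
    and "list_coloring G L f" "list_coloring G L g"
  shows "kempe_equivalent G L f g"
  using assms
proof (induction "card C" arbitrary: C f rule: less_induct)
  case less
  let ?V = "pverts G"
  have CV: "C \<subseteq> ?V" using less.prems(1) by (simp add: gr.swap_on_def)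
  have finC: "finite C" using CV finite_verts finite_subset by fastforce
  have ext: "f \<in> extensional ?V" "g \<in> extensional ?V"
    and col: "gr.coloring ?V L f" "gr.coloring ?V L g"
    using less.prems list_coloring_iff by blast+
  have gz: "g z = (if z \<in> C then transpose \<alpha> \<beta> (f z) else f z)" if "z \<in> ?V" for z
    using less.prems(1) that by (simp add: gr.swap_on_def)
  show ?case
  proof (cases "C = {} \<or> \<alpha> = \<beta>")
    case True
    have "f = g"
      by (rule extensionalityI[OF ext]) (use gz True in auto)
    then show ?thesis by (simp add: kempe_equivalent_def)
  next
    case False
    then obtain u where u: "u \<in> C" by blast
    have uV: "u \<in> ?V" "f u \<in> {\<alpha>, \<beta>}" using u CV less.prems(1) by (auto simp: gr.swap_on_def)
    let ?W = "{w \<in> ?V. f w \<in> {\<alpha>, \<beta>}}"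
    define K where "K = kempe_component G f \<alpha> \<beta> u"
    note comp = kempe_component_props[of u f \<alpha> \<beta>, OF uV, folded K_def]
    have KC: "K \<subseteq> C"
    proof (rule comp(4)[OF u])
      show "y \<in> C" if "x \<in> C" "y \<in> ?W" "adj x y" for x y
        using less.prems(1) that by (auto simp: gr.swap_on_def)
    qed
    define h where "h = kempe_swap G \<alpha> \<beta> u f"
    have h: "h z = (if z \<in> K then transpose \<alpha> \<beta> (f z) else f z)" for z
      by (simp add: h_def kempe_swap_def K_def)
    have "gr.swap_on ?V \<alpha> \<beta> K f h"
      unfolding gr.swap_on_def
    proof (intro conjI ballI impI)
      fix z y assume "z \<in> K" "y \<in> ?V - K" "adj z y"
      then show "f y \<notin> {\<alpha>, \<beta>}" using comp(3)[of z y] by auto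
    qed (use comp(2) h in auto)
    then have "gr.step ?V L f h"
    proof (rule gr.swap_on_step[OF _ col(1)])
      show "h z \<in> L z" if "z \<in> K" for z
      proof -
        have "z \<in> C" "z \<in> ?V" using that KC CV by blast+
        then show ?thesis using col(2) gz[of z] h[of z] that by (auto simp: gr.coloring_def)
      qed
    qed
    moreover have "h \<in> extensional ?V"
      using ext(1) KC CV h by (auto simp: extensional_def)
    ultimately have lh: "list_coloring G L h"
      by (simp add: gr.step_def list_coloring_iff)
    have "valid_kempe_step G L f h"
      unfolding valid_kempe_step_def using less.prems(2) lh uV False h_def by auto
    moreover have "kempe_equivalent G L h g"
    proof (rule less.hyps[of "C - K"])
      show "card (C - K) < card C"
        using u comp(1) finC by (intro psubset_card_mono) auto
      show "gr.swap_on ?V \<alpha> \<beta> (C - K) h g"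
        unfolding gr.swap_on_def
      proof (intro conjI ballI impI)
        fix z assume "z \<in> C - K"
        then show "h z \<in> {\<alpha>, \<beta>}" using less.prems(1) h by (auto simp: gr.swap_on_def)
      next
        fix z y assume z: "z \<in> C - K" and y: "y \<in> ?V - (C - K)" and e: "adj z y"
        have zW: "z \<in> ?W" using z less.prems(1) CV by (auto simp: gr.swap_on_def)
        have "y \<notin> K" using comp(3)[of y z] zW z adj_sym[OF e] by blast
        moreover have "y \<in> ?V - C" using y \<open>y \<notin> K\<close> by blast
        ultimately show "h y \<notin> {\<alpha>, \<beta>}"
          using less.prems(1) z e h[of y] by (auto simp: gr.swap_on_def)
      next
        fix z assume "z \<in> ?V"
        then show "g z = (if z \<in> C - K then transpose \<alpha> \<beta> (h z) else h z)"
          using gz h KC by auto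
      qed (use CV in auto)
    qed fact+
    ultimately show ?thesis
      unfolding kempe_equivalent_def by (rule converse_rtranclp_into_rtranclp)
  qed
qed

text \<open>Intermediate functions need not be extensional, so the steps are carried out on their
  restrictions to the vertex set.\<close>

lemma equiv_on_kempe_equivalent:
  assumes eq: "gr.equiv_on (pverts G) L f g" and f: "list_coloring G L f" and g: "list_coloring G L g"
  shows "kempe_equivalent G L f g"
proof -
  let ?V = "pverts G"
  have "kempe_equivalent G L f (restrict g ?V)"
    using eq
  proof (induction rule: rtranclp_induct)
    case base
    have "restrict f ?V = f"
      using f list_coloring_iff by (metis extensional_restrict)
    then show ?case by (simp add: kempe_equivalent_def)
  next
    case (step h k)
    have lc: "list_coloring G L (restrict p ?V)" if "gr.coloring ?V L p" for p
      using that gr.coloring_cong[OF that, of "restrict p ?V"] by (simp add: list_coloring_iff)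
    obtain \<alpha> \<beta> C where sw: "gr.swap_on ?V \<alpha> \<beta> C h k"
      and hk: "gr.coloring ?V L h" "gr.coloring ?V L k"
      using step.hyps(2) by (auto simp: gr.step_def)
    have "gr.swap_on ?V \<alpha> \<beta> C (restrict h ?V) (restrict k ?V)"
      using sw by (auto simp: gr.swap_on_def subset_iff)
    from swap_on_kempe_equivalent[OF this lc[OF hk(1)] lc[OF hk(2)]]
    show ?case using step.IH unfolding kempe_equivalent_def by (meson rtranclp_trans)
  qed
  then show ?thesis using g list_coloring_iff by (metis extensional_restrict)
qed

section \<open>Connectivity and the two exceptional graphs\<close>

lemma connectivity_connected:
  assumes conn: "vertex_connectivity G = 3" and S: "S \<subseteq> pverts G" "card S \<le> 2"
  shows "connected (G \<restriction> (pverts G - S))"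
proof -
  let ?P = "\<lambda>k. \<exists>T\<subseteq>verts G. card T = k \<and>
      (\<not> connected (G \<restriction> (verts G - T)) \<or> card (verts G - T) = 1)"
  have "card S < (LEAST k. ?P k)" using assms unfolding vertex_connectivity_def by linarith
  then have "\<not> ?P (card S)" by (rule not_less_Least)
  then show ?thesis using S(1) by auto
qed

text \<open>Within the connected graph left by \<open>S\<close>, no edge leads out of
  \<open>A\<close>, so everything reachable from a vertex of \<open>A\<close> lies in
  \<open>A\<close>.\<close>

lemma connectivity_closed:
  assumes conn: "vertex_connectivity G = 3"
    and A: "A \<subseteq> pverts G" "A \<noteq> {}" and S: "finite S" "card S \<le> 2" "A \<inter> S = {}"
    and nb: "\<And>u. u \<in> A \<Longrightarrow> gr.nb u \<subseteq> A \<union> S"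
  shows "pverts G \<subseteq> A \<union> S"
proof -
  let ?V = "pverts G"
  let ?S = "S \<inter> ?V"
  let ?H = "with_proj G \<restriction> (?V - ?S)"
  have "card ?S \<le> 2" using S(1,2) card_mono[of S ?S] by simp
  then have "connected ?H" using connectivity_connected[OF conn, of ?S] by simp
  then have sc: "strongly_connected (mk_symmetric ?H)" by (simp add: connected_def)
  obtain u where u: "u \<in> A" using A by blast
  have vH: "verts (mk_symmetric ?H) = ?V - ?S"
    by (simp add: mk_symmetric_def induce_subgraph_def)
  have eH: "(x, y) \<in> arcs_ends (mk_symmetric ?H) \<Longrightarrow> adj x y \<and> y \<in> ?V - ?S" for x y
    using adj_sym by (auto simp: mk_symmetric_def induce_subgraph_def arcs_ends_conv arcs_ends_def arc_to_ends_def)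
  show ?thesis
  proof
    fix v assume v: "v \<in> ?V"
    show "v \<in> A \<union> S"
    proof (cases "v \<in> S")
      case False
      have "u \<in> verts (mk_symmetric ?H)" "v \<in> verts (mk_symmetric ?H)"
        using u v False A S vH by auto
      then have "u \<rightarrow>\<^sup>*\<^bsub>mk_symmetric ?H\<^esub> v" using sc by (auto simp: strongly_connected_def)
      then have "v \<in> A"
      proof (rule reachable_closed[OF _ u])
        fix x y assume x: "x \<in> A" and "(x, y) \<in> arcs_ends (mk_symmetric ?H)"
        then have "adj x y" "y \<in> ?V - ?S" using eH by blast+
        then show "y \<in> A" using nb[OF x] by auto
      qed
      then show ?thesis by blast
    qed auto
  qed
qed

lemma out_degree_nb: "out_degree G v = card (gr.nb v)"
proof -
  have "out_arcs G v = Pair v ` gr.nb v"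
    by (auto simp: out_arcs_def gr.nb_def)
  then show ?thesis by (simp add: out_degree_def card_image inj_on_def)
qed

lemma complete_4:
  assumes "card (pverts G) = 4" "\<And>v. v \<in> pverts G \<Longrightarrow> card (gr.nb v) = 3"
  shows "K\<^bsub>4\<^esub> G"
proof -
  have nb: "gr.nb v = pverts G - {v}" if v: "v \<in> pverts G" for v
  proof (rule card_subset_eq)
    show "finite (pverts G - {v})" using finite_verts by auto
    show "gr.nb v \<subseteq> pverts G - {v}" using in_arcsD2 adj_irrefl by (auto simp: gr.nb_def)
    show "card (gr.nb v) = card (pverts G - {v})" using assms v by simp
  qed
  have "graph (with_proj G)" by unfold_locales
  moreover have "arcs_ends G = {(u, v). (u, v) \<in> pverts G \<times> pverts G \<and> u \<noteq> v}"
    using nb in_arcsD1 in_arcsD2 adj_irrefl by (auto simp: arcs_ends_conv gr.nb_def)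
  ultimately show ?thesis using assms(1) by (simp add: complete_digraph_def)
qed

lemma prism_iso:
  assumes V: "pverts G = {v1, v2, v3, w1, w2, w3}" and d: "distinct [v1, v2, v3, w1, w2, w3]"
    and nb: "gr.nb v1 = {v2, v3, w1}" "gr.nb v2 = {v1, v3, w2}" "gr.nb v3 = {v1, v2, w3}"
      "gr.nb w1 = {w2, w3, v1}" "gr.nb w2 = {w1, w3, v2}" "gr.nb w3 = {w1, w2, v3}"
  shows "digraph_iso G (complete_graph 2 \<box> complete_graph 3)"
proof -
  \<comment> \<open>The first coordinate tells the two triangles apart, the second numbers the three
    edges between them.\<close>
  define p :: "'a \<Rightarrow> nat \<times> nat" where
    "p u = (if u \<in> {v1, v2, v3} then 0 else 1,
            if u \<in> {v1, w1} then 0 else if u \<in> {v2, w2} then 1 else 2)" for u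
  have pv: "p v1 = (0, 0)" "p v2 = (0, 1)" "p v3 = (0, 2)" "p w1 = (1, 0)" "p w2 = (1, 1)" "p w3 = (1, 2)"
    using d by (auto simp: p_def)
  have inj: "inj_on p (pverts G)"
    unfolding V by (simp add: inj_on_def pv)
  have two: "{..<2} = {0, 1 :: nat}" and three: "{..<3} = {0, 1, 2 :: nat}" by auto
  let ?q = "\<lambda>(u, v). (p u, p v)"
  have vs: "p ` pverts G = pverts (complete_graph 2 \<box> complete_graph 3)"
    unfolding V by (auto simp: pv cartesian_product_def complete_graph_def two three)
  let ?P = "complete_graph 2 \<box> complete_graph 3"
  have adj: "adj v1 x \<longleftrightarrow> x \<in> {v2, v3, w1}" "adj v2 x \<longleftrightarrow> x \<in> {v1, v3, w2}"
    "adj v3 x \<longleftrightarrow> x \<in> {v1, v2, w3}" "adj w1 x \<longleftrightarrow> x \<in> {w2, w3, v1}"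
    "adj w2 x \<longleftrightarrow> x \<in> {w1, w3, v2}" "adj w3 x \<longleftrightarrow> x \<in> {w1, w2, v3}" for x
    using nb gr.in_nb by metis+
  have key: "\<forall>u\<in>pverts G. \<forall>v\<in>pverts G. adj u v \<longleftrightarrow> (p u, p v) \<in> parcs ?P"
    unfolding V using d by (simp add: adj pv cartesian_product_def complete_graph_def eq_commute)
  have as: "?q ` parcs G = parcs ?P"
  proof (intro equalityI subsetI)
    fix e assume "e \<in> ?q ` parcs G"
    then obtain u v where uv: "adj u v" "e = (p u, p v)" by auto
    have "u \<in> pverts G" "v \<in> pverts G" using in_arcsD1[OF uv(1)] in_arcsD2[OF uv(1)] .
    then show "e \<in> parcs ?P" using key uv by blast
  next
    fix e assume e: "e \<in> parcs ?P"
    obtain x y where xy: "e = (x, y)" by (cases e)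
    have "x \<in> pverts ?P" "y \<in> pverts ?P"
      using e xy by (auto simp: cartesian_product_def complete_graph_def)
    then obtain u v where uv: "u \<in> pverts G" "x = p u" "v \<in> pverts G" "y = p v"
      using vs by blast
    then have "adj u v" using key e xy by blast
    then show "e \<in> ?q ` parcs G" using xy uv by force
  qed
  define F :: "('a, 'a \<times> 'a, nat \<times> nat, (nat \<times> nat) \<times> nat \<times> nat) digraph_isomorphism" where
    "F = \<lparr> iso_verts = p, iso_arcs = ?q, iso_head = snd, iso_tail = fst \<rparr>"
  have "wf_digraph (with_proj G)" by unfold_locales
  moreover have "inj_on ?q (parcs G)"
    using inj in_arcsD1 in_arcsD2 by (auto simp: inj_on_def)
  ultimately have "pre_digraph.digraph_isomorphism (with_proj G) F"
    unfolding pre_digraph.digraph_isomorphism_def using inj by (auto simp: F_def)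
  moreover have "with_proj (complete_graph 2 \<box> complete_graph 3) = app_iso F (with_proj G)"
    using vs as by (simp add: app_iso_def F_def with_proj_def)
  ultimately show ?thesis unfolding digraph_iso_def by blast
qed

end

theorem theorem3:
  fixes G :: "'a pair_pre_digraph" and L :: "'a \<Rightarrow> 'c set"
  assumes "pair_graph G"
    and "regular 3 G"
    and "vertex_connectivity G = 3"
    and "list_assignment 3 G L"
    and "\<not> K\<^bsub>4\<^esub> G"
    and "\<not> (digraph_iso G (complete_graph 2 \<box> complete_graph 3) \<and>
             (\<forall>v \<in> pverts G. \<forall>w \<in> pverts G. L v = L w))"
  shows "swappable G L"
proof -
  interpret pair_graph G by fact
  let ?V = "pverts G"
  have nb3: "card (gr.nb v) = 3" if "v \<in> ?V" for v
    using assms(2) that by (simp add: regular_def out_degree_nb)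
  have card_V: "card ?V \<noteq> 4" using complete_4 nb3 assms(5) by blast
  interpret cubic_graph adj ?V L
  proof unfold_locales
    show "finite ?V" using finite_verts by simp
    show "u \<in> ?V" if "adj u v" for u v using in_arcsD1[OF that] .
    show "card (L v) = 3" if "v \<in> ?V" for v using assms(4) that by (simp add: list_assignment_def)
  qed (fact nb3 card_V connectivity_closed[OF assms(3)])+
  have equiv: "(\<exists>f. col f) \<and> (\<forall>f g. col f \<longrightarrow> col g \<longrightarrow> eqv f g)"
  proof (cases "\<forall>v\<in>?V. \<forall>w\<in>?V. L v = L w")
    case False
    then obtain x w where "x \<in> ?V" "w \<in> ?V" "L x \<noteq> L w" by blast
    from nonconstant_lists[OF this] show ?thesis by blast
  next
    case True
    \<comment> \<open>Connectedness includes having a vertex, whose list serves as the constant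
      one.\<close>
    have "connected (G \<restriction> ?V)" using connectivity_connected[OF assms(3), of "{}"] by simp
    then obtain v0 where v0: "v0 \<in> ?V"
      by (auto simp: connected_def strongly_connected_def mk_symmetric_def induce_subgraph_def)
    interpret constant_lists adj ?V L "L v0"
    proof unfold_locales
      show "L v = L v0" if "v \<in> ?V" for v using True v0 that by blast
      show "?V \<noteq> {}" using v0 by blast
    qed
    have "\<not> prism v1 v2 v3 w1 w2 w3" for v1 v2 v3 w1 w2 w3
      using prism_iso[of v1 v2 v3 w1 w2 w3] assms(6) True unfolding prism_def triangle_def by blast
    then show ?thesis using coloring_exists constant_lists_equiv by blast
  qed
  obtain f where f: "col f" using equiv by blast
  have "col (restrict f ?V)" by (rule gr.coloring_cong[OF f]) simp
  then have "list_coloring G L (restrict f ?V)" by (simp add: list_coloring_iff)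
  moreover have "kempe_equivalent G L g h" if "list_coloring G L g" "list_coloring G L h" for g h
    using that equiv equiv_on_kempe_equivalent list_coloring_iff by blast
  ultimately show ?thesis unfolding swappable_def by blast
qed

end
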